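(* Let $(M,\{,\ldots,\})$ be a Nambu-Poisson manifold of order $n$ with associated Nambu tensor $\Pi$, and let $N\subset M$ be a submanifold with inclusion $i:N\hookrightarrow M$. Let $E\subset TM|_N$ be a vector subbundle (not necessarily canonical) such that $F:=E\cap TN$ is a regular, integrable distribution on $N$. Assume that $D$ is a subbundle of $TM|_N$ satisfying $F\subseteq D\subseteq E$ and $$\Pi^\sharp(Ann^1E)\subseteq TN+D.$$ Moreover, let $\mathcal B\subseteq C^\infty(M)_E$ be a multiplicative subalgebra such that the restriction map $i^*:\mathcal B\to C^\infty(N)_F$ is surjective and $$\{\mathcal B,\ldots,\mathcal B\}\subseteq C^\infty(M)_D .$$ Then $(M,N,E)$ is reducible.
   Context: A Nambu-Poisson manifold of order $n$ is a smooth manifold $M$ ($n\le\dim M$) with an $n$-multilinear skew-symmetric bracket $\{,\ldots,\}$ on $C^\infty(M)$ satisfying the Leibniz rule $\{f_1,\ldots,f_{n-1},gh\}=g\{f_1,\ldots,f_{n-1},h\}+\{f_1,\ldots,f_{n-1},g\}h$ and the fundamental identity $\{g_1,\ldots,g_{n-1},\{f_1,\ldots,f_n\}\}=\sum_{k=1}^n\{f_1,\ldots,f_{k-1},\{g_1,\ldots,g_{n-1},f_k\},\ldots,f_n\}$. The Nambu tensor $\Pi\in\Gamma(\Lambda^nTM)$ is defined by $\Pi(df_1,\ldots,df_n)=\{f_1,\ldots,f_n\}$, and $\Pi^\sharp:\Lambda^{n-1}T^*M\to TM$ by $\langle\beta,\Pi^\sharp(\alpha_1\wedge\cdots\wedge\alpha_{n-1})\rangle=\Pi(\alpha_1,\ldots,\alpha_{n-1},\beta)$.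 "$F$ is a regular, integrable distribution on $N$" means that $F$ is a smooth integrable distribution of constant rank on $N$ such that the leaf space $\underline N=N/\mathcal F$ of the induced foliation $\mathcal F$ is a smooth manifold and the projection $\pi:N\to\underline N$ is a submersion. For a subbundle $S\subseteq TM|_N$, $C^\infty(M)_S$ denotes the functions on $M$ whose differential vanishes on $S$ (at points of $N$); $C^\infty(N)_F$ denotes the functions on $N$ whose differential vanishes on $F$. $E$ is canonical if $F_1,\ldots,F_n\in C^\infty(M)_E$ implies $\{F_1,\ldots,F_n\}\in C^\infty(M)_E$. For $p\in N$, $Ann^1E_p=\{\eta\in\Lambda^{n-1}T_p^*M\mid i_v\eta=0\ \forall v\in E_p\}$. A multiplicative subalgebra is a subalgebra for pointwise multiplication of functions. $(M,N,E)$ is (Nambu-Poisson) reducible if $\underline N$ has a Nambu-Poisson structure of order $n$ with bracket $\{,\ldots,\}_{\underline N}$ such that for all $f_1,\ldots,f_n\in C^\infty(\underline N)$ and all smooth extensions $F_1,\ldots,F_n\in C^\infty(M)_E$ of $f_1\circ\pi,\ldots,f_n\circ\pi$, one has $\pi^*\{f_1,\ldots,f_n\}_{\underline N}=i^*\{F_1,\ldots,F_n\}$. *)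

theory Defs
  imports "HOL-Analysis.Analysis" "HOL-Combinatorics.Permutations"
begin

section \<open>Smoothness in Euclidean space\<close>

fun times_differentiable_on ::
  "nat \<Rightarrow> 'e::real_normed_vector set \<Rightarrow> ('e \<Rightarrow> 'b::real_normed_vector) \<Rightarrow> bool" where
  "times_differentiable_on 0 U f \<longleftrightarrow> continuous_on U f"
| "times_differentiable_on (Suc k) U f \<longleftrightarrow>
     (\<forall>x\<in>U. f differentiable (at x)) \<and>
     (\<forall>v. times_differentiable_on k U (\<lambda>x. frechet_derivative f (at x) v))"

text \<open>Smoothness on a set that need not be open (below: relatively open subsets of a linear
  subspace) means local extendability to a smooth function on an open set.\<close>

definition smooth_on :: "'e::real_normed_vector set \<Rightarrow> ('e \<Rightarrow> 'b::real_normed_vector) \<Rightarrow> bool" where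
  "smooth_on W f \<longleftrightarrow> (\<forall>x\<in>W. \<exists>U g. open U \<and> x \<in> U \<and>
     (\<forall>k. times_differentiable_on k U g) \<and> (\<forall>y\<in>U \<inter> W. g y = f y))"


section \<open>Smooth manifolds, functions and maps\<close>

text \<open>The charts take values in a fixed linear subspace of a Euclidean space. As no Euclidean space
  type has dimension 0, modelling on the whole type would exclude 0-dimensional manifolds.\<close>

record ('a, 'e) manifold =
  mfd_top :: "'a topology"
  mfd_model :: "'e set"
  mfd_atlas :: "('a set \<times> ('a \<Rightarrow> 'e)) set"

abbreviation pts :: "('a, 'e) manifold \<Rightarrow> 'a set" where
  "pts M \<equiv> topspace (mfd_top M)"

definition smooth_manifold :: "('a, 'e::euclidean_space) manifold \<Rightarrow> bool" where
  "smooth_manifold M \<longleftrightarrow>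
     Hausdorff_space (mfd_top M) \<and> second_countable (mfd_top M) \<and> subspace (mfd_model M) \<and>
     (\<forall>(U, \<phi>) \<in> mfd_atlas M.
        openin (mfd_top M) U \<and>
        openin (top_of_set (mfd_model M)) (\<phi> ` U) \<and>
        homeomorphic_map (subtopology (mfd_top M) U) (top_of_set (\<phi> ` U)) \<phi>) \<and>
     (\<Union>(U, \<phi>) \<in> mfd_atlas M. U) = pts M \<and>
     (\<forall>(U, \<phi>) \<in> mfd_atlas M. \<forall>(V, \<psi>) \<in> mfd_atlas M.
        smooth_on (\<phi> ` (U \<inter> V)) (\<psi> \<circ> inv_into U \<phi>))"

definition mfd_dim :: "('a, 'e::euclidean_space) manifold \<Rightarrow> nat" where
  "mfd_dim M = dim (mfd_model M)"

definition smooth_fun_on :: "('a, 'e::euclidean_space) manifold \<Rightarrow> 'a set \<Rightarrow> ('a \<Rightarrow> real) \<Rightarrow> bool" where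
  "smooth_fun_on M W f \<longleftrightarrow>
     (\<forall>(U, \<phi>) \<in> mfd_atlas M. smooth_on (\<phi> ` (U \<inter> W)) (f \<circ> inv_into U \<phi>))"

text \<open>A function on the manifold is represented by the HOL function that is 0 off the manifold.\<close>

definition smooth_funs :: "('a, 'e::euclidean_space) manifold \<Rightarrow> ('a \<Rightarrow> real) set" where
  "smooth_funs M = {f. smooth_fun_on M (pts M) f \<and> (\<forall>x. x \<notin> pts M \<longrightarrow> f x = 0)}"

definition smooth_map ::
  "('a, 'e::euclidean_space) manifold \<Rightarrow> ('b, 'k::euclidean_space) manifold \<Rightarrow> ('a \<Rightarrow> 'b) \<Rightarrow> bool" where
  "smooth_map M N F \<longleftrightarrow> continuous_map (mfd_top M) (mfd_top N) F \<and>
     (\<forall>(U, \<phi>) \<in> mfd_atlas M. \<forall>(V, \<psi>) \<in> mfd_atlas N.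
        smooth_on (\<phi> ` (U \<inter> F -` V)) (\<psi> \<circ> F \<circ> inv_into U \<phi>))"

definition pullback :: "('a, 'e) manifold \<Rightarrow> ('a \<Rightarrow> 'b) \<Rightarrow> ('b \<Rightarrow> real) \<Rightarrow> 'a \<Rightarrow> real" where
  "pullback M F g = (\<lambda>x. if x \<in> pts M then g (F x) else 0)"


section \<open>Tangent and cotangent spaces\<close>

type_synonym 'a tangent = "('a \<Rightarrow> real) \<Rightarrow> real"
type_synonym 'a covector = "'a tangent \<Rightarrow> real"
type_synonym 'a form = "'a tangent list \<Rightarrow> real"

text \<open>Tangent vectors are derivations at a point. Derivations, covectors and forms are 0 outside
  their proper domains, so that they form genuine vector spaces under pointwise operations.\<close>

definition tangent_space :: "('a, 'e::euclidean_space) manifold \<Rightarrow> 'a \<Rightarrow> 'a tangent set" where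
  "tangent_space M p = {v.
     (\<forall>f\<in>smooth_funs M. \<forall>g\<in>smooth_funs M. \<forall>a b.
        v (\<lambda>x. a * f x + b * g x) = a * v f + b * v g) \<and>
     (\<forall>f\<in>smooth_funs M. \<forall>g\<in>smooth_funs M. v (\<lambda>x. f x * g x) = f p * v g + v f * g p) \<and>
     (\<forall>f. f \<notin> smooth_funs M \<longrightarrow> v f = 0)}"

definition pushforward ::
  "('a, 'e::euclidean_space) manifold \<Rightarrow> ('b, 'k::euclidean_space) manifold \<Rightarrow> ('a \<Rightarrow> 'b) \<Rightarrow>
   'a tangent \<Rightarrow> 'b tangent" where
  "pushforward M N F v = (\<lambda>g. if g \<in> smooth_funs N then v (pullback M F g) else 0)"

definition cotangent_space :: "('a, 'e::euclidean_space) manifold \<Rightarrow> 'a \<Rightarrow> 'a covector set" where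
  "cotangent_space M p = {\<alpha>.
     (\<forall>v\<in>tangent_space M p. \<forall>w\<in>tangent_space M p. \<forall>a b.
        \<alpha> (\<lambda>f. a * v f + b * w f) = a * \<alpha> v + b * \<alpha> w) \<and>
     (\<forall>v. v \<notin> tangent_space M p \<longrightarrow> \<alpha> v = 0)}"

definition differential :: "('a, 'e::euclidean_space) manifold \<Rightarrow> 'a \<Rightarrow> ('a \<Rightarrow> real) \<Rightarrow> 'a covector" where
  "differential M p f = (\<lambda>v. if v \<in> tangent_space M p then v f else 0)"

text \<open>The space \<open>\<Lambda>\<^sup>k T\<^sub>p\<^sup>*M\<close> as alternating multilinear forms on lists of \<open>k\<close> tangent vectors.\<close>

definition alt_forms :: "('a, 'e::euclidean_space) manifold \<Rightarrow> nat \<Rightarrow> 'a \<Rightarrow> 'a form set" where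
  "alt_forms M k p = {\<eta>.
     (\<forall>ws i u v a b. length ws = k \<and> set ws \<subseteq> tangent_space M p \<and> i < k \<and>
        u \<in> tangent_space M p \<and> v \<in> tangent_space M p \<longrightarrow>
        \<eta> (ws[i := \<lambda>f. a * u f + b * v f]) = a * \<eta> (ws[i := u]) + b * \<eta> (ws[i := v])) \<and>
     (\<forall>ws i j. length ws = k \<and> set ws \<subseteq> tangent_space M p \<and> i < j \<and> j < k \<and> ws ! i = ws ! j \<longrightarrow>
        \<eta> ws = 0) \<and>
     (\<forall>ws. \<not> (length ws = k \<and> set ws \<subseteq> tangent_space M p) \<longrightarrow> \<eta> ws = 0)}"

definition wedge :: "'a covector list \<Rightarrow> 'a form" where
  "wedge \<alpha>s ws = (if length ws = length \<alpha>s
     then \<Sum>\<sigma> | \<sigma> permutes {..<length \<alpha>s}.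
            of_int (sign \<sigma>) * (\<Prod>i<length \<alpha>s. (\<alpha>s ! i) (ws ! \<sigma> i))
     else 0)"

text \<open>For a 0-form \<open>\<eta>\<close> the result is 0, since \<open>\<eta>\<close> vanishes on nonempty lists.\<close>

definition interior_product :: "'a tangent \<Rightarrow> 'a form \<Rightarrow> 'a form" where
  "interior_product v \<eta> = (\<lambda>ws. \<eta> (v # ws))"

definition ann_forms ::
  "('a, 'e::euclidean_space) manifold \<Rightarrow> nat \<Rightarrow> ('a \<Rightarrow> 'a tangent set) \<Rightarrow> 'a \<Rightarrow> 'a form set" where
  "ann_forms M k E p = {\<eta> \<in> alt_forms M k p. \<forall>v\<in>E p. interior_product v \<eta> = (\<lambda>_. 0)}"


section \<open>Submanifolds, subbundles and foliations\<close>

definition immersion ::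
  "('a, 'e::euclidean_space) manifold \<Rightarrow> ('b, 'k::euclidean_space) manifold \<Rightarrow> ('a \<Rightarrow> 'b) \<Rightarrow> bool" where
  "immersion M N F \<longleftrightarrow> smooth_map M N F \<and>
     (\<forall>p\<in>pts M. inj_on (pushforward M N F) (tangent_space M p))"

definition submersion ::
  "('a, 'e::euclidean_space) manifold \<Rightarrow> ('b, 'k::euclidean_space) manifold \<Rightarrow> ('a \<Rightarrow> 'b) \<Rightarrow> bool" where
  "submersion M N F \<longleftrightarrow> smooth_map M N F \<and>
     (\<forall>p\<in>pts M. pushforward M N F ` tangent_space M p = tangent_space N (F p))"

text \<open>Submanifolds may be immersed: the topology of \<open>N\<close> may be finer than the subspace topology.
  Embedded submanifolds are the case of equality.\<close>

definition submanifold ::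
  "('a, 'e::euclidean_space) manifold \<Rightarrow> ('a, 'k::euclidean_space) manifold \<Rightarrow> bool" where
  "submanifold M N \<longleftrightarrow> smooth_manifold N \<and> pts N \<subseteq> pts M \<and> immersion N M id"

text \<open>A family \<open>S\<close> of subspaces of \<open>T\<^sub>qM\<close> for \<open>q \<in> N\<close> has the smooth local frame
  \<open>X 0, \<dots>, X (r - 1)\<close> over the open subset \<open>U\<close> of \<open>N\<close>.\<close>

definition local_frame ::
  "('a, 'e::euclidean_space) manifold \<Rightarrow> ('a, 'k::euclidean_space) manifold \<Rightarrow>
   ('a \<Rightarrow> 'a tangent set) \<Rightarrow> 'a set \<Rightarrow> nat \<Rightarrow> (nat \<Rightarrow> 'a \<Rightarrow> 'a tangent) \<Rightarrow> bool" where
  "local_frame M N S U r X \<longleftrightarrow> openin (mfd_top N) U \<and>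
     (\<forall>i<r. \<forall>q\<in>U. X i q \<in> tangent_space M q) \<and>
     (\<forall>i<r. \<forall>f\<in>smooth_funs M. smooth_fun_on N U (\<lambda>q. X i q f)) \<and>
     (\<forall>q\<in>U. S q = {(\<lambda>f. \<Sum>i<r. c i * X i q f) | c. True}) \<and>
     (\<forall>q\<in>U. \<forall>c. (\<lambda>f. \<Sum>i<r. c i * X i q f) = (\<lambda>_. 0) \<longrightarrow> (\<forall>i<r. c i = 0))"

text \<open>Vector subbundles of \<open>TM|\<^sub>N\<close>; the rank is locally constant.\<close>

definition vector_subbundle ::
  "('a, 'e::euclidean_space) manifold \<Rightarrow> ('a, 'k::euclidean_space) manifold \<Rightarrow>
   ('a \<Rightarrow> 'a tangent set) \<Rightarrow> bool" where
  "vector_subbundle M N S \<longleftrightarrow> (\<forall>p\<in>pts N. \<exists>U r X. p \<in> U \<and> local_frame M N S U r X)"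

definition constant_rank_distribution ::
  "('a, 'k::euclidean_space) manifold \<Rightarrow> ('a \<Rightarrow> 'a tangent set) \<Rightarrow> bool" where
  "constant_rank_distribution N F \<longleftrightarrow>
     (\<exists>r. \<forall>p\<in>pts N. \<exists>U X. p \<in> U \<and> local_frame N N F U r X)"

definition integral_manifold ::
  "('a, 'k::euclidean_space) manifold \<Rightarrow> ('a \<Rightarrow> 'a tangent set) \<Rightarrow> ('a, 'k) manifold \<Rightarrow> bool" where
  "integral_manifold N F S \<longleftrightarrow> submanifold N S \<and>
     (\<forall>q\<in>pts S. pushforward S N id ` tangent_space S q = F q)"

definition integrable_distribution ::
  "('a, 'k::euclidean_space) manifold \<Rightarrow> ('a \<Rightarrow> 'a tangent set) \<Rightarrow> bool" where
  "integrable_distribution N F \<longleftrightarrow> (\<forall>p\<in>pts N. \<exists>S. integral_manifold N F S \<and> p \<in> pts S)"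

text \<open>The leaf through \<open>p\<close>, i.e. the maximal connected integral manifold containing \<open>p\<close>, as the
  union of all of them. The map \<open>leaf N F\<close> is the projection of \<open>N\<close> onto the leaf space.\<close>

definition leaf ::
  "('a, 'k::euclidean_space) manifold \<Rightarrow> ('a \<Rightarrow> 'a tangent set) \<Rightarrow> 'a \<Rightarrow> 'a set" where
  "leaf N F p = \<Union>{pts S | S. integral_manifold N F S \<and> connected_space (mfd_top S) \<and> p \<in> pts S}"

text \<open>\<open>F\<close> is a regular, integrable distribution on \<open>N\<close>, and \<open>Q\<close> is the smooth manifold \<open>N/\<F>\<close>.
  The smooth structure of \<open>Q\<close> is determined by the projection being a submersion.\<close>

definition regular_integrable ::
  "('a, 'k::euclidean_space) manifold \<Rightarrow> ('a \<Rightarrow> 'a tangent set) \<Rightarrow>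
   ('a set, 'q::euclidean_space) manifold \<Rightarrow> bool" where
  "regular_integrable N F Q \<longleftrightarrow>
     constant_rank_distribution N F \<and> integrable_distribution N F \<and>
     smooth_manifold Q \<and> pts Q = leaf N F ` pts N \<and> submersion N Q (leaf N F)"

text \<open>\<open>E \<inter> TN\<close>, as a family of subspaces of the tangent spaces of \<open>N\<close>.\<close>

definition tangential_part ::
  "('a, 'e::euclidean_space) manifold \<Rightarrow> ('a, 'k::euclidean_space) manifold \<Rightarrow>
   ('a \<Rightarrow> 'a tangent set) \<Rightarrow> 'a \<Rightarrow> 'a tangent set" where
  "tangential_part M N E p = {v \<in> tangent_space N p. pushforward N M id v \<in> E p}"

text \<open>\<open>C\<^sup>\<infinity>(M)\<^sub>S\<close> for \<open>S \<subseteq> TM|\<^sub>N\<close>, where \<open>A\<close> is the set of points of \<open>N\<close>.\<close>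

definition smooth_funs_ann ::
  "('a, 'e::euclidean_space) manifold \<Rightarrow> 'a set \<Rightarrow> ('a \<Rightarrow> 'a tangent set) \<Rightarrow> ('a \<Rightarrow> real) set" where
  "smooth_funs_ann M A S = {f \<in> smooth_funs M. \<forall>p\<in>A. \<forall>v\<in>S p. differential M p f v = 0}"

definition mult_subalgebra :: "('a \<Rightarrow> real) set \<Rightarrow> bool" where
  "mult_subalgebra B \<longleftrightarrow> (\<lambda>_. 0) \<in> B \<and>
     (\<forall>f\<in>B. \<forall>g\<in>B. \<forall>a b. (\<lambda>x. a * f x + b * g x) \<in> B) \<and>
     (\<forall>f\<in>B. \<forall>g\<in>B. (\<lambda>x. f x * g x) \<in> B)"


section \<open>Nambu-Poisson structures\<close>

text \<open>A bracket of order \<open>n\<close> is a function of lists of length \<open>n\<close>.\<close>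

definition nambu_poisson_bracket ::
  "nat \<Rightarrow> ('a, 'e::euclidean_space) manifold \<Rightarrow> (('a \<Rightarrow> real) list \<Rightarrow> 'a \<Rightarrow> real) \<Rightarrow> bool" where
  "nambu_poisson_bracket n M br \<longleftrightarrow>
     (\<forall>fs. length fs = n \<and> set fs \<subseteq> smooth_funs M \<longrightarrow> br fs \<in> smooth_funs M) \<and>
     (\<forall>fs i g h a b. length fs = n \<and> set fs \<subseteq> smooth_funs M \<and> i < n \<and>
        g \<in> smooth_funs M \<and> h \<in> smooth_funs M \<longrightarrow>
        br (fs[i := \<lambda>x. a * g x + b * h x]) =
          (\<lambda>x. a * br (fs[i := g]) x + b * br (fs[i := h]) x)) \<and>
     (\<forall>fs i j. length fs = n \<and> set fs \<subseteq> smooth_funs M \<and> i < j \<and> j < n \<longrightarrow>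
        br (fs[i := fs ! j, j := fs ! i]) = (\<lambda>x. - br fs x)) \<and>
     (\<forall>fs g h. Suc (length fs) = n \<and> set fs \<subseteq> smooth_funs M \<and>
        g \<in> smooth_funs M \<and> h \<in> smooth_funs M \<longrightarrow>
        br (fs @ [\<lambda>x. g x * h x]) = (\<lambda>x. g x * br (fs @ [h]) x + br (fs @ [g]) x * h x)) \<and>
     (\<forall>gs fs. Suc (length gs) = n \<and> set gs \<subseteq> smooth_funs M \<and>
        length fs = n \<and> set fs \<subseteq> smooth_funs M \<longrightarrow>
        br (gs @ [br fs]) = (\<lambda>x. \<Sum>k<n. br (fs[k := br (gs @ [fs ! k])]) x))"

definition nambu_poisson_manifold ::
  "nat \<Rightarrow> ('a, 'e::euclidean_space) manifold \<Rightarrow> (('a \<Rightarrow> real) list \<Rightarrow> 'a \<Rightarrow> real) \<Rightarrow> bool" where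
  "nambu_poisson_manifold n M br \<longleftrightarrow>
     smooth_manifold M \<and> 1 \<le> n \<and> n \<le> mfd_dim M \<and> nambu_poisson_bracket n M br"

text \<open>\<open>\<Pi>\<^sub>p(df\<^sub>1, \<dots>, df\<^sub>n) = {f\<^sub>1, \<dots>, f\<^sub>n}(p)\<close>. Every covector at \<open>p\<close> is the differential of a smooth
  function, and the value does not depend on the chosen functions, because for fixed
  \<open>f\<^sub>1, \<dots>, f\<^sub>n\<^sub>-\<^sub>1\<close> the bracket at \<open>p\<close> is a derivation at \<open>p\<close> in the last argument.\<close>

definition nambu_tensor ::
  "('a, 'e::euclidean_space) manifold \<Rightarrow> (('a \<Rightarrow> real) list \<Rightarrow> 'a \<Rightarrow> real) \<Rightarrow> 'a \<Rightarrow>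
   'a covector list \<Rightarrow> real" where
  "nambu_tensor M br p \<alpha>s =
     br (map (\<lambda>\<alpha>. SOME f. f \<in> smooth_funs M \<and> differential M p f = \<alpha>) \<alpha>s) p"

text \<open>The graph of \<open>\<Pi>\<^sup>\<sharp>\<close> at \<open>p\<close>: it is prescribed on decomposable forms
  \<open>\<alpha>\<^sub>1 \<and> \<dots> \<and> \<alpha>\<^sub>n\<^sub>-\<^sub>1\<close> and extended linearly to \<open>\<Lambda>\<^sup>n\<^sup>-\<^sup>1 T\<^sub>p\<^sup>*M\<close>, every element of which is a linear
  combination of decomposable ones.\<close>

definition nambu_sharp ::
  "nat \<Rightarrow> ('a, 'e::euclidean_space) manifold \<Rightarrow> (('a \<Rightarrow> real) list \<Rightarrow> 'a \<Rightarrow> real) \<Rightarrow> 'a \<Rightarrow>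
   ('a form \<times> 'a tangent) set" where
  "nambu_sharp n M br p = {(\<lambda>ws. \<Sum>(c, \<alpha>s)\<leftarrow>cs. c * wedge \<alpha>s ws, v) | cs v.
     (\<forall>(c, \<alpha>s) \<in> set cs. Suc (length \<alpha>s) = n \<and> set \<alpha>s \<subseteq> cotangent_space M p) \<and>
     v \<in> tangent_space M p \<and>
     (\<forall>\<beta> \<in> cotangent_space M p. \<beta> v = (\<Sum>(c, \<alpha>s)\<leftarrow>cs. c * nambu_tensor M br p (\<alpha>s @ [\<beta>])))}"

text \<open>There is no requirement \<open>n \<le> dim Q\<close>: if it fails, the reduced bracket is 0.\<close>

definition nambu_reducible ::
  "nat \<Rightarrow> ('a, 'e::euclidean_space) manifold \<Rightarrow> (('a \<Rightarrow> real) list \<Rightarrow> 'a \<Rightarrow> real) \<Rightarrow>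
   ('a, 'k::euclidean_space) manifold \<Rightarrow> ('a \<Rightarrow> 'a tangent set) \<Rightarrow>
   ('a set, 'q::euclidean_space) manifold \<Rightarrow> bool" where
  "nambu_reducible n M br N E Q \<longleftrightarrow>
     (\<exists>brQ. nambu_poisson_bracket n Q brQ \<and>
        (\<forall>fs Fs. length fs = n \<and> length Fs = n \<and>
           set fs \<subseteq> smooth_funs Q \<and> set Fs \<subseteq> smooth_funs_ann M (pts N) E \<and>
           (\<forall>i<n. pullback N id (Fs ! i) = pullback N (leaf N (tangential_part M N E)) (fs ! i)) \<longrightarrow>
           pullback N (leaf N (tangential_part M N E)) (brQ fs) = pullback N id (br Fs)))"

end

theory Submission
  imports Defs
begin

text \<open>
The reduced bracket of functions \<open>f\<^sub>1, \<dots>, f\<^sub>n\<close> on the leaf space \<open>Q\<close> is obtained by pulling them back to \<open>N\<close>, extending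
the pull-backs to functions in \<open>B\<close>, taking the bracket on \<open>M\<close>, restricting to \<open>N\<close> and descending to \<open>Q\<close>. Three points
make this work.

First, extensions exist: a function pulled back from \<open>Q\<close> is constant on leaves, so \<open>F\<close> kills it
(\<open>distribution_kills_leafwise_constant\<close>), and the restriction map from \<open>B\<close> is onto such functions. Conversely, a bracket of
functions in \<open>B\<close> annihilates \<open>D\<close>, hence \<open>F\<close>, so its restriction to \<open>N\<close> is constant on leaves
(\<open>killed_by_distribution_leafwise_constant\<close>) and descends to a smooth function because the projection is a submersion
(\<open>submersion_descent\<close>).

Second, the choice of the extensions does not matter. If \<open>df\<^sub>1, \<dots>, df\<^sub>n\<^sub>-\<^sub>1\<close> annihilate \<open>E\<close>, then their wedge product is in
\<open>Ann\<^sup>1 E\<close>, so the vector \<open>\<Pi>\<^sup>\<sharp> (df\<^sub>1 \<and> \<dots> \<and> df\<^sub>n\<^sub>-\<^sub>1)\<close> is in \<open>TN + D\<close> and kills every function that vanishes on \<open>N\<close> and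
annihilates \<open>D\<close> (\<open>bracket_vanishing_last\<close>). By skew-symmetry, in any slot a function may be exchanged for one with the
same restriction to \<open>N\<close> as long as both annihilate \<open>D\<close> and the other arguments annihilate \<open>E\<close> (\<open>bracket_eq_slot\<close>).

Third, multilinearity, skew-symmetry and the Leibniz rule pass to \<open>Q\<close> since \<open>B\<close> is a subalgebra. In the fundamental identity
an inner bracket of functions in \<open>B\<close> need not be in \<open>B\<close>, but it annihilates \<open>D\<close>, and the second point allows to exchange it for
the chosen extension in \<open>B\<close> of the corresponding reduced bracket.

Most of the work goes into differential geometry. Tangent vectors are derivations; Hadamard's lemma identifies them with
the vectors of the model space (\<open>tangent_space_chart\<close>), and it follows that every covector is a differential
(\<open>cotangent_is_differential\<close>), so that \<open>\<Pi>\<close> is determined by the bracket. That \<open>F\<close> is tangent to the fibres of the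
projection is not immediate either: a leaf is the union of the connected integral manifolds through a point, so nearby points of an
integral manifold have the same leaf only because overlapping integral manifolds can be glued
(\<open>glue_integral_manifolds\<close>). This rests on the local uniqueness of integral manifolds (\<open>plaque_transition_local\<close>). In a chart
both are graphs over the tangent plane of \<open>F\<close> at a common point, and along rays the two graphs solve the same
differential equation with Lipschitz right-hand side.
\<close>

section \<open>Calculus of smooth maps on open sets\<close>

lemma linear_Basis_expansion:
  fixes g :: "'a::euclidean_space \<Rightarrow> 'b::real_vector"
  assumes "linear g"
  shows "(\<Sum>b\<in>Basis. (w \<bullet> b) *\<^sub>R g b) = g w"
proof -
  have "g (\<Sum>b\<in>Basis. (w \<bullet> b) *\<^sub>R b) = (\<Sum>b\<in>Basis. (w \<bullet> b) *\<^sub>R g b)"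
    by (simp only: linear_sum[OF assms] linear_scale[OF assms])
  then show ?thesis by (simp only: euclidean_representation)
qed

abbreviation deriv_at :: "('e::real_normed_vector \<Rightarrow> 'b::real_normed_vector) \<Rightarrow> 'e \<Rightarrow> 'e \<Rightarrow> 'b" where
  "deriv_at f x \<equiv> frechet_derivative f (at x)"

text \<open>Openness is part of the notion, so that derivatives are determined by the values on the set.\<close>

definition smooth_open :: "'e::real_normed_vector set \<Rightarrow> ('e \<Rightarrow> 'b::real_normed_vector) \<Rightarrow> bool" where
  "smooth_open U f \<longleftrightarrow> open U \<and> (\<forall>k. times_differentiable_on k U f)"

text \<open>Any derivative will do in place of the chosen Frechet derivative: on an open set the two agree,
  and so do their derivatives.\<close>

lemma times_differentiable_on_SucI:
  assumes "open U" "\<And>x. x \<in> U \<Longrightarrow> (f has_derivative f' x) (at x)"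
    "\<And>v. times_differentiable_on k U (\<lambda>x. f' x v)"
  shows "times_differentiable_on (Suc k) U f"
  using assms
proof (induction k arbitrary: f f')
  case 0
  have "continuous_on U (\<lambda>x. deriv_at f x v)" for v
    using 0(3)[of v] continuous_on_cong[of U U "\<lambda>x. f' x v" "\<lambda>x. deriv_at f x v"]
      frechet_derivative_at[OF 0(2)] by simp
  then show ?case using 0 by (auto simp: differentiable_def)
next
  case (Suc k)
  have eq: "deriv_at f x = f' x" if "x \<in> U" for x
    using Suc.prems(2)[OF that] frechet_derivative_at by metis
  have "times_differentiable_on (Suc k) U (\<lambda>x. deriv_at f x v)" for v
  proof (rule Suc.IH[OF Suc.prems(1)])
    fix x assume x: "x \<in> U"
    have "((\<lambda>x. f' x v) has_derivative deriv_at (\<lambda>x. f' x v) x) (at x)"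
      using Suc.prems(3)[of v] x by (auto simp: frechet_derivative_works[symmetric])
    then show "((\<lambda>x. deriv_at f x v) has_derivative deriv_at (\<lambda>x. f' x v) x) (at x)"
      by (rule has_derivative_transform_within_open[OF _ Suc.prems(1) x]) (simp add: eq)
  next
    fix w show "times_differentiable_on k U (\<lambda>x. deriv_at (\<lambda>x. f' x v) x w)"
      using Suc.prems(3)[of v] by auto
  qed
  moreover have "\<forall>x\<in>U. f differentiable (at x)" using Suc.prems(2) by (auto simp: differentiable_def)
  ultimately show ?case by (simp only: times_differentiable_on.simps(2)) blast
qed

lemma times_differentiable_on_SucD:
  assumes "times_differentiable_on (Suc k) U f"
  shows "\<And>x. x \<in> U \<Longrightarrow> (f has_derivative deriv_at f x) (at x)"
    "\<And>v. times_differentiable_on k U (\<lambda>x. deriv_at f x v)"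
  using assms by (auto simp: frechet_derivative_works[symmetric])

lemma times_differentiable_on_cong:
  assumes "open U" "times_differentiable_on k U f" "\<And>x. x \<in> U \<Longrightarrow> f x = g x"
  shows "times_differentiable_on k U g"
proof (cases k)
  case 0
  then show ?thesis using assms by (simp cong: continuous_on_cong)
next
  case (Suc l)
  show ?thesis unfolding Suc
  proof (rule times_differentiable_on_SucI[OF assms(1)])
    fix x assume x: "x \<in> U"
    show "(g has_derivative deriv_at f x) (at x)"
      using has_derivative_transform_within_open[OF times_differentiable_on_SucD(1)] assms x Suc by blast
  qed (use assms(2) Suc in auto)
qed

lemma times_differentiable_on_subset:
  "times_differentiable_on k U f \<Longrightarrow> V \<subseteq> U \<Longrightarrow> times_differentiable_on k V f"
  by (induction k arbitrary: f) (auto intro: continuous_on_subset)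

lemma times_differentiable_on_local:
  assumes "\<And>x. x \<in> U \<Longrightarrow> \<exists>V. open V \<and> x \<in> V \<and> times_differentiable_on k V f"
  shows "times_differentiable_on k U f"
  using assms
proof (induction k arbitrary: f)
  case 0
  have "isCont f x" if "x \<in> U" for x
    using 0[OF that] by (auto simp: continuous_on_eq_continuous_at)
  then show ?case by (simp add: continuous_at_imp_continuous_on)
next
  case (Suc k)
  have "f differentiable (at x)" if "x \<in> U" for x using Suc.prems[OF that] by auto
  moreover have "times_differentiable_on k U (\<lambda>x. deriv_at f x v)" for v
    by (rule Suc.IH) (use Suc.prems in \<open>fastforce\<close>)
  ultimately show ?case by simp
qed

lemma times_differentiable_on_Suc_imp:
  "open U \<Longrightarrow> times_differentiable_on (Suc k) U f \<Longrightarrow> times_differentiable_on k U f"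
proof (induction k arbitrary: f)
  case 0
  then show ?case
    by (auto intro!: continuous_at_imp_continuous_on differentiable_imp_continuous_within)
next
  case (Suc k)
  then show ?case by (metis times_differentiable_on.simps(2))
qed

lemma times_differentiable_on_const: "open U \<Longrightarrow> times_differentiable_on k U (\<lambda>x. c)"
  by (induction k arbitrary: c) auto

lemma times_differentiable_on_bounded_linear_comp:
  assumes "open U" "bounded_linear h" "times_differentiable_on k U f"
  shows "times_differentiable_on k U (\<lambda>x. h (f x))"
  using assms(3)
proof (induction k arbitrary: f)
  case 0
  then show ?case using assms(2) by (auto intro: bounded_linear.continuous_on)
next
  case (Suc k)
  show ?case
  proof (rule times_differentiable_on_SucI[OF assms(1)])
    fix x assume "x \<in> U"
    then show "((\<lambda>x. h (f x)) has_derivative (\<lambda>v. h (deriv_at f x v))) (at x)"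
      using bounded_linear.has_derivative[OF assms(2)] times_differentiable_on_SucD(1)[OF Suc.prems] by blast
  qed (use Suc in auto)
qed

lemma times_differentiable_on_bounded_linear:
  assumes "open U" "bounded_linear h" shows "times_differentiable_on k U h"
proof -
  have "times_differentiable_on k U (\<lambda>x. x)"
  proof (cases k)
    case (Suc l)
    have "times_differentiable_on (Suc l) U (\<lambda>x. x)"
      by (rule times_differentiable_on_SucI[OF assms(1), where f' = "\<lambda>x v. v"])
        (auto simp: times_differentiable_on_const assms(1))
    then show ?thesis using Suc by simp
  qed auto
  from times_differentiable_on_bounded_linear_comp[OF assms this] show ?thesis by simp
qed

lemma times_differentiable_on_add:
  "open U \<Longrightarrow> times_differentiable_on k U f \<Longrightarrow> times_differentiable_on k U g \<Longrightarrow>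
    times_differentiable_on k U (\<lambda>x. f x + g x)"
proof (induction k arbitrary: f g)
  case 0 then show ?case by (auto intro: continuous_on_add)
next
  case (Suc k)
  show ?case
  proof (rule times_differentiable_on_SucI[OF Suc.prems(1)])
    fix x assume x: "x \<in> U"
    show "((\<lambda>x. f x + g x) has_derivative (\<lambda>v. deriv_at f x v + deriv_at g x v)) (at x)"
      by (intro has_derivative_add times_differentiable_on_SucD(1)[OF Suc.prems(2) x]
        times_differentiable_on_SucD(1)[OF Suc.prems(3) x])
  qed (use Suc in auto)
qed

lemma times_differentiable_on_bilinear:
  assumes "open U" "bounded_bilinear pr" "times_differentiable_on k U f" "times_differentiable_on k U g"
  shows "times_differentiable_on k U (\<lambda>x. pr (f x) (g x))"
proof -
  interpret bounded_bilinear pr by fact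
  show ?thesis using assms(3,4)
  proof (induction k arbitrary: f g)
    case 0 then show ?case by (auto intro: continuous_on)
  next
    case (Suc k)
    show ?case
    proof (rule times_differentiable_on_SucI[OF assms(1)])
      fix x assume x: "x \<in> U"
      show "((\<lambda>x. pr (f x) (g x)) has_derivative
          (\<lambda>v. pr (f x) (deriv_at g x v) + pr (deriv_at f x v) (g x))) (at x)"
        by (rule FDERIV[OF times_differentiable_on_SucD(1)[OF Suc.prems(1) x]
          times_differentiable_on_SucD(1)[OF Suc.prems(2) x]])
    next
      fix v
      show "times_differentiable_on k U (\<lambda>x. pr (f x) (deriv_at g x v) + pr (deriv_at f x v) (g x))"
        using times_differentiable_on_SucD(2)[OF Suc.prems(1)] times_differentiable_on_SucD(2)[OF Suc.prems(2)]
          times_differentiable_on_Suc_imp[OF assms(1) Suc.prems(1)]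
          times_differentiable_on_Suc_imp[OF assms(1) Suc.prems(2)]
        by (intro times_differentiable_on_add assms(1) Suc.IH)
    qed
  qed
qed

lemma times_differentiable_on_sum:
  assumes "open U" "\<And>i. i \<in> I \<Longrightarrow> times_differentiable_on k U (f i)"
  shows "times_differentiable_on k U (\<lambda>x. \<Sum>i\<in>I. f i x)"
  using assms(2)
  by (induction I rule: infinite_finite_induct)
    (auto simp: times_differentiable_on_const assms(1) intro!: times_differentiable_on_add assms(1))

text \<open>Expanding the outer derivative along a basis turns the chain rule into a sum of products of
  functions of lower order, to which the induction hypothesis applies.\<close>

lemma times_differentiable_on_compose:
  fixes f :: "'a::real_normed_vector \<Rightarrow> 'b::euclidean_space" and g :: "'b \<Rightarrow> 'c::real_normed_vector"
  assumes "open U" "open V" "f ` U \<subseteq> V"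
    "times_differentiable_on k U f" "times_differentiable_on k V g"
  shows "times_differentiable_on k U (\<lambda>x. g (f x))"
  using assms(4,5)
proof (induction k arbitrary: g)
  case 0
  then show ?case using assms(3) by (auto intro: continuous_on_compose2)
next
  case (Suc k)
  have der: "(g has_derivative deriv_at g (f x)) (at (f x))" if "x \<in> U" for x
    using times_differentiable_on_SucD(1)[OF Suc.prems(2)] assms(3) that by blast
  have expand: "(\<Sum>b\<in>Basis. (w \<bullet> b) *\<^sub>R deriv_at g (f x) b) = deriv_at g (f x) w" if "x \<in> U" for x w
    by (rule linear_Basis_expansion[OF has_derivative_linear[OF der[OF that]]])
  show ?case
  proof (rule times_differentiable_on_SucI[OF assms(1)])
    fix x assume x: "x \<in> U"
    have "((\<lambda>x. g (f x)) has_derivative (\<lambda>v. deriv_at g (f x) (deriv_at f x v))) (at x)"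
      by (rule has_derivative_compose[OF times_differentiable_on_SucD(1)[OF Suc.prems(1) x] der[OF x]])
    then show "((\<lambda>x. g (f x)) has_derivative
        (\<lambda>v. \<Sum>b\<in>Basis. (deriv_at f x v \<bullet> b) *\<^sub>R deriv_at g (f x) b)) (at x)"
      by (simp only: expand[OF x])
  next
    fix v
    have "times_differentiable_on k U (\<lambda>x. deriv_at g (f x) b)" for b
      using Suc.IH[of "\<lambda>y. deriv_at g y b"] Suc.prems assms(1) times_differentiable_on_Suc_imp
        times_differentiable_on_SucD(2) by blast
    moreover have "times_differentiable_on k U (\<lambda>x. deriv_at f x v \<bullet> b)" for b
      by (rule times_differentiable_on_bounded_linear_comp[OF assms(1) bounded_linear_inner_left])
        (use Suc.prems in auto)
    ultimately show "times_differentiable_on k U (\<lambda>x. \<Sum>b\<in>Basis. (deriv_at f x v \<bullet> b) *\<^sub>R deriv_at g (f x) b)"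
      by (intro times_differentiable_on_sum assms(1)
        times_differentiable_on_bilinear[OF assms(1) bounded_bilinear_scaleR])
  qed
qed

lemma smooth_open_has_derivative:
  "smooth_open U f \<Longrightarrow> x \<in> U \<Longrightarrow> (f has_derivative deriv_at f x) (at x)"
  unfolding smooth_open_def using times_differentiable_on_SucD(1) by blast

lemma smooth_open_deriv: "smooth_open U f \<Longrightarrow> smooth_open U (\<lambda>x. deriv_at f x v)"
  unfolding smooth_open_def using times_differentiable_on_SucD(2) by blast

lemma smooth_open_cont: "smooth_open U f \<Longrightarrow> continuous_on U f"
  unfolding smooth_open_def using times_differentiable_on.simps(1) by blast

lemma smooth_open_cong:
  "smooth_open U f \<Longrightarrow> (\<And>x. x \<in> U \<Longrightarrow> f x = g x) \<Longrightarrow> smooth_open U g"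
  unfolding smooth_open_def using times_differentiable_on_cong by blast

lemma smooth_open_subset: "smooth_open U f \<Longrightarrow> open V \<Longrightarrow> V \<subseteq> U \<Longrightarrow> smooth_open V f"
  unfolding smooth_open_def using times_differentiable_on_subset by blast

lemma smooth_open_local:
  assumes "\<And>x. x \<in> U \<Longrightarrow> \<exists>V. x \<in> V \<and> smooth_open V f" "open U"
  shows "smooth_open U f"
  unfolding smooth_open_def
proof (intro conjI allI assms(2) times_differentiable_on_local)
  fix k x assume "x \<in> U"
  then obtain V where "x \<in> V" "smooth_open V f" using assms(1) by blast
  then show "\<exists>V. open V \<and> x \<in> V \<and> times_differentiable_on k V f"
    unfolding smooth_open_def by blast
qed

lemma smooth_open_const [simp]: "open U \<Longrightarrow> smooth_open U (\<lambda>x. c)"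
  by (simp add: smooth_open_def times_differentiable_on_const)

lemma smooth_open_bounded_linear: "open U \<Longrightarrow> bounded_linear h \<Longrightarrow> smooth_open U h"
  by (simp add: smooth_open_def times_differentiable_on_bounded_linear)

lemma smooth_open_ident [simp]: "open U \<Longrightarrow> smooth_open U (\<lambda>x. x)"
  by (simp add: smooth_open_bounded_linear bounded_linear_ident)

lemma smooth_open_bounded_linear_comp:
  "bounded_linear h \<Longrightarrow> smooth_open U f \<Longrightarrow> smooth_open U (\<lambda>x. h (f x))"
  by (simp add: smooth_open_def times_differentiable_on_bounded_linear_comp)

lemma smooth_open_bilinear:
  "bounded_bilinear pr \<Longrightarrow> smooth_open U f \<Longrightarrow> smooth_open U g \<Longrightarrow> smooth_open U (\<lambda>x. pr (f x) (g x))"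
  by (simp add: smooth_open_def times_differentiable_on_bilinear)

lemmas smooth_open_mult = smooth_open_bilinear[OF bounded_bilinear_mult]
lemmas smooth_open_scaleR = smooth_open_bilinear[OF bounded_bilinear_scaleR]
lemmas smooth_open_inner = smooth_open_bilinear[OF bounded_bilinear_inner]

lemma smooth_open_add: "smooth_open U f \<Longrightarrow> smooth_open U g \<Longrightarrow> smooth_open U (\<lambda>x. f x + g x)"
  by (simp add: smooth_open_def times_differentiable_on_add)

lemma smooth_open_minus: "smooth_open U f \<Longrightarrow> smooth_open U (\<lambda>x. - f x)"
  by (rule smooth_open_bounded_linear_comp[OF bounded_linear_minus[OF bounded_linear_ident]])

lemma smooth_open_diff: "smooth_open U f \<Longrightarrow> smooth_open U g \<Longrightarrow> smooth_open U (\<lambda>x. f x - g x)"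
  using smooth_open_add[OF _ smooth_open_minus, of U f g] by simp

lemma smooth_open_sum:
  "open U \<Longrightarrow> (\<And>i. i \<in> I \<Longrightarrow> smooth_open U (f i)) \<Longrightarrow> smooth_open U (\<lambda>x. \<Sum>i\<in>I. f i x)"
  by (simp add: smooth_open_def times_differentiable_on_sum)

lemma smooth_open_compose:
  fixes f :: "'a::real_normed_vector \<Rightarrow> 'b::euclidean_space" and g :: "'b \<Rightarrow> 'c::real_normed_vector"
  shows "smooth_open U f \<Longrightarrow> smooth_open V g \<Longrightarrow> f ` U \<subseteq> V \<Longrightarrow> smooth_open U (\<lambda>x. g (f x))"
  unfolding smooth_open_def using times_differentiable_on_compose[of U V f _ g] by blast

lemma smooth_open_vimage: "smooth_open U f \<Longrightarrow> open V \<Longrightarrow> open (U \<inter> f -` V)"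
  by (metis continuous_open_preimage smooth_open_cont smooth_open_def)

lemma times_differentiable_on_real_SucI:
  fixes f :: "real \<Rightarrow> real"
  assumes "open U" "\<And>x. x \<in> U \<Longrightarrow> (f has_real_derivative f' x) (at x)" "times_differentiable_on k U f'"
  shows "times_differentiable_on (Suc k) U f"
proof (rule times_differentiable_on_SucI[OF assms(1)])
  show "\<And>x. x \<in> U \<Longrightarrow> (f has_derivative (\<lambda>v. v * f' x)) (at x)"
    using assms(2) by (simp add: has_field_derivative_def mult.commute[of _ "f' _"])
  show "times_differentiable_on k U (\<lambda>x. v * f' x)" for v
    by (rule times_differentiable_on_bounded_linear_comp[OF assms(1) bounded_linear_mult_right assms(3)])
qed

lemma smooth_open_inverse: "smooth_open {0<..} (inverse :: real \<Rightarrow> real)"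
proof -
  have "times_differentiable_on k {0<..} (inverse :: real \<Rightarrow> real)" for k
  proof (induction k)
    case 0
    show ?case by (auto intro!: continuous_intros)
  next
    case (Suc k)
    show ?case
    proof (rule times_differentiable_on_real_SucI)
      show "(inverse has_real_derivative - (inverse x * inverse x)) (at x)" if "x \<in> {0<..}" for x :: real
        using DERIV_inverse[of x] that by (simp add: power2_eq_square)
      show "times_differentiable_on k {0<..} (\<lambda>x::real. - (inverse x * inverse x))"
        by (intro times_differentiable_on_bounded_linear_comp[OF _ bounded_linear_minus[OF bounded_linear_ident]]
          times_differentiable_on_bilinear[OF _ bounded_bilinear_mult] Suc) auto
    qed simp
  qed
  then show ?thesis by (simp add: smooth_open_def)
qed

section \<open>Bump functions\<close>

text \<open>The powers of \<open>1 / t\<close> make the family closed under differentiation up to linear combinations;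
  all members are flat at 0.\<close>

definition flat_exp :: "nat \<Rightarrow> real \<Rightarrow> real" where
  "flat_exp m t = (if t > 0 then inverse t ^ m * exp (- inverse t) else 0)"

lemma flat_exp_tendsto_0: "(flat_exp m \<longlongrightarrow> 0) (at 0)"
proof -
  have "((\<lambda>t. inverse t ^ m * exp (- inverse t)) \<longlongrightarrow> 0) (at_right (0::real))"
  proof -
    have "((\<lambda>x. x ^ m / exp x) \<longlongrightarrow> 0) (at_top :: real filter)" by (rule tendsto_power_div_exp_0)
    then have "((\<lambda>x. inverse x ^ m / exp (inverse x)) \<longlongrightarrow> 0) (at_right (0::real))"
      by (rule filterlim_compose) (rule filterlim_inverse_at_top_right)
    then show ?thesis by (simp add: exp_minus divide_inverse)
  qed
  then have "(flat_exp m \<longlongrightarrow> 0) (at_right 0)"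
    by (rule Lim_transform_eventually)
      (auto simp: flat_exp_def eventually_at_filter)
  moreover have "(flat_exp m \<longlongrightarrow> 0) (at_left 0)"
    by (rule tendsto_eventually) (auto simp: flat_exp_def eventually_at_filter)
  ultimately show ?thesis by (simp add: filterlim_at_split)
qed

lemma flat_exp_deriv:
  "(flat_exp m has_real_derivative (flat_exp (m + 2) t - real m * flat_exp (m + 1) t)) (at t)"
proof (cases t "0::real" rule: linorder_cases)
  case less
  have "((\<lambda>_. 0) has_real_derivative 0) (at t)" by simp
  then have "(flat_exp m has_real_derivative 0) (at t)"
    by (rule has_field_derivative_transform_within_open[of _ _ _ "{..<0}"]) (use less in \<open>auto simp: flat_exp_def\<close>)
  then show ?thesis using less by (simp add: flat_exp_def)
next
  case equal
  have "((\<lambda>h. flat_exp m h / h) \<longlongrightarrow> 0) (at 0)"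
    by (rule Lim_transform_eventually[OF flat_exp_tendsto_0[of "m + 1"]])
      (auto simp: flat_exp_def eventually_at_filter divide_inverse)
  then show ?thesis using equal by (simp add: DERIV_def flat_exp_def)
next
  case greater
  have "((\<lambda>t. inverse t ^ m * exp (- inverse t)) has_real_derivative
      (inverse t ^ (m + 2) * exp (- inverse t) - real m * (inverse t ^ (m + 1) * exp (- inverse t)))) (at t)"
  proof -
    have inv: "(inverse has_real_derivative - (inverse t * inverse t)) (at t)"
      using DERIV_inverse[of t] greater by (simp add: power2_eq_square)
    have pow: "real m * inverse t ^ (m - Suc 0) * (inverse t * inverse t) = real m * inverse t ^ (m + 1)"
      by (cases m) (auto simp: algebra_simps)
    have "((\<lambda>t. inverse t ^ m * exp (- inverse t)) has_real_derivative
        (real m * (- (inverse t * inverse t) * inverse t ^ (m - Suc 0)) * exp (- inverse t)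
          + exp (- inverse t) * (- (- (inverse t * inverse t))) * inverse t ^ m)) (at t)"
      by (intro DERIV_mult DERIV_power[OF inv] DERIV_fun_exp DERIV_minus inv)
    then show ?thesis
      by (rule DERIV_cong) (use pow in \<open>auto simp: algebra_simps\<close>)
  qed
  then have "(flat_exp m has_real_derivative
      (inverse t ^ (m + 2) * exp (- inverse t) - real m * (inverse t ^ (m + 1) * exp (- inverse t)))) (at t)"
    by (rule has_field_derivative_transform_within_open[of _ _ _ "{0<..}"]) (use greater in \<open>auto simp: flat_exp_def\<close>)
  then show ?thesis using greater by (simp add: flat_exp_def)
qed

lemma smooth_flat_exp: "smooth_open UNIV (flat_exp m)"
proof -
  have "times_differentiable_on k UNIV (flat_exp m)" for k
  proof (induction k arbitrary: m)
    case 0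
    show ?case by (auto intro!: DERIV_isCont[OF flat_exp_deriv] continuous_at_imp_continuous_on)
  next
    case (Suc k)
    have "times_differentiable_on k UNIV (\<lambda>t. flat_exp (m + 2) t + (- real m) * flat_exp (m + 1) t)"
      by (intro times_differentiable_on_add Suc
          times_differentiable_on_bounded_linear_comp[OF _ bounded_linear_mult_right]) auto
    then show ?case
      by (intro times_differentiable_on_real_SucI[OF open_UNIV flat_exp_deriv]) simp
  qed
  then show ?thesis by (simp add: smooth_open_def)
qed

text \<open>With \<open>h = exp (- 1 / t)\<close>, extended by 0, and \<open>q\<close> the squared distance from \<open>p\<close>, the quotient
  \<open>h (s\<^sup>2 - q) / (h (s\<^sup>2 - q) + h (q - r\<^sup>2))\<close> works, as the two summands never vanish together.\<close>

lemma smooth_bump: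
  fixes p :: "'e::euclidean_space"
  assumes "0 < r" "r < s"
  shows "\<exists>b :: 'e \<Rightarrow> real. smooth_open UNIV b \<and> (\<forall>x\<in>ball p r. b x = 1) \<and> (\<forall>x. x \<notin> ball p s \<longrightarrow> b x = 0)"
proof -
  let ?h = "flat_exp 0"
  let ?q = "\<lambda>x. (x - p) \<bullet> (x - p)"
  let ?den = "\<lambda>x. ?h (s\<^sup>2 - ?q x) + ?h (?q x - r\<^sup>2)"
  let ?b = "\<lambda>x. ?h (s\<^sup>2 - ?q x) * inverse (?den x)"
  have q: "?q x = (dist p x)\<^sup>2" for x by (metis dist_commute dist_norm power2_norm_eq_inner)
  have rs: "r\<^sup>2 < s\<^sup>2" using assms by (intro power_strict_mono) auto
  have pos: "?den x > 0" for x
  proof (cases "?q x < s\<^sup>2")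
    case True
    then have "?h (s\<^sup>2 - ?q x) > 0" by (simp add: flat_exp_def)
    then show ?thesis by (auto intro!: add_pos_nonneg simp: flat_exp_def)
  next
    case False
    then have "?h (?q x - r\<^sup>2) > 0" using rs by (simp add: flat_exp_def)
    then show ?thesis by (intro add_nonneg_pos) (auto simp: flat_exp_def)
  qed
  have sq: "smooth_open UNIV (\<lambda>x. ?q x)"
    by (intro smooth_open_inner smooth_open_diff) auto
  have s1: "smooth_open UNIV (\<lambda>x. ?h (s\<^sup>2 - ?q x))"
    by (rule smooth_open_compose[OF smooth_open_diff[OF _ sq] smooth_flat_exp]) auto
  have s2: "smooth_open UNIV (\<lambda>x. ?h (?q x - r\<^sup>2))"
    by (rule smooth_open_compose[OF smooth_open_diff[OF sq] smooth_flat_exp]) auto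
  have b: "smooth_open UNIV ?b"
    by (intro smooth_open_mult s1 smooth_open_compose[OF smooth_open_add[OF s1 s2] smooth_open_inverse])
      (use pos in auto)
  have "?b x = 1" if "x \<in> ball p r" for x
  proof -
    have "(dist p x)\<^sup>2 < r\<^sup>2" using that by (intro power_strict_mono) auto
    then show ?thesis using pos[of x] by (simp add: q flat_exp_def)
  qed
  moreover have "?b x = 0" if "x \<notin> ball p s" for x
  proof -
    have "s\<^sup>2 \<le> (dist p x)\<^sup>2" using that assms by (intro power_mono) auto
    then show ?thesis by (simp add: q flat_exp_def)
  qed
  ultimately show ?thesis by (intro exI[of _ ?b] conjI b) auto
qed

section \<open>Hadamard's lemma\<close>

text \<open>Averaging along the rays from the origin is where the partial derivatives of a smooth function get
  integrated in Hadamard's lemma; the weight \<open>t ^ m\<close> makes the statement stable under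
  differentiation, as each derivative produces one factor \<open>t\<close>.\<close>

lemma smooth_open_ray_average:
  fixes h :: "'e::euclidean_space \<Rightarrow> real"
  assumes "smooth_open (ball 0 r) h"
  shows "smooth_open (ball 0 r) (\<lambda>x. integral {0..1} (\<lambda>t. t ^ m * h (t *\<^sub>R x)))"
proof -
  let ?B = "ball (0::'e) r"
  have mem: "t *\<^sub>R x \<in> ?B" if "x \<in> ?B" "t \<in> {0..1}" for x t
  proof -
    have "\<bar>t\<bar> * norm x \<le> norm x" using that mult_right_mono[of "\<bar>t\<bar>" 1 "norm x"] by auto
    then show ?thesis using that by simp
  qed
  have cont: "continuous_on (?B \<times> {0..1}) (\<lambda>(x, t). t ^ n * h (t *\<^sub>R x))"
    if "continuous_on ?B h" for n and h :: "'e \<Rightarrow> real"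
  proof -
    have "continuous_on (?B \<times> {0..1}) (\<lambda>z. h (snd z *\<^sub>R fst z))"
      by (rule continuous_on_compose2[OF that]) (use mem in \<open>auto intro!: continuous_intros\<close>)
    then show ?thesis by (auto simp: case_prod_unfold intro!: continuous_intros)
  qed
  have cont1: "continuous_on {0..1} (\<lambda>t. t ^ n * h (t *\<^sub>R x))"
    if "continuous_on ?B h" "x \<in> ?B" for n x and h :: "'e \<Rightarrow> real"
  proof -
    have "Pair x ` {0..1} \<subseteq> ?B \<times> {0..1::real}" using that(2) by auto
    from continuous_on_compose2[OF cont[OF that(1), of n] _ this]
    show ?thesis by (simp add: continuous_intros)
  qed
  have der: "((\<lambda>x. integral {0..1} (\<lambda>t. t ^ m * h (t *\<^sub>R x))) has_derivative
      (\<lambda>v. integral {0..1} (\<lambda>t. t ^ Suc m * deriv_at h (t *\<^sub>R x0) v))) (at x0)"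
    if h: "smooth_open ?B h" and x0: "x0 \<in> ?B" for h :: "'e \<Rightarrow> real" and m x0
  proof -
    define fx where "fx x t = (\<Sum>b\<in>Basis. (t ^ Suc m * deriv_at h (t *\<^sub>R x) b) *\<^sub>R blinfun_inner_left b)"
      for x :: 'e and t :: real
    have cd: "continuous_on ?B (\<lambda>x. deriv_at h x v)" for v
      by (rule smooth_open_cont[OF smooth_open_deriv[OF h]])
    have fx_apply: "blinfun_apply (fx x t) v = t ^ Suc m * deriv_at h (t *\<^sub>R x) v"
      if "x \<in> ?B" "t \<in> {0..1}" for x t v
    proof -
      have lin: "linear (deriv_at h (t *\<^sub>R x))"
        using smooth_open_has_derivative[OF h mem[OF that]] has_derivative_linear by blast
      have "blinfun_apply (fx x t) v = t ^ Suc m * (\<Sum>b\<in>Basis. (v \<bullet> b) *\<^sub>R deriv_at h (t *\<^sub>R x) b)"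
        by (simp add: fx_def blinfun.sum_left blinfun.scaleR_left sum_distrib_left algebra_simps)
      also have "(\<Sum>b\<in>Basis. (v \<bullet> b) *\<^sub>R deriv_at h (t *\<^sub>R x) b) = deriv_at h (t *\<^sub>R x) v"
        by (rule linear_Basis_expansion[OF lin])
      finally show ?thesis .
    qed
    have "((\<lambda>x. integral (cbox 0 1) (\<lambda>t. t ^ m * h (t *\<^sub>R x))) has_derivative
        blinfun_apply (integral (cbox 0 1) (fx x0))) (at x0 within ?B)"
    proof (rule leibniz_rule[OF _ _ _ x0])
      fix x t assume *: "x \<in> ?B" "t \<in> cbox (0::real) 1"
      have "((\<lambda>x. t ^ m * h (t *\<^sub>R x)) has_derivative (\<lambda>v. t ^ m * deriv_at h (t *\<^sub>R x) (t *\<^sub>R v))) (at x)"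
        using has_derivative_compose[OF has_derivative_scaleR_right[OF has_derivative_ident]
          smooth_open_has_derivative[OF h mem]] *
        by (intro has_derivative_mult_right) auto
      moreover have "(\<lambda>v. t ^ m * deriv_at h (t *\<^sub>R x) (t *\<^sub>R v)) = blinfun_apply (fx x t)"
      proof
        fix v
        have "linear (deriv_at h (t *\<^sub>R x))"
          using has_derivative_linear[OF smooth_open_has_derivative[OF h mem]] * by simp
        then show "t ^ m * deriv_at h (t *\<^sub>R x) (t *\<^sub>R v) = blinfun_apply (fx x t) v"
          using * by (simp add: fx_apply linear_scale)
      qed
      ultimately show "((\<lambda>x. t ^ m * h (t *\<^sub>R x)) has_derivative blinfun_apply (fx x t)) (at x within ?B)"
        by (simp add: has_derivative_at_withinI)
    next
      show "(\<lambda>t. t ^ m * h (t *\<^sub>R x)) integrable_on cbox 0 1" if "x \<in> ?B" for x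
        using cont1[OF smooth_open_cont[OF h] that] by (intro integrable_continuous) auto
      have "continuous_on (?B \<times> cbox 0 1) (\<lambda>z. t_dep z *\<^sub>R blinfun_inner_left b)"
        if "continuous_on (?B \<times> {0..1}) t_dep" for t_dep :: "'e \<times> real \<Rightarrow> real" and b :: 'e
        using that by (auto intro!: continuous_intros)
      then show "continuous_on (?B \<times> cbox 0 1) (\<lambda>(x, t). fx x t)"
        using cont[OF cd, of "Suc m"] unfolding fx_def case_prod_unfold
        by (intro continuous_on_sum) auto
    qed auto
    then have "((\<lambda>x. integral {0..1} (\<lambda>t. t ^ m * h (t *\<^sub>R x))) has_derivative
        blinfun_apply (integral {0..1} (fx x0))) (at x0)"
      using x0 by (simp add: at_within_open[OF x0])
    moreover have "blinfun_apply (integral {0..1} (fx x0)) =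
        (\<lambda>v. integral {0..1} (\<lambda>t. t ^ Suc m * deriv_at h (t *\<^sub>R x0) v))"
    proof
      fix v
      have "continuous_on {0..1} (fx x0)"
        unfolding fx_def by (intro continuous_on_sum continuous_on_scaleR continuous_on_const cont1[OF cd x0, of "Suc m"])
      then have "fx x0 integrable_on {0..1}" by (rule integrable_continuous_interval)
      then have "integral {0..1} (\<lambda>t. blinfun_apply (fx x0 t) v) = blinfun_apply (integral {0..1} (fx x0)) v"
        using integral_linear[of "fx x0" "{0..1}" "\<lambda>f. blinfun_apply f v"] 
        by (simp add: o_def bounded_linear_intros)
      then show "blinfun_apply (integral {0..1} (fx x0)) v =
          integral {0..1} (\<lambda>t. t ^ Suc m * deriv_at h (t *\<^sub>R x0) v)"
        using fx_apply[OF x0] by (metis (no_types, lifting) Henstock_Kurzweil_Integration.integral_cong)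
    qed
    ultimately show ?thesis by simp
  qed
  have "times_differentiable_on k ?B (\<lambda>x. integral {0..1} (\<lambda>t. t ^ m * h (t *\<^sub>R x)))"
    if "smooth_open ?B h" for k h m
    using that
  proof (induction k arbitrary: h m)
    case 0
    show ?case
      using der[OF 0] by (auto intro!: continuous_at_imp_continuous_on has_derivative_continuous)
  next
    case (Suc k)
    show ?case
      by (rule times_differentiable_on_SucI[OF _ der[OF Suc.prems] Suc.IH[OF smooth_open_deriv[OF Suc.prems]]])
        auto
  qed
  then show ?thesis using assms by (simp add: smooth_open_def)
qed

text \<open>Integrate the derivative of \<open>f\<close> along the segment from \<open>p\<close> to \<open>x\<close> and split it into partial derivatives.\<close>

lemma Hadamard:
  fixes f :: "'e::euclidean_space \<Rightarrow> real"
  assumes "smooth_open (ball p r) f"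
  obtains g where "\<And>b. smooth_open (ball p r) (g b)"
    "\<And>x. x \<in> ball p r \<Longrightarrow> f x = f p + (\<Sum>b\<in>Basis. ((x - p) \<bullet> b) * g b x)"
    "\<And>b. r > 0 \<Longrightarrow> g b p = deriv_at f p b"
proof
  let ?F = "\<lambda>x. f (p + x)"
  have shift: "smooth_open (ball 0 r) (\<lambda>x. k (p + x))" if "smooth_open (ball p r) k" for k :: "'e \<Rightarrow> real"
    by (rule smooth_open_compose[OF smooth_open_add[OF smooth_open_const smooth_open_ident] that])
      (auto simp: dist_norm)
  define g where "g b x = integral {0..1} (\<lambda>t. t ^ 0 * deriv_at f (p + t *\<^sub>R (x - p)) b)" for b x
  show "smooth_open (ball p r) (g b)" for b
  proof -
    have 1: "smooth_open (ball 0 r) (\<lambda>x. integral {0..1} (\<lambda>t. t ^ 0 * deriv_at f (p + t *\<^sub>R x) b))"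
      by (rule smooth_open_ray_average[OF shift[OF smooth_open_deriv[OF assms]]])
    show ?thesis unfolding g_def
      by (rule smooth_open_compose[OF smooth_open_diff[OF smooth_open_ident smooth_open_const] 1])
        (auto simp: dist_norm norm_minus_commute)
  qed
  show "g b p = deriv_at f p b" if "r > 0" for b by (simp add: g_def)
  show "f x = f p + (\<Sum>b\<in>Basis. ((x - p) \<bullet> b) * g b x)" if x: "x \<in> ball p r" for x
  proof -
    have mem: "p + t *\<^sub>R (x - p) \<in> ball p r" if "t \<in> {0..1}" for t
    proof -
      have "\<bar>t\<bar> * norm (x - p) \<le> norm (x - p)"
        using that mult_right_mono[of "\<bar>t\<bar>" 1 "norm (x - p)"] by auto
      then show ?thesis using x by (simp add: dist_norm norm_minus_commute)
    qed
    have d: "((\<lambda>t. f (p + t *\<^sub>R (x - p))) has_vector_derivative deriv_at f (p + t *\<^sub>R (x - p)) (x - p)) (at t within {0..1})"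
      if "t \<in> {0..1}" for t
    proof -
      have lin: "linear (deriv_at f (p + t *\<^sub>R (x - p)))"
        using smooth_open_has_derivative[OF assms mem[OF that]] has_derivative_linear by blast
      have "((\<lambda>t. p + t *\<^sub>R (x - p)) has_derivative (\<lambda>s. s *\<^sub>R (x - p))) (at t)"
        by (auto intro!: derivative_eq_intros)
      from has_derivative_compose[OF this smooth_open_has_derivative[OF assms mem[OF that]]]
      show ?thesis
        by (auto simp: has_vector_derivative_def linear_scale[OF lin] intro: has_derivative_at_withinI)
    qed
    have "((\<lambda>t. deriv_at f (p + t *\<^sub>R (x - p)) (x - p)) has_integral (f (p + 1 *\<^sub>R (x - p)) - f (p + 0 *\<^sub>R (x - p)))) {0..1}"
      by (rule fundamental_theorem_of_calculus) (auto intro: d)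
    then have "f x - f p = integral {0..1} (\<lambda>t. deriv_at f (p + t *\<^sub>R (x - p)) (x - p))"
      by (simp add: integral_unique)
    also have "\<dots> = integral {0..1} (\<lambda>t. \<Sum>b\<in>Basis. ((x - p) \<bullet> b) * deriv_at f (p + t *\<^sub>R (x - p)) b)"
    proof (rule Henstock_Kurzweil_Integration.integral_cong)
      fix t :: real assume "t \<in> {0..1}"
      then have lin: "linear (deriv_at f (p + t *\<^sub>R (x - p)))"
        using has_derivative_linear[OF smooth_open_has_derivative[OF assms mem]] by simp
      from linear_Basis_expansion[OF lin, of "x - p"]
      show "deriv_at f (p + t *\<^sub>R (x - p)) (x - p) = (\<Sum>b\<in>Basis. ((x - p) \<bullet> b) * deriv_at f (p + t *\<^sub>R (x - p)) b)"
        by simp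
    qed
    also have "\<dots> = (\<Sum>b\<in>Basis. ((x - p) \<bullet> b) * integral {0..1} (\<lambda>t. deriv_at f (p + t *\<^sub>R (x - p)) b))"
    proof (subst integral_sum)
      show "(\<lambda>t. ((x - p) \<bullet> b) * deriv_at f (p + t *\<^sub>R (x - p)) b) integrable_on {0..1}" if "b \<in> Basis" for b
        by (rule integrable_continuous_interval, intro continuous_intros
            continuous_on_compose2[OF smooth_open_cont[OF smooth_open_deriv[OF assms]]])
          (use mem in auto)
    qed auto
    finally show ?thesis by (simp add: g_def)
  qed
qed

section \<open>Smooth local sections\<close>

text \<open>The product rule at a zero of one factor, where continuity of the other factor is enough. It serves
  below for the entries of an inverse matrix, whose continuity is known before its differentiability.\<close>

lemma has_derivative_scaleR_vanishing:
  fixes g :: "'a::real_normed_vector \<Rightarrow> real"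
  assumes g: "isCont g x0" and k: "(k has_derivative k') (at x0)" and "k x0 = 0"
  shows "((\<lambda>x. g x *\<^sub>R k x) has_derivative (\<lambda>v. g x0 *\<^sub>R k' v)) (at x0)"
proof -
  have bl: "bounded_linear k'" using k by (rule has_derivative_bounded_linear)
  have lim: "((\<lambda>y. norm (k y - k' (y - x0)) / norm (y - x0)) \<longlongrightarrow> 0) (at x0)"
    using k assms(3) by (simp add: has_derivative_iff_norm)
  have "((\<lambda>y. \<bar>g y - g x0\<bar> * (norm (k y - k' (y - x0)) / norm (y - x0) + onorm k')) \<longlongrightarrow> 0 * (0 + onorm k')) (at x0)"
    using g by (intro tendsto_mult tendsto_add lim tendsto_const tendsto_rabs_zero LIM_zero)
      (simp add: isCont_def)
  then have lim0: "((\<lambda>y. \<bar>g y - g x0\<bar> * (norm (k y - k' (y - x0)) / norm (y - x0) + onorm k')) \<longlongrightarrow> 0) (at x0)"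
    by simp
  have bnd: "norm ((g y - g x0) *\<^sub>R k y) / norm (y - x0) \<le>
      \<bar>g y - g x0\<bar> * (norm (k y - k' (y - x0)) / norm (y - x0) + onorm k')" if "y \<noteq> x0" for y
  proof -
    have "norm (k y) \<le> norm (k y - k' (y - x0)) + onorm k' * norm (y - x0)"
      using norm_triangle_sub[of "k y" "k' (y - x0)"] onorm[OF bl, of "y - x0"] by linarith
    then have "norm (k y) / norm (y - x0) \<le> norm (k y - k' (y - x0)) / norm (y - x0) + onorm k'"
      using that by (simp add: field_simps)
    then have "\<bar>g y - g x0\<bar> * (norm (k y) / norm (y - x0)) \<le>
      \<bar>g y - g x0\<bar> * (norm (k y - k' (y - x0)) / norm (y - x0) + onorm k')"
      by (rule mult_left_mono) simp
    then show ?thesis by simp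
  qed
  have "((\<lambda>y. norm ((g y - g x0) *\<^sub>R k y) / norm (y - x0)) \<longlongrightarrow> 0) (at x0)"
    by (rule tendsto_sandwich[OF _ _ tendsto_const lim0])
      (use bnd in \<open>auto simp: eventually_at_filter\<close>)
  then have "((\<lambda>x. (g x - g x0) *\<^sub>R k x) has_derivative (\<lambda>v. 0)) (at x0)"
    using assms(3) by (simp add: has_derivative_iff_norm)
  from has_derivative_add[OF this has_derivative_scaleR_right[OF k, of "g x0"]]
  show ?thesis by (simp add: scaleR_left_diff_distrib)
qed

lemma linear_inverse_linear:
  assumes A: "linear A" and AJ: "\<And>w. A (J w) = w" and JA: "\<And>w. J (A w) = w"
  shows "linear J"
proof (rule linearI)
  fix a b c
  show "J (a + b) = J a + J b" using JA[of "J a + J b"] by (simp add: AJ linear_add[OF A])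
  show "J (c *\<^sub>R a) = c *\<^sub>R J a" using JA[of "c *\<^sub>R J a"] by (simp add: AJ linear_scale[OF A])
qed

text \<open>From \<open>J x - J x0 = - J x0 \<circ> (A x - A x0) \<circ> J x\<close> one first gets continuity of \<open>J\<close> at \<open>x0\<close>, as \<open>J\<close> stays
  bounded near \<open>x0\<close>, and then the derivative, as \<open>A x - A x0\<close> vanishes at \<open>x0\<close>.\<close>

lemma inverse_family_has_derivative:
  fixes A J :: "'a::euclidean_space \<Rightarrow> 'q::euclidean_space \<Rightarrow> 'q"
  assumes "open U" "x0 \<in> U"
    and lin: "\<And>x. x \<in> U \<Longrightarrow> linear (A x)"
    and AJ: "\<And>x w. x \<in> U \<Longrightarrow> A x (J x w) = w"
    and JA: "\<And>x w. x \<in> U \<Longrightarrow> J x (A x w) = w"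
    and der: "\<And>w. ((\<lambda>x. A x w) has_derivative A' w) (at x0)"
  shows "((\<lambda>x. J x w) has_derivative (\<lambda>v. \<Sum>b\<in>Basis. - (J x0 w \<bullet> b) *\<^sub>R J x0 (A' b v))) (at x0)"
proof -
  have linJ: "linear (J x0)" by (rule linear_inverse_linear[OF lin[OF assms(2)] AJ[OF assms(2)] JA[OF assms(2)]])
  then have blJ: "bounded_linear (J x0)" by (rule linear_linear[THEN iffD2])
  obtain C where C: "C > 0" "\<And>w. norm (J x0 w) \<le> C * norm w"
    using linear_bounded_pos[OF linJ] by blast
  define e where "e x = (\<Sum>b\<in>Basis. norm (A x b - A x0 b))" for x
  have expand: "A x u - A x0 u = (\<Sum>b\<in>Basis. (u \<bullet> b) *\<^sub>R (A x b - A x0 b))" if "x \<in> U" for x u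
  proof -
    have "A y u = (\<Sum>b\<in>Basis. (u \<bullet> b) *\<^sub>R A y b)" if "y \<in> U" for y
      by (rule linear_Basis_expansion[OF lin[OF that], symmetric])
    from arg_cong2[OF this[OF that] this[OF assms(2)], of minus] show ?thesis
      by (simp only: scaleR_diff_right sum_subtractf)
  qed
  have e: "norm (A x u - A x0 u) \<le> e x * norm u" if "x \<in> U" for x u
  proof -
    have "norm (A x u - A x0 u) \<le> (\<Sum>b\<in>Basis. norm ((u \<bullet> b) *\<^sub>R (A x b - A x0 b)))"
      by (subst expand[OF that]) (rule norm_sum)
    also have "\<dots> \<le> (\<Sum>b\<in>Basis. norm u * norm (A x b - A x0 b))"
      by (intro sum_mono) (auto intro!: mult_right_mono Basis_le_norm)
    finally show ?thesis by (simp add: e_def sum_distrib_right sum_distrib_left mult.commute)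
  qed
  have e0: "e x \<ge> 0" for x by (simp add: e_def sum_nonneg)
  have elim: "(e \<longlongrightarrow> 0) (at x0)"
  proof -
    have "((\<lambda>x. A x b - A x0 b) \<longlongrightarrow> 0) (at x0)" for b
      using has_derivative_continuous[OF der[of b]] by (simp add: continuous_at LIM_zero)
    then show ?thesis unfolding e_def
      by (intro tendsto_null_sum tendsto_norm_zero) auto
  qed
  have Jeq: "J x u - J x0 u = - J x0 (A x (J x u) - A x0 (J x u))" if "x \<in> U" for x u
    using that assms(2) by (simp add: AJ JA linear_diff[OF linJ])
  \<comment> \<open>Where \<open>A\<close> differs from \<open>A x0\<close> by at most \<open>1 / (2 C)\<close>, the inverse is bounded by \<open>2 C\<close>.\<close>
  have contJ: "isCont (\<lambda>x. J x u) x0" for u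
  proof -
    have ev: "eventually (\<lambda>x. x \<in> U \<and> C * e x < 1/2) (at x0)"
    proof (rule eventually_conj)
      show "eventually (\<lambda>x. x \<in> U) (at x0)"
        using assms(1,2) by (rule eventually_at_in_open')
      have "((\<lambda>x. C * e x) \<longlongrightarrow> C * 0) (at x0)" by (intro tendsto_mult_left elim)
      then show "eventually (\<lambda>x. C * e x < 1/2) (at x0)" by (rule order_tendstoD) simp
    qed
    have "norm (J x u - J x0 u) \<le> C * e x * (2 * C * norm u)" if "x \<in> U" "C * e x < 1/2" for x
    proof -
      let ?j = "norm (J x u)"
      have 1: "norm (J x u - J x0 u) \<le> C * (e x * ?j)"
        unfolding Jeq[OF that(1)] norm_minus_cancel
        using C(2)[of "A x (J x u) - A x0 (J x u)"] e[OF that(1), of "J x u"] C(1)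
        by (meson order_trans mult_left_mono less_imp_le)
      have "C * (e x * ?j) \<le> 1/2 * ?j" using that(2) mult_right_mono[of "C * e x" "1/2" ?j] by (simp add: mult.assoc)
      moreover have "?j \<le> norm (J x0 u) + norm (J x u - J x0 u)" by (rule norm_triangle_sub)
      ultimately have "?j \<le> 2 * C * norm u" using 1 C(2)[of u] by linarith
      then have "C * e x * ?j \<le> C * e x * (2 * C * norm u)"
        using C(1) e0 by (intro mult_left_mono) auto
      then show ?thesis using 1 by (simp add: mult.assoc)
    qed
    then have "eventually (\<lambda>x. norm (J x u - J x0 u) \<le> C * e x * (2 * C * norm u)) (at x0)"
      using ev by (auto elim: eventually_mono)
    moreover have "((\<lambda>x. C * e x * (2 * C * norm u)) \<longlongrightarrow> 0) (at x0)"
      using tendsto_mult[OF tendsto_mult[OF tendsto_const elim, of C] tendsto_const, of "2 * C * norm u"] by simp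
    ultimately have "((\<lambda>x. J x u - J x0 u) \<longlongrightarrow> 0) (at x0)"
      by (rule Lim_null_comparison)
    then show ?thesis by (simp add: isCont_def LIM_zero_cancel)
  qed
  have "((\<lambda>x. \<Sum>b\<in>Basis. - (J x w \<bullet> b) *\<^sub>R J x0 (A x b - A x0 b)) has_derivative
      (\<lambda>v. \<Sum>b\<in>Basis. - (J x0 w \<bullet> b) *\<^sub>R J x0 (A' b v))) (at x0)"
  proof (intro has_derivative_sum has_derivative_scaleR_vanishing)
    fix b :: 'q
    show "isCont (\<lambda>x. - (J x w \<bullet> b)) x0" by (intro continuous_intros contJ)
    have "((\<lambda>x. A x b - A x0 b) has_derivative (\<lambda>v. A' b v - 0)) (at x0)"
      by (intro has_derivative_diff der has_derivative_const)
    then show "((\<lambda>x. J x0 (A x b - A x0 b)) has_derivative (\<lambda>v. J x0 (A' b v))) (at x0)"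
      using bounded_linear.has_derivative[OF blJ] by fastforce
    show "J x0 (A x0 b - A x0 b) = 0" by (simp add: linear_0[OF linJ])
  qed
  then have "((\<lambda>x. J x0 w + (\<Sum>b\<in>Basis. - (J x w \<bullet> b) *\<^sub>R J x0 (A x b - A x0 b))) has_derivative
      (\<lambda>v. 0 + (\<Sum>b\<in>Basis. - (J x0 w \<bullet> b) *\<^sub>R J x0 (A' b v)))) (at x0)"
    by (intro has_derivative_add has_derivative_const)
  then have *: "((\<lambda>x. J x0 w + (\<Sum>b\<in>Basis. - (J x w \<bullet> b) *\<^sub>R J x0 (A x b - A x0 b))) has_derivative
      (\<lambda>v. \<Sum>b\<in>Basis. - (J x0 w \<bullet> b) *\<^sub>R J x0 (A' b v))) (at x0)"
    by simp
  show ?thesis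
  proof (rule has_derivative_transform_within_open[OF * assms(1,2)])
    fix x assume x: "x \<in> U"
    have "J x0 (A x (J x w) - A x0 (J x w)) = (\<Sum>b\<in>Basis. (J x w \<bullet> b) *\<^sub>R J x0 (A x b - A x0 b))"
      by (subst expand[OF x]) (simp only: linear_sum[OF linJ] linear_scale[OF linJ])
    then show "J x0 w + (\<Sum>b\<in>Basis. - (J x w \<bullet> b) *\<^sub>R J x0 (A x b - A x0 b)) = J x w"
      using Jeq[OF x, of w] by (simp add: sum_negf algebra_simps)
  qed
qed

text \<open>The derivative of the inverse is a polynomial in the inverse and the derivative of the family, so the
  order of differentiability can be raised step by step.\<close>

lemma smooth_open_inverse_family:
  fixes A J :: "'a::euclidean_space \<Rightarrow> 'q::euclidean_space \<Rightarrow> 'q"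
  assumes "open U"
    and lin: "\<And>x. x \<in> U \<Longrightarrow> linear (A x)"
    and AJ: "\<And>x w. x \<in> U \<Longrightarrow> A x (J x w) = w"
    and JA: "\<And>x w. x \<in> U \<Longrightarrow> J x (A x w) = w"
    and smooth: "\<And>w. smooth_open U (\<lambda>x. A x w)"
  shows "smooth_open U (\<lambda>x. J x w)"
proof -
  define J' where "J' w x v = (\<Sum>b\<in>Basis. - (J x w \<bullet> b) *\<^sub>R J x (deriv_at (\<lambda>x. A x b) x v))" for w x v
  have der: "((\<lambda>x. J x w) has_derivative J' w x) (at x)" if x: "x \<in> U" for w x
    unfolding J'_def
    by (rule inverse_family_has_derivative[OF assms(1) x lin AJ JA smooth_open_has_derivative[OF smooth x]])
  have J'_eq: "J' w x v = (\<Sum>b\<in>Basis. - (J x w \<bullet> b) *\<^sub>R (\<Sum>c\<in>Basis. (deriv_at (\<lambda>x. A x b) x v \<bullet> c) *\<^sub>R J x c))"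
    if x: "x \<in> U" for w x v
  proof -
    have linJ: "linear (J x)" by (rule linear_inverse_linear[OF lin[OF x] AJ[OF x] JA[OF x]])
    have "J x u = (\<Sum>c\<in>Basis. (u \<bullet> c) *\<^sub>R J x c)" for u by (rule linear_Basis_expansion[OF linJ, symmetric])
    then show ?thesis unfolding J'_def
      by (intro sum.cong[OF refl] arg_cong2[of _ _ _ _ scaleR, OF refl])
  qed
  have "times_differentiable_on k U (\<lambda>x. J x w)" for k w
  proof (induction k arbitrary: w)
    case 0
    show ?case using der by (auto intro!: continuous_at_imp_continuous_on has_derivative_continuous)
  next
    case (Suc k)
    have "times_differentiable_on k U (\<lambda>x. J' w x v)" for v
    proof (rule times_differentiable_on_cong[OF assms(1)])
      have "times_differentiable_on k U (\<lambda>x. deriv_at (\<lambda>x. A x b) x v \<bullet> c)" for b c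
        using times_differentiable_on_bounded_linear_comp[OF assms(1) bounded_linear_inner_left]
          smooth_open_deriv[OF smooth] smooth_open_def by blast
      moreover have "times_differentiable_on k U (\<lambda>x. - (J x w \<bullet> b))" for b
        using times_differentiable_on_bounded_linear_comp[OF assms(1) bounded_linear_minus[OF bounded_linear_inner_left[of b]] Suc] 
        by simp
      ultimately show "times_differentiable_on k U
        (\<lambda>x. \<Sum>b\<in>Basis. - (J x w \<bullet> b) *\<^sub>R (\<Sum>c\<in>Basis. (deriv_at (\<lambda>x. A x b) x v \<bullet> c) *\<^sub>R J x c))"
        by (intro times_differentiable_on_sum assms(1) Suc
            times_differentiable_on_bilinear[OF assms(1) bounded_bilinear_scaleR])
    qed (simp add: J'_eq)
    from times_differentiable_on_SucI[where f' = "J' w", OF assms(1) der this] show ?case .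
  qed
  then show ?thesis using assms(1) by (simp add: smooth_open_def)
qed

text \<open>The derivative of the inverse function \<open>g\<close> at \<open>y\<close> is the inverse of the derivative of \<open>f\<close> at \<open>g y\<close>. As
  inverses of linear maps depend smoothly on them, \<open>g\<close> gains one order of differentiability at a time.\<close>

lemma smooth_inverse_function:
  fixes f :: "'a::euclidean_space \<Rightarrow> 'a"
  assumes f: "smooth_open U f" and x0: "x0 \<in> U" and id: "deriv_at f x0 = (\<lambda>v. v)"
  obtains B g where "f x0 \<in> B" "smooth_open B g" "g (f x0) = x0" "\<And>y. y \<in> B \<Longrightarrow> g y \<in> U \<and> f (g y) = y"
proof -
  have U: "open U" using f by (simp add: smooth_open_def)
  have bl: "bounded_linear (deriv_at f x)" if "x \<in> U" for x
    using smooth_open_has_derivative[OF f that] by (rule has_derivative_bounded_linear)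
  define f' where "f' x = Blinfun (deriv_at f x)" for x
  have f': "blinfun_apply (f' x) = deriv_at f x" if "x \<in> U" for x
    using bl[OF that] by (simp add: f'_def bounded_linear_Blinfun_apply)
  have "continuous_on U f'"
  proof (rule continuous_on_blinfun_componentwise)
    fix i :: 'a
    show "continuous_on U (\<lambda>x. blinfun_apply (f' x) i)"
      using smooth_open_cont[OF smooth_open_deriv[OF f, of i]] f'
      by (simp cong: continuous_on_cong)
  qed
  moreover have "id_blinfun o\<^sub>L f' x0 = id_blinfun"
    by (rule blinfun_eqI) (simp add: f'[OF x0] id)
  ultimately obtain U' B g g' where g: "open U'" "U' \<subseteq> U" "x0 \<in> U'" "open B" "f x0 \<in> B"
    "homeomorphism U' B f g" "\<And>y. y \<in> B \<Longrightarrow> (g has_derivative (g' y)) (at y)"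
    "\<And>y. y \<in> B \<Longrightarrow> g' y = inv (blinfun_apply (f' (g y)))"
    "\<And>y. y \<in> B \<Longrightarrow> bij (blinfun_apply (f' (g y)))"
    using inverse_function_theorem[OF U, of f f' x0 id_blinfun] smooth_open_has_derivative[OF f] f' x0
    by (smt (verit, del_insts))
  have gU: "g ` B = U'" using g(6) by (simp add: homeomorphism_def)
  have bij: "bij (deriv_at f x)" if "x \<in> U'" for x
    using that g(9) gU f' g(2) by (metis imageE subsetD)
  have J: "smooth_open U' (\<lambda>x. inv (deriv_at f x) w)" for w
  proof (rule smooth_open_inverse_family[where A = "\<lambda>x. deriv_at f x"])
    show "linear (deriv_at f x)" if "x \<in> U'" for x
      using bl that g(2) bounded_linear.linear by blast
    show "smooth_open U' (\<lambda>x. deriv_at f x w)" for w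
      by (rule smooth_open_subset[OF smooth_open_deriv[OF f] g(1,2)])
    show "deriv_at f x (inv (deriv_at f x) w) = w" if "x \<in> U'" for x w
      using bij[OF that] by (simp add: bij_is_surj surj_f_inv_f)
    show "inv (deriv_at f x) (deriv_at f x w) = w" if "x \<in> U'" for x w
      using bij[OF that] by (simp add: bij_is_inj)
  qed (rule g(1))
  have "times_differentiable_on k B g" for k
  proof (induction k)
    case 0
    show ?case using g(6) by (simp add: homeomorphism_def)
  next
    case (Suc k)
    show ?case
    proof (rule times_differentiable_on_SucI[OF g(4)])
      show "(g has_derivative (\<lambda>w. inv (deriv_at f (g y)) w)) (at y)" if "y \<in> B" for y
        using g(7,8)[OF that] f' gU g(2) that by (metis (no_types, lifting) imageI subsetD)
      show "times_differentiable_on k B (\<lambda>y. inv (deriv_at f (g y)) v)" for v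
        using times_differentiable_on_compose[OF g(4,1) _ Suc, of "\<lambda>x. inv (deriv_at f x) v"] J gU
        by (auto simp: smooth_open_def)
    qed
  qed
  then have "smooth_open B g" using g(4) by (simp add: smooth_open_def)
  moreover have "g (f x0) = x0" "\<And>y. y \<in> B \<Longrightarrow> g y \<in> U \<and> f (g y) = y"
    using g(6) g(2,3) by (auto simp: homeomorphism_def)
  ultimately show ?thesis using that g(5) by blast
qed

text \<open>A linear projection onto a subspace. It transports maps between subspaces of Euclidean spaces to maps
  between the whole spaces.\<close>

definition proj_on :: "'e::euclidean_space set \<Rightarrow> 'e \<Rightarrow> 'e" where
  "proj_on V = (SOME P. linear P \<and> range P \<subseteq> V \<and> (\<forall>v\<in>V. P v = v))"

lemma proj_on:
  assumes "subspace V"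
  shows linear_proj_on: "linear (proj_on V)" and proj_on_in: "proj_on V x \<in> V"
    and proj_on_ident: "x \<in> V \<Longrightarrow> proj_on V x = x"
proof -
  have "linear (\<lambda>x::'a. x)" by (simp add: linear_iff)
  from linear_exists_right_inverse_on[OF this assms]
  have "\<exists>P::'a \<Rightarrow> 'a. linear P \<and> range P \<subseteq> V \<and> (\<forall>v\<in>V. P v = v)" by auto
  then have "linear (proj_on V) \<and> range (proj_on V) \<subseteq> V \<and> (\<forall>v\<in>V. proj_on V v = v)"
    unfolding proj_on_def by (rule someI_ex)
  then show "linear (proj_on V)" "proj_on V x \<in> V" "x \<in> V \<Longrightarrow> proj_on V x = x" by auto
qed

lemma smooth_open_linear: "open U \<Longrightarrow> linear h \<Longrightarrow> smooth_open U h"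
  for h :: "'a::euclidean_space \<Rightarrow> 'b::real_normed_vector"
  by (simp add: linear_conv_bounded_linear smooth_open_bounded_linear)

text \<open>Let \<open>R\<close> be a linear right inverse of the derivative of \<open>f\<close> at \<open>x0\<close> on \<open>A\<close>, and \<open>P\<close> the projection onto \<open>A\<close>. The map
  \<open>y \<mapsto> f (x0 + R (P y)) + (y - P y)\<close> has derivative the identity at 0; composing its local inverse with
  \<open>y \<mapsto> x0 + R (P y)\<close> gives the section.\<close>

lemma smooth_section:
  fixes f :: "'k::euclidean_space \<Rightarrow> 'q::euclidean_space"
  assumes V: "subspace V" and A: "subspace A" and f: "smooth_open U f" and x0: "x0 \<in> U" "x0 \<in> V"
    and fA: "\<And>x. x \<in> U \<Longrightarrow> x \<in> V \<Longrightarrow> f x \<in> A" and surj: "A \<subseteq> deriv_at f x0 ` V"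
  obtains B s where "f x0 \<in> B" "smooth_open B s" "s (f x0) = x0"
    "\<And>y. y \<in> B \<Longrightarrow> s y \<in> U \<and> s y \<in> V" "\<And>y. y \<in> B \<Longrightarrow> y \<in> A \<Longrightarrow> f (s y) = y"
proof -
  have lD: "linear (deriv_at f x0)"
    using smooth_open_has_derivative[OF f x0(1)] by (rule has_derivative_linear)
  obtain R where R: "range R \<subseteq> V" "linear R" "\<And>v. v \<in> deriv_at f x0 ` V \<Longrightarrow> deriv_at f x0 (R v) = v"
    using linear_exists_right_inverse_on[OF lD V] by blast
  let ?P = "proj_on A"
  note P = linear_proj_on[OF A] proj_on_in[OF A] proj_on_ident[OF A]
  define L where "L y = R (?P y)" for y
  have L: "linear L" unfolding L_def using linear_compose[OF P(1) R(2)] by (simp add: o_def)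
  define h where "h y = x0 + L y" for y
  have hV: "h y \<in> V" for y using R(1) x0(2) V by (auto simp: h_def L_def intro: subspace_add)
  have h: "smooth_open UNIV h" unfolding h_def
    by (intro smooth_open_add smooth_open_const smooth_open_linear L) auto
  have oU: "open U" using f by (simp add: smooth_open_def)
  define W where "W = h -` U"
  have oW: "open W" using smooth_open_vimage[OF h oU] by (simp add: W_def)
  define th where "th y = f (h y) + (y - ?P y)" for y
  have th: "smooth_open W th" unfolding th_def
    by (intro smooth_open_add smooth_open_diff smooth_open_linear P(1) smooth_open_ident oW
        smooth_open_compose[OF smooth_open_subset[OF h oW] f]) (auto simp: W_def)
  have h0: "h 0 = x0" by (simp add: h_def linear_0[OF L])
  have th0: "th 0 = f x0" by (simp add: th_def h0 linear_0[OF P(1)])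
  have 0: "0 \<in> W" using x0 by (simp add: W_def h0)
  have dP: "(?P has_derivative ?P) (at 0)" and dL: "(L has_derivative L) (at 0)"
    using P(1) L by (auto intro!: bounded_linear_imp_has_derivative simp: linear_conv_bounded_linear)
  have dh: "(h has_derivative (\<lambda>v. 0 + L v)) (at 0)" unfolding h_def
    by (intro has_derivative_add has_derivative_const dL)
  have df: "(f has_derivative deriv_at f x0) (at (h 0))"
    using smooth_open_has_derivative[OF f x0(1)] by (simp add: h0)
  have "(th has_derivative (\<lambda>v. deriv_at f x0 (0 + L v) + (v - ?P v))) (at 0)"
    unfolding th_def
    by (intro has_derivative_add has_derivative_diff has_derivative_ident dP has_derivative_compose[OF dh df])
  moreover have "deriv_at f x0 (L v) = ?P v" for v
    unfolding L_def using R(3) P(2) surj by blast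
  ultimately have "(th has_derivative (\<lambda>v. v)) (at 0)" by simp
  then have "deriv_at th 0 = (\<lambda>v. v)" by (rule frechet_derivative_at[symmetric])
  from smooth_inverse_function[OF th 0 this]
  obtain B g where g: "th 0 \<in> B" "smooth_open B g" "g (th 0) = 0" "\<And>y. y \<in> B \<Longrightarrow> g y \<in> W \<and> th (g y) = y"
    by blast
  show ?thesis
  proof
    show "f x0 \<in> B" "h (g (f x0)) = x0" using g(1,3) h0 by (auto simp: th0)
    show "smooth_open B (\<lambda>y. h (g y))" by (rule smooth_open_compose[OF g(2) h]) auto
    show "h (g y) \<in> U \<and> h (g y) \<in> V" if "y \<in> B" for y using g(4)[OF that] hV by (auto simp: W_def)
    show "f (h (g y)) = y" if "y \<in> B" "y \<in> A" for y
    proof -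
      let ?z = "g y"
      have eq: "y = f (h ?z) + (?z - ?P ?z)" using g(4)[OF that(1)] by (simp add: th_def)
      have fz: "f (h ?z) \<in> A" using fA hV g(4)[OF that(1)] by (auto simp: W_def)
      have "?P y = ?P (f (h ?z)) + (?P ?z - ?P (?P ?z))"
        by (subst eq) (simp add: linear_add[OF P(1)] linear_diff[OF P(1)])
      then show ?thesis using P(2,3) that(2) fz by simp
    qed
  qed
qed

section \<open>Smooth functions on manifolds\<close>

subsection \<open>Smoothness on relatively open sets\<close>

lemma smooth_open_imp_open: "smooth_open U f \<Longrightarrow> open U"
  by (simp add: smooth_open_def)

lemma smooth_onI:
  assumes "\<And>x. x \<in> W \<Longrightarrow> \<exists>U g. x \<in> U \<and> smooth_open U g \<and> (\<forall>y\<in>U \<inter> W. g y = f y)"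
  shows "smooth_on W f"
  unfolding smooth_on_def
proof
  fix x assume "x \<in> W"
  from assms[OF this] obtain U g where "x \<in> U" "smooth_open U g" "\<forall>y\<in>U \<inter> W. g y = f y" by blast
  then show "\<exists>U g. open U \<and> x \<in> U \<and> (\<forall>k. times_differentiable_on k U g) \<and> (\<forall>y\<in>U \<inter> W. g y = f y)"
    unfolding smooth_open_def by blast
qed

lemma smooth_onE:
  assumes "smooth_on W f" "x \<in> W"
  obtains U g where "x \<in> U" "smooth_open U g" "\<And>y. y \<in> U \<Longrightarrow> y \<in> W \<Longrightarrow> g y = f y"
proof -
  obtain U g where U: "open U" "x \<in> U" "\<forall>k. times_differentiable_on k U g" "\<forall>y\<in>U \<inter> W. g y = f y"
    using assms unfolding smooth_on_def by blast
  then have "smooth_open U g" unfolding smooth_open_def by blast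
  then show ?thesis using that U by blast
qed

lemma smooth_open_imp_smooth_on: "smooth_open U f \<Longrightarrow> W \<subseteq> U \<Longrightarrow> smooth_on W f"
  by (rule smooth_onI) blast

lemma smooth_on_subset:
  assumes "smooth_on W f" "T \<subseteq> W"
  shows "smooth_on T f"
proof (rule smooth_onI)
  fix x assume "x \<in> T"
  with assms(2) have "x \<in> W" by blast
  from smooth_onE[OF assms(1) this] assms(2)
  show "\<exists>U g. x \<in> U \<and> smooth_open U g \<and> (\<forall>y\<in>U \<inter> T. g y = f y)" by (metis IntE subsetD)
qed

lemma smooth_on_cong:
  assumes "smooth_on W f" "\<And>x. x \<in> W \<Longrightarrow> f x = g x"
  shows "smooth_on W g"
proof (rule smooth_onI)
  fix x assume "x \<in> W"
  from smooth_onE[OF assms(1) this] assms(2)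
  show "\<exists>U h. x \<in> U \<and> smooth_open U h \<and> (\<forall>y\<in>U \<inter> W. h y = g y)" by (metis IntE)
qed

lemma smooth_on_local:
  assumes "\<And>x. x \<in> W \<Longrightarrow> \<exists>T. open T \<and> x \<in> T \<and> smooth_on (W \<inter> T) f"
  shows "smooth_on W f"
proof (rule smooth_onI)
  fix x assume x: "x \<in> W"
  then obtain T where T: "open T" "x \<in> T" "smooth_on (W \<inter> T) f" using assms by blast
  then obtain U g where U: "x \<in> U" "smooth_open U g" "\<And>y. y \<in> U \<Longrightarrow> y \<in> W \<inter> T \<Longrightarrow> g y = f y"
    using smooth_onE[of "W \<inter> T" f x] x by blast
  have "open U" by (rule smooth_open_imp_open[OF U(2)])
  then have "smooth_open (U \<inter> T) g" using U(2) T(1) smooth_open_subset by (metis Int_lower1 open_Int)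
  then show "\<exists>U g. x \<in> U \<and> smooth_open U g \<and> (\<forall>y\<in>U \<inter> W. g y = f y)"
    using U T by (intro exI[of _ "U \<inter> T"] exI[of _ g]) auto
qed

lemma smooth_on_compose:
  fixes f :: "'a::real_normed_vector \<Rightarrow> 'b::euclidean_space" and g :: "'b \<Rightarrow> 'c::real_normed_vector"
  assumes f: "smooth_on W f" and g: "smooth_on Z g" and sub: "f ` W \<subseteq> Z"
  shows "smooth_on W (\<lambda>x. g (f x))"
proof (rule smooth_onI)
  fix x assume x: "x \<in> W"
  obtain U f' where U: "x \<in> U" "smooth_open U f'" "\<And>y. y \<in> U \<Longrightarrow> y \<in> W \<Longrightarrow> f' y = f y"
    using smooth_onE[OF f x] by blast
  obtain T g' where T: "f x \<in> T" "smooth_open T g'" "\<And>y. y \<in> T \<Longrightarrow> y \<in> Z \<Longrightarrow> g' y = g y"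
    using smooth_onE[OF g, of "f x"] x sub by blast
  let ?U = "U \<inter> f' -` T"
  have o: "open ?U" by (rule smooth_open_vimage[OF U(2) smooth_open_imp_open[OF T(2)]])
  have "smooth_open ?U (\<lambda>x. g' (f' x))"
    by (rule smooth_open_compose[OF smooth_open_subset[OF U(2) o] T(2)]) auto
  moreover have "x \<in> ?U" using U(1) U(3)[OF U(1) x] T(1) by simp
  moreover have "\<forall>y\<in>?U \<inter> W. g' (f' y) = g (f y)"
  proof
    fix y assume y: "y \<in> ?U \<inter> W"
    then have "f' y = f y" "f y \<in> Z" using U(3) sub by auto
    then show "g' (f' y) = g (f y)" using T(3)[of "f y"] y by simp
  qed
  ultimately show "\<exists>U h. x \<in> U \<and> smooth_open U h \<and> (\<forall>y\<in>U \<inter> W. h y = g (f y))"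
    by (intro exI[of _ ?U] exI[of _ "\<lambda>x. g' (f' x)"] conjI)
qed

lemma smooth_on_bilinear:
  assumes "bounded_bilinear pr" "smooth_on W f" "smooth_on W g"
  shows "smooth_on W (\<lambda>x. pr (f x) (g x))"
proof (rule smooth_onI)
  fix x assume x: "x \<in> W"
  obtain U f' where U: "x \<in> U" "smooth_open U f'" "\<And>y. y \<in> U \<Longrightarrow> y \<in> W \<Longrightarrow> f' y = f y"
    using smooth_onE[OF assms(2) x] by blast
  obtain T g' where T: "x \<in> T" "smooth_open T g'" "\<And>y. y \<in> T \<Longrightarrow> y \<in> W \<Longrightarrow> g' y = g y"
    using smooth_onE[OF assms(3) x] by blast
  have o: "open (U \<inter> T)" by (intro open_Int smooth_open_imp_open[OF U(2)] smooth_open_imp_open[OF T(2)])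
  have "smooth_open (U \<inter> T) (\<lambda>x. pr (f' x) (g' x))"
    by (rule smooth_open_bilinear[OF assms(1) smooth_open_subset[OF U(2) o Int_lower1]
      smooth_open_subset[OF T(2) o Int_lower2]])
  then show "\<exists>U h. x \<in> U \<and> smooth_open U h \<and> (\<forall>y\<in>U \<inter> W. h y = pr (f y) (g y))"
    using U T by (intro exI[of _ "U \<inter> T"] exI[of _ "\<lambda>x. pr (f' x) (g' x)"]) auto
qed

lemma smooth_on_add:
  assumes "smooth_on W f" "smooth_on W g"
  shows "smooth_on W (\<lambda>x. f x + g x)"
proof (rule smooth_onI)
  fix x assume x: "x \<in> W"
  obtain U f' where U: "x \<in> U" "smooth_open U f'" "\<And>y. y \<in> U \<Longrightarrow> y \<in> W \<Longrightarrow> f' y = f y"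
    using smooth_onE[OF assms(1) x] by blast
  obtain T g' where T: "x \<in> T" "smooth_open T g'" "\<And>y. y \<in> T \<Longrightarrow> y \<in> W \<Longrightarrow> g' y = g y"
    using smooth_onE[OF assms(2) x] by blast
  have o: "open (U \<inter> T)" by (intro open_Int smooth_open_imp_open[OF U(2)] smooth_open_imp_open[OF T(2)])
  have "smooth_open (U \<inter> T) (\<lambda>x. f' x + g' x)"
    by (rule smooth_open_add[OF smooth_open_subset[OF U(2) o Int_lower1]
      smooth_open_subset[OF T(2) o Int_lower2]])
  then show "\<exists>U h. x \<in> U \<and> smooth_open U h \<and> (\<forall>y\<in>U \<inter> W. h y = f y + g y)"
    using U T by (intro exI[of _ "U \<inter> T"] exI[of _ "\<lambda>x. f' x + g' x"]) auto
qed

lemma smooth_on_const: "smooth_on W (\<lambda>x. c)"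
  by (rule smooth_open_imp_smooth_on[of UNIV]) auto

text \<open>Precomposing with a projection onto the model subspace turns smoothness on a relatively open
  subset into smoothness on an open set, where derivatives are defined.\<close>

lemma open_vimage_proj_on:
  assumes "subspace V" "openin (top_of_set V) W"
  shows "open (proj_on V -` W)"
proof -
  obtain T where T: "open T" "W = V \<inter> T" using assms(2) by (auto simp: openin_open)
  have "proj_on V -` W = proj_on V -` T" using T proj_on_in[OF assms(1)] by auto
  moreover have "continuous_on UNIV (proj_on V)"
    using linear_proj_on[OF assms(1)] by (simp add: linear_continuous_on linear_conv_bounded_linear)
  ultimately show ?thesis using T(1) open_vimage by metis
qed

lemma smooth_open_proj_on: "subspace V \<Longrightarrow> open U \<Longrightarrow> smooth_open U (proj_on V)"
  by (simp add: smooth_open_linear linear_proj_on)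

lemma smooth_on_imp_smooth_open:
  assumes "subspace V" "openin (top_of_set V) W" "smooth_on W f"
  shows "smooth_open (proj_on V -` W) (\<lambda>x. f (proj_on V x))"
proof (rule smooth_open_local)
  let ?P = "proj_on V"
  show o: "open (?P -` W)" by (rule open_vimage_proj_on[OF assms(1,2)])
  fix x assume x: "x \<in> ?P -` W"
  then obtain U g where U: "?P x \<in> U" "smooth_open U g" "\<And>y. y \<in> U \<Longrightarrow> y \<in> W \<Longrightarrow> g y = f y"
    using smooth_onE[OF assms(3), of "?P x"] by auto
  let ?U = "(?P -` W) \<inter> ?P -` U"
  have sP: "smooth_open (?P -` W) ?P" using o assms(1) by (simp add: smooth_open_proj_on)
  have oU: "open ?U" by (rule smooth_open_vimage[OF sP smooth_open_imp_open[OF U(2)]])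
  have "smooth_open ?U (\<lambda>x. g (?P x))"
    by (rule smooth_open_compose[OF smooth_open_subset[OF sP oU] U(2)]) auto
  then have "smooth_open ?U (\<lambda>x. f (?P x))"
    by (rule smooth_open_cong) (rule U(3), auto)
  moreover have "x \<in> ?U" using x U(1) by simp
  ultimately show "\<exists>T. x \<in> T \<and> smooth_open T (\<lambda>x. f (?P x))" by (intro exI[of _ ?U] conjI)
qed

subsection \<open>Charts\<close>

lemma
  assumes "smooth_manifold M"
  shows smooth_manifold_Hausdorff: "Hausdorff_space (mfd_top M)"
    and smooth_manifold_second_countable: "second_countable (mfd_top M)"
    and smooth_manifold_model: "subspace (mfd_model M)"
    and smooth_manifold_charts: "\<forall>(U, \<phi>) \<in> mfd_atlas M.
        openin (mfd_top M) U \<and>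
        openin (top_of_set (mfd_model M)) (\<phi> ` U) \<and>
        homeomorphic_map (subtopology (mfd_top M) U) (top_of_set (\<phi> ` U)) \<phi>"
    and smooth_manifold_cover: "(\<Union>(U, \<phi>) \<in> mfd_atlas M. U) = pts M"
    and smooth_manifold_transitions: "\<forall>(U, \<phi>) \<in> mfd_atlas M. \<forall>(V, \<psi>) \<in> mfd_atlas M.
        smooth_on (\<phi> ` (U \<inter> V)) (\<psi> \<circ> inv_into U \<phi>)"
proof -
  note * = assms[unfolded smooth_manifold_def]
  show "Hausdorff_space (mfd_top M)" by (rule conjunct1[OF *])
  note * = conjunct2[OF *]
  show "second_countable (mfd_top M)" by (rule conjunct1[OF *])
  note * = conjunct2[OF *]
  show "subspace (mfd_model M)" by (rule conjunct1[OF *])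
  note * = conjunct2[OF *]
  show "\<forall>(U, \<phi>) \<in> mfd_atlas M.
        openin (mfd_top M) U \<and>
        openin (top_of_set (mfd_model M)) (\<phi> ` U) \<and>
        homeomorphic_map (subtopology (mfd_top M) U) (top_of_set (\<phi> ` U)) \<phi>" by (rule conjunct1[OF *])
  note * = conjunct2[OF *]
  show "(\<Union>(U, \<phi>) \<in> mfd_atlas M. U) = pts M" by (rule conjunct1[OF *])
  show "\<forall>(U, \<phi>) \<in> mfd_atlas M. \<forall>(V, \<psi>) \<in> mfd_atlas M.
        smooth_on (\<phi> ` (U \<inter> V)) (\<psi> \<circ> inv_into U \<phi>)" by (rule conjunct2[OF *])
qed

lemma chart_exists:
  assumes "smooth_manifold M" "p \<in> pts M"
  obtains U \<phi> where "(U, \<phi>) \<in> mfd_atlas M" "p \<in> U"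
  using assms(2) smooth_manifold_cover[OF assms(1)] by blast

context
  fixes M :: "('a, 'e::euclidean_space) manifold" and U \<phi>
  assumes M: "smooth_manifold M" and chart: "(U, \<phi>) \<in> mfd_atlas M"
begin

lemma chart_openin: "openin (mfd_top M) U"
  and chart_image_openin: "openin (top_of_set (mfd_model M)) (\<phi> ` U)"
  and chart_homeomorphic: "homeomorphic_map (subtopology (mfd_top M) U) (top_of_set (\<phi> ` U)) \<phi>"
  using smooth_manifold_charts[OF M] chart by blast+

lemma chart_transition:
  assumes "(V, \<psi>) \<in> mfd_atlas M"
  shows "smooth_on (\<phi> ` (U \<inter> V)) (\<lambda>x. \<psi> (inv_into U \<phi> x))"
  using smooth_manifold_transitions[OF M] chart assms by (fastforce simp: o_def)

lemma chart_subset: "U \<subseteq> pts M"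
  using chart_openin by (rule openin_subset)

lemma chart_inj: "inj_on \<phi> U"
  using homeomorphic_imp_injective_map[OF chart_homeomorphic] chart_subset by (simp add: Int_absorb1)

lemma chart_inv [simp]: "q \<in> U \<Longrightarrow> inv_into U \<phi> (\<phi> q) = q"
  by (rule inv_into_f_f[OF chart_inj])

lemma chart_model: "q \<in> U \<Longrightarrow> \<phi> q \<in> mfd_model M"
  using openin_subset[OF chart_image_openin] by auto

lemma chart_proj [simp]: "q \<in> U \<Longrightarrow> proj_on (mfd_model M) (\<phi> q) = \<phi> q"
  by (rule proj_on_ident[OF smooth_manifold_model[OF M] chart_model])

lemma chart_open_image:
  assumes "openin (mfd_top M) W" "W \<subseteq> U"
  shows "openin (top_of_set (mfd_model M)) (\<phi> ` W)"
proof -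
  have "openin (subtopology (mfd_top M) U) W" using assms by (simp add: openin_open_subtopology chart_openin)
  then have "openin (top_of_set (\<phi> ` U)) (\<phi> ` W)"
    using chart_homeomorphic homeomorphic_imp_open_map open_map_def by blast
  then show ?thesis using chart_image_openin openin_trans by blast
qed

lemma chart_open_preimage:
  assumes "openin (top_of_set (mfd_model M)) T"
  shows "openin (mfd_top M) {q \<in> U. \<phi> q \<in> T}"
proof -
  have "openin (top_of_set (\<phi> ` U)) (\<phi> ` U \<inter> T)"
  proof -
    obtain S where S: "open S" "T = mfd_model M \<inter> S" using assms by (auto simp: openin_open)
    then have "\<phi> ` U \<inter> T = \<phi> ` U \<inter> S" using openin_subset[OF chart_image_openin] by auto
    then show ?thesis using S(1) by (auto simp: openin_open)
  qed
  moreover have "continuous_map (subtopology (mfd_top M) U) (top_of_set (\<phi> ` U)) \<phi>"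
    by (rule homeomorphic_imp_continuous_map[OF chart_homeomorphic])
  ultimately have "openin (subtopology (mfd_top M) U) {q \<in> topspace (subtopology (mfd_top M) U). \<phi> q \<in> \<phi> ` U \<inter> T}"
    by (rule openin_continuous_map_preimage[rotated])
  moreover have "{q \<in> topspace (subtopology (mfd_top M) U). \<phi> q \<in> \<phi> ` U \<inter> T} = {q \<in> U. \<phi> q \<in> T}"
    using chart_subset by auto
  ultimately show ?thesis using openin_trans_full chart_openin by metis
qed

end

abbreviation in_chart :: "('a, 'e::euclidean_space) manifold \<Rightarrow> 'a set \<Rightarrow> ('a \<Rightarrow> 'e) \<Rightarrow> ('a \<Rightarrow> 'c) \<Rightarrow> 'e \<Rightarrow> 'c" where
  "in_chart M U \<phi> f \<equiv> \<lambda>x. f (inv_into U \<phi> (proj_on (mfd_model M) x))"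

abbreviation chart_vimage :: "('a, 'e::euclidean_space) manifold \<Rightarrow> ('a \<Rightarrow> 'e) \<Rightarrow> 'a set \<Rightarrow> 'e set" where
  "chart_vimage M \<phi> W \<equiv> proj_on (mfd_model M) -` (\<phi> ` W)"

subsection \<open>Smooth functions\<close>

lemma smooth_fun_onD:
  "smooth_fun_on M W f \<Longrightarrow> (U, \<phi>) \<in> mfd_atlas M \<Longrightarrow> smooth_on (\<phi> ` (U \<inter> W)) (\<lambda>x. f (inv_into U \<phi> x))"
  unfolding smooth_fun_on_def o_def by (drule (1) bspec) simp

lemma smooth_fun_onI:
  assumes "\<And>U \<phi>. (U, \<phi>) \<in> mfd_atlas M \<Longrightarrow> smooth_on (\<phi> ` (U \<inter> W)) (\<lambda>x. f (inv_into U \<phi> x))"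
  shows "smooth_fun_on M W f"
  unfolding smooth_fun_on_def o_def using assms by auto

lemma smooth_fun_on_subset: "smooth_fun_on M W f \<Longrightarrow> T \<subseteq> W \<Longrightarrow> smooth_fun_on M T f"
  by (rule smooth_fun_onI, rule smooth_on_subset[OF smooth_fun_onD[of M W f]]) auto

lemma smooth_fun_on_const: "smooth_fun_on M W (\<lambda>x. c)"
  by (intro smooth_fun_onI smooth_on_const)

lemma smooth_fun_on_cong:
  assumes "smooth_manifold M" "smooth_fun_on M W f" "\<And>x. x \<in> W \<Longrightarrow> f x = g x"
  shows "smooth_fun_on M W g"
proof (rule smooth_fun_onI)
  fix U \<phi> assume c: "(U, \<phi>) \<in> mfd_atlas M"
  show "smooth_on (\<phi> ` (U \<inter> W)) (\<lambda>x. g (inv_into U \<phi> x))"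
    by (rule smooth_on_cong[OF smooth_fun_onD[OF assms(2) c]]) (use chart_inv[OF assms(1) c] assms(3) in auto)
qed

lemma smooth_fun_on_add: "smooth_fun_on M W f \<Longrightarrow> smooth_fun_on M W g \<Longrightarrow> smooth_fun_on M W (\<lambda>x. f x + g x)"
  by (rule smooth_fun_onI, rule smooth_on_add) (erule (1) smooth_fun_onD)+

lemma smooth_fun_on_mult: "smooth_fun_on M W f \<Longrightarrow> smooth_fun_on M W g \<Longrightarrow> smooth_fun_on M W (\<lambda>x. f x * g x)"
  by (rule smooth_fun_onI, rule smooth_on_bilinear[OF bounded_bilinear_mult]) (erule (1) smooth_fun_onD)+

lemma smooth_funs_iff: "f \<in> smooth_funs M \<longleftrightarrow> smooth_fun_on M (pts M) f \<and> (\<forall>x. x \<notin> pts M \<longrightarrow> f x = 0)"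
  by (simp add: smooth_funs_def)

lemma smooth_funs_lincomb:
  "f \<in> smooth_funs M \<Longrightarrow> g \<in> smooth_funs M \<Longrightarrow> (\<lambda>x. a * f x + b * g x) \<in> smooth_funs M"
  by (simp add: smooth_funs_iff smooth_fun_on_add smooth_fun_on_mult smooth_fun_on_const)

lemma smooth_funs_mult:
  "f \<in> smooth_funs M \<Longrightarrow> g \<in> smooth_funs M \<Longrightarrow> (\<lambda>x. f x * g x) \<in> smooth_funs M"
  by (simp add: smooth_funs_iff smooth_fun_on_mult)

lemma smooth_funs_zero: "(\<lambda>x. 0) \<in> smooth_funs M"
  by (simp add: smooth_funs_iff smooth_fun_on_const)

lemma smooth_funs_sum: "(\<And>i. i \<in> I \<Longrightarrow> f i \<in> smooth_funs M) \<Longrightarrow> (\<lambda>x. \<Sum>i\<in>I. f i x) \<in> smooth_funs M"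
proof (induction I rule: infinite_finite_induct)
  case (insert j I)
  then show ?case using smooth_funs_lincomb[of "f j" M "\<lambda>x. \<Sum>i\<in>I. f i x" 1 1] by simp
qed (simp_all add: smooth_funs_zero)

lemma smooth_funs_const:
  assumes "smooth_manifold M"
  shows "(\<lambda>x. if x \<in> pts M then c else 0) \<in> smooth_funs M"
  using smooth_fun_on_cong[OF assms smooth_fun_on_const] by (auto simp: smooth_funs_iff)

lemma chart_inv_continuous:
  assumes M: "smooth_manifold M" and c: "(U, \<phi>) \<in> mfd_atlas M"
  shows "continuous_map (top_of_set (\<phi> ` U)) (subtopology (mfd_top M) U) (inv_into U \<phi>)"
proof -
  obtain g where g: "homeomorphic_maps (subtopology (mfd_top M) U) (top_of_set (\<phi> ` U)) \<phi> g"
    using chart_homeomorphic[OF M c] by (auto simp: homeomorphic_map_maps)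
  have 1: "continuous_map (top_of_set (\<phi> ` U)) (subtopology (mfd_top M) U) g"
    using g by (simp add: homeomorphic_maps_def)
  have "g (\<phi> q) = q" if "q \<in> U" for q
    using g that chart_subset[OF M c] by (auto simp: homeomorphic_maps_def)
  then show ?thesis
    by (intro continuous_map_eq[OF 1]) (auto simp: chart_inv[OF M c])
qed

text \<open>One chart around each point is enough, because the transition maps are smooth.\<close>

lemma smooth_fun_on_local:
  assumes M: "smooth_manifold M"
    and loc: "\<And>p. p \<in> W \<Longrightarrow> \<exists>U \<phi> T. (U, \<phi>) \<in> mfd_atlas M \<and> p \<in> T \<and> openin (mfd_top M) T \<and> T \<subseteq> U \<and>
      smooth_on (\<phi> ` (T \<inter> W)) (\<lambda>x. f (inv_into U \<phi> x))"
  shows "smooth_fun_on M W f"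
proof (rule smooth_fun_onI, rule smooth_on_local)
  fix V \<psi> x assume c: "(V, \<psi>) \<in> mfd_atlas M" and "x \<in> \<psi> ` (V \<inter> W)"
  then obtain p where p: "p \<in> V" "p \<in> W" "x = \<psi> p" by blast
  obtain U \<phi> T where T: "(U, \<phi>) \<in> mfd_atlas M" "p \<in> T" "openin (mfd_top M) T" "T \<subseteq> U"
      "smooth_on (\<phi> ` (T \<inter> W)) (\<lambda>x. f (inv_into U \<phi> x))"
    using loc[OF p(2)] by blast
  have "openin (top_of_set (mfd_model M)) (\<psi> ` (T \<inter> V))"
    by (rule chart_open_image[OF M c openin_Int[OF T(3) chart_openin[OF M c]]]) simp
  then obtain S where S: "open S" "\<psi> ` (T \<inter> V) = mfd_model M \<inter> S" by (auto simp: openin_open)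
  have sub: "y \<in> \<psi> ` (T \<inter> V \<inter> W)" if y: "y \<in> \<psi> ` (V \<inter> W) \<inter> S" for y
  proof -
    obtain q where q: "q \<in> V" "q \<in> W" "y = \<psi> q" using y by blast
    then have "y \<in> \<psi> ` (T \<inter> V)" using S(2) y chart_model[OF M c] by auto
    then obtain q' where "q' \<in> T" "q' \<in> V" "y = \<psi> q'" by blast
    then show ?thesis using q inj_onD[OF chart_inj[OF M c]] by auto
  qed
  have "smooth_on (\<psi> ` (T \<inter> V \<inter> W)) (\<lambda>x. f (inv_into U \<phi> (\<phi> (inv_into V \<psi> x))))"
  proof (rule smooth_on_compose[OF _ T(5)])
    show "smooth_on (\<psi> ` (T \<inter> V \<inter> W)) (\<lambda>x. \<phi> (inv_into V \<psi> x))"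
      by (rule smooth_on_subset[OF chart_transition[OF M c T(1)]]) (use T(4) in blast)
    show "(\<lambda>x. \<phi> (inv_into V \<psi> x)) ` (\<psi> ` (T \<inter> V \<inter> W)) \<subseteq> \<phi> ` (T \<inter> W)"
      by (auto simp: chart_inv[OF M c])
  qed
  then have "smooth_on (\<psi> ` (T \<inter> V \<inter> W)) (\<lambda>x. f (inv_into V \<psi> x))"
    by (rule smooth_on_cong) (use T(4) in \<open>auto simp: chart_inv[OF M c] chart_inv[OF M T(1)]\<close>)
  then have "smooth_on (\<psi> ` (V \<inter> W) \<inter> S) (\<lambda>x. f (inv_into V \<psi> x))"
    by (rule smooth_on_subset) (use sub in blast)
  moreover have "x \<in> S" using S(2) T(2) p by blast
  ultimately show "\<exists>S. open S \<and> x \<in> S \<and> smooth_on (\<psi> ` (V \<inter> W) \<inter> S) (\<lambda>x. f (inv_into V \<psi> x))"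
    using S(1) by blast
qed

lemma in_chart_smooth:
  assumes M: "smooth_manifold M" and c: "(U, \<phi>) \<in> mfd_atlas M" and W: "openin (mfd_top M) W" "W \<subseteq> U"
    and f: "smooth_fun_on M W f"
  shows "smooth_open (chart_vimage M \<phi> W) (in_chart M U \<phi> f)"
proof (rule smooth_on_imp_smooth_open[OF smooth_manifold_model[OF M] chart_open_image[OF M c W]])
  show "smooth_on (\<phi> ` W) (\<lambda>x. f (inv_into U \<phi> x))"
    using smooth_fun_onD[OF f c] W(2) by (simp add: Int_absorb1)
qed

lemma in_chart_smooth_funs:
  assumes "smooth_manifold M" "(U, \<phi>) \<in> mfd_atlas M" "f \<in> smooth_funs M"
  shows "smooth_open (chart_vimage M \<phi> U) (in_chart M U \<phi> f)"
proof -
  have "smooth_fun_on M (pts M) f" using assms(3) by (simp add: smooth_funs_iff)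
  from smooth_fun_on_subset[OF this chart_subset[OF assms(1,2)]]
  show ?thesis by (rule in_chart_smooth[OF assms(1,2) chart_openin[OF assms(1,2)] subset_refl])
qed

lemma chart_in_vimage:
  assumes "smooth_manifold M" "(U, \<phi>) \<in> mfd_atlas M" "q \<in> U" "q \<in> W"
  shows "\<phi> q \<in> chart_vimage M \<phi> W"
  using assms chart_proj by fastforce

lemma smooth_cutoff:
  fixes h :: "'e::euclidean_space \<Rightarrow> real"
  assumes h: "smooth_open T h" and x: "x \<in> T" and e: "e > 0"
  obtains k r where "smooth_open UNIV k" "r > 0" "\<And>y. y \<in> ball x r \<Longrightarrow> k y = h y"
    "\<And>y. y \<notin> ball x e \<Longrightarrow> k y = 0"
proof -
  obtain d where d: "d > 0" "ball x d \<subseteq> T" using x smooth_open_imp_open[OF h] open_contains_ball by blast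
  define m where "m = min d e"
  have m: "m > 0" "ball x m \<subseteq> T" "m \<le> e" using d e by (auto simp: m_def)
  have m4: "0 < m/4" "m/4 < m/2" using m(1) by auto
  obtain b :: "'e \<Rightarrow> real" where b: "smooth_open UNIV b" "\<And>y. y \<in> ball x (m/4) \<Longrightarrow> b y = 1" "\<And>y. y \<notin> ball x (m/2) \<Longrightarrow> b y = 0"
    using smooth_bump[OF m4, of x] by auto
  define k where "k y = (if y \<in> ball x m then b y * h y else 0)" for y
  have 1: "smooth_open (ball x m) k"
    by (rule smooth_open_cong[OF smooth_open_mult[OF smooth_open_subset[OF b(1)] smooth_open_subset[OF h]]])
      (use m(2) in \<open>auto simp: k_def\<close>)
  have 2: "smooth_open (- cball x (m/2)) k"
    by (rule smooth_open_cong[OF smooth_open_const[of _ 0]]) (auto simp: k_def b(3))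
  have "smooth_open UNIV k"
  proof (rule smooth_open_local)
    fix y
    show "\<exists>V. y \<in> V \<and> smooth_open V k"
    proof (cases "y \<in> ball x m")
      case True then show ?thesis using 1 by blast
    next
      case False
      then have "y \<in> - cball x (m/2)" using m(1) by auto
      then show ?thesis using 2 by blast
    qed
  qed simp
  moreover have "k y = h y" if "y \<in> ball x (m/4)" for y
    using that b(2) m(1) by (auto simp: k_def)
  moreover have "k y = 0" if "y \<notin> ball x e" for y
    using that m by (auto simp: k_def)
  ultimately show ?thesis using that[of k "m/4"] m(1) by simp
qed

text \<open>Cut off in the chart and extend by 0. The support of the cutoff is compact in the chart domain, hence
  closed in the manifold, which is Hausdorff; so the extension is smooth at the points off the chart, too.\<close>

lemma smooth_funs_extension:
  fixes M :: "('a, 'e::euclidean_space) manifold"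
  assumes M: "smooth_manifold M" and c: "(U, \<phi>) \<in> mfd_atlas M" and p: "p \<in> U"
    and W: "openin (mfd_top M) W" "p \<in> W" and h: "smooth_open T h" "\<phi> p \<in> T"
  obtains f T' where "f \<in> smooth_funs M" "open T'" "\<phi> p \<in> T'" "T' \<subseteq> T" "T' \<subseteq> chart_vimage M \<phi> (U \<inter> W)"
    "\<And>x. x \<in> T' \<Longrightarrow> in_chart M U \<phi> f x = h (proj_on (mfd_model M) x)" "\<And>q. q \<notin> W \<Longrightarrow> f q = 0"
proof -
  let ?V = "mfd_model M" and ?P = "proj_on (mfd_model M)"
  note V = smooth_manifold_model[OF M]
  have oW: "openin (mfd_top M) (U \<inter> W)" by (rule openin_Int[OF chart_openin[OF M c] W(1)])
  have img: "openin (top_of_set ?V) (\<phi> ` (U \<inter> W))" by (rule chart_open_image[OF M c oW]) simp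
  then obtain S where S: "open S" "\<phi> ` (U \<inter> W) = ?V \<inter> S" by (auto simp: openin_open)
  have pS: "\<phi> p \<in> S" using S p W(2) by blast
  then obtain e where e: "e > 0" "cball (\<phi> p) e \<subseteq> S" using S(1) open_contains_cball by blast
  obtain k r where k: "smooth_open UNIV k" "r > 0" "\<And>y. y \<in> ball (\<phi> p) r \<Longrightarrow> k y = h y"
    "\<And>y. y \<notin> ball (\<phi> p) e \<Longrightarrow> k y = 0"
    using smooth_cutoff[OF h e(1)] by blast
  define f where "f q = (if q \<in> U \<inter> W then k (\<phi> q) else 0)" for q
  define K where "K = inv_into U \<phi> ` (?V \<inter> cball (\<phi> p) e)"
  have KW: "K \<subseteq> U \<inter> W"
  proof
    fix q assume "q \<in> K"
    then obtain x where x: "x \<in> ?V \<inter> cball (\<phi> p) e" "q = inv_into U \<phi> x" unfolding K_def by blast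
    then have "x \<in> \<phi> ` (U \<inter> W)" using e(2) S(2) by blast
    then show "q \<in> U \<inter> W" using x(2) chart_inv[OF M c] by auto
  qed
  have "compactin (mfd_top M) K"
  proof -
    note cm = chart_inv_continuous[OF M c]
    have "compact (?V \<inter> cball (\<phi> p) e)" by (simp add: closed_Int_compact closed_subspace V)
    then have "compactin (top_of_set (\<phi> ` U)) (?V \<inter> cball (\<phi> p) e)"
      using e(2) S(2) by (auto simp: compactin_subtopology)
    from image_compactin[OF this cm] show ?thesis by (simp add: K_def compactin_subtopology)
  qed
  then have Kcl: "closedin (mfd_top M) K" using smooth_manifold_Hausdorff[OF M] compactin_imp_closedin by blast
  have f0: "f q = 0" if "q \<notin> K" for q
  proof (cases "q \<in> U \<inter> W")
    case True
    have "\<phi> q \<notin> cball (\<phi> p) e"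
    proof
      assume "\<phi> q \<in> cball (\<phi> p) e"
      then have "\<phi> q \<in> ?V \<inter> cball (\<phi> p) e" using True chart_model[OF M c] by blast
      then have "inv_into U \<phi> (\<phi> q) \<in> K" unfolding K_def by (rule imageI)
      then show False using that True chart_inv[OF M c] by simp
    qed
    then show ?thesis using k(4) by (auto simp: f_def)
  qed (auto simp: f_def)
  have "smooth_fun_on M (pts M) f"
  proof (rule smooth_fun_on_local[OF M])
    fix q assume q: "q \<in> pts M"
    show "\<exists>U \<phi> T. (U, \<phi>) \<in> mfd_atlas M \<and> q \<in> T \<and> openin (mfd_top M) T \<and> T \<subseteq> U \<and>
      smooth_on (\<phi> ` (T \<inter> pts M)) (\<lambda>x. f (inv_into U \<phi> x))"
    proof (cases "q \<in> U \<inter> W")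
      case True
      have "smooth_on (\<phi> ` (U \<inter> W \<inter> pts M)) (\<lambda>x. f (inv_into U \<phi> x))"
        by (rule smooth_on_cong[OF smooth_open_imp_smooth_on[OF k(1)]]) (auto simp: f_def chart_inv[OF M c])
      then show ?thesis using True c oW by blast
    next
      case False
      then have "q \<notin> K" using KW by blast
      obtain U' \<phi>' where c': "(U', \<phi>') \<in> mfd_atlas M" "q \<in> U'" using chart_exists[OF M q] by blast
      have o: "openin (mfd_top M) (U' - K)" using chart_openin[OF M c'(1)] Kcl by (rule openin_diff)
      have "smooth_on (\<phi>' ` ((U' - K) \<inter> pts M)) (\<lambda>x. f (inv_into U' \<phi>' x))"
        by (rule smooth_on_cong[OF smooth_on_const[of _ 0]]) (auto simp: f0 chart_inv[OF M c'(1)])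
      then show ?thesis using c' o \<open>q \<notin> K\<close> by blast
    qed
  qed
  then have fs: "f \<in> smooth_funs M" using chart_subset[OF M c] by (auto simp: smooth_funs_iff f_def)
  let ?T = "chart_vimage M \<phi> (U \<inter> W) \<inter> T \<inter> ?P -` ball (\<phi> p) r"
  have ov: "open (chart_vimage M \<phi> (U \<inter> W))" by (rule open_vimage_proj_on[OF V img])
  have "open (?P -` ball (\<phi> p) r)"
    using smooth_open_vimage[OF smooth_open_proj_on[OF V open_UNIV] open_ball] by simp
  then have 1: "open ?T" using ov smooth_open_imp_open[OF h(1)] by blast
  have 2: "\<phi> p \<in> ?T" using chart_in_vimage[OF M c p, of "U \<inter> W"] p W(2) h(2) chart_proj[OF M c p] k(2) by simp
  have 3: "in_chart M U \<phi> f x = h (?P x)" if "x \<in> ?T" for x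
  proof -
    have "?P x \<in> \<phi> ` (U \<inter> W)" using that by simp
    then obtain q where q: "q \<in> U \<inter> W" "?P x = \<phi> q" by blast
    then show ?thesis using k(3)[of "?P x"] that chart_inv[OF M c] by (simp add: f_def)
  qed
  show ?thesis by (rule that[OF fs 1 2 _ _ 3]) (auto simp: f_def)
qed

section \<open>Tangent vectors in charts\<close>

lemma deriv_at_cong:
  assumes "(F has_derivative F') (at x)" "open T" "x \<in> T" "\<And>y. y \<in> T \<Longrightarrow> F y = G y"
  shows "deriv_at G x = deriv_at F x"
  using has_derivative_transform_within_open[OF assms] assms(1) frechet_derivative_at by metis

lemma smooth_funs_germ:
  fixes M :: "('a, 'e::euclidean_space) manifold"
  assumes M: "smooth_manifold M" and c: "(U, \<phi>) \<in> mfd_atlas M" and p: "p \<in> U"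
    and h: "smooth_open T h" "\<phi> p \<in> T"
  shows "\<exists>f W. f \<in> smooth_funs M \<and> openin (mfd_top M) W \<and> p \<in> W \<and> W \<subseteq> U \<and> (\<forall>q\<in>W. f q = h (\<phi> q))"
proof -
  obtain f T' where f: "f \<in> smooth_funs M" "open T'" "\<phi> p \<in> T'" "T' \<subseteq> T" "T' \<subseteq> chart_vimage M \<phi> (U \<inter> U)"
    "\<And>x. x \<in> T' \<Longrightarrow> in_chart M U \<phi> f x = h (proj_on (mfd_model M) x)" "\<And>q. q \<notin> U \<Longrightarrow> f q = 0"
    using smooth_funs_extension[OF M c p chart_openin[OF M c] p h] by blast
  let ?W = "{q \<in> U. \<phi> q \<in> mfd_model M \<inter> T'}"
  have "openin (mfd_top M) ?W"
    by (rule chart_open_preimage[OF M c]) (simp add: openin_open_Int f(2))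
  moreover have "p \<in> ?W" using p f(3) chart_model[OF M c] by simp
  moreover have "f q = h (\<phi> q)" if "q \<in> ?W" for q
    using f(6)[of "\<phi> q"] that chart_proj[OF M c, of q] chart_inv[OF M c, of q] by simp
  ultimately show ?thesis using f(1) by (intro exI[of _ f] exI[of _ ?W]) auto
qed

lemma deriv_germ:
  assumes M: "smooth_manifold M" and c: "(U, \<phi>) \<in> mfd_atlas M" and p: "p \<in> W"
    and W: "openin (mfd_top M) W" "W \<subseteq> U" and eq: "\<And>q. q \<in> W \<Longrightarrow> f q = h (\<phi> q)"
    and h: "smooth_open T h" "\<phi> p \<in> T"
  shows "deriv_at (in_chart M U \<phi> f) (\<phi> p) u = deriv_at h (\<phi> p) (proj_on (mfd_model M) u)"
proof -
  let ?P = "proj_on (mfd_model M)"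
  note V = smooth_manifold_model[OF M]
  have pU: "p \<in> U" using p W(2) by blast
  have o: "open (chart_vimage M \<phi> W)" by (rule open_vimage_proj_on[OF V chart_open_image[OF M c W]])
  have dP: "(?P has_derivative ?P) (at (\<phi> p))"
    using linear_proj_on[OF V] by (auto intro!: bounded_linear_imp_has_derivative simp: linear_conv_bounded_linear)
  have "(h has_derivative deriv_at h (\<phi> p)) (at (?P (\<phi> p)))"
    using smooth_open_has_derivative[OF h] chart_proj[OF M c pU] by simp
  from has_derivative_compose[OF dP this]
  have d: "((\<lambda>x. h (?P x)) has_derivative (\<lambda>v. deriv_at h (\<phi> p) (?P v))) (at (\<phi> p))" .
  have "deriv_at (in_chart M U \<phi> f) (\<phi> p) = deriv_at (\<lambda>x. h (?P x)) (\<phi> p)"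
  proof (rule deriv_at_cong[OF d o chart_in_vimage[OF M c pU p]])
    fix y assume "y \<in> chart_vimage M \<phi> W"
    then obtain q where "q \<in> W" "?P y = \<phi> q" by auto
    then show "h (?P y) = in_chart M U \<phi> f y" using chart_inv[OF M c, of q] eq W(2) by auto
  qed
  then show ?thesis using frechet_derivative_at[OF d] by metis
qed

text \<open>The directional derivative along \<open>u\<close> in a chart. Every tangent vector has this form, for a unique
  \<open>u\<close> in the model space, which makes the abstract derivations computable.\<close>

definition tvec :: "('a, 'e::euclidean_space) manifold \<Rightarrow> 'a set \<Rightarrow> ('a \<Rightarrow> 'e) \<Rightarrow> 'a \<Rightarrow> 'e \<Rightarrow> 'a tangent" where
  "tvec M U \<phi> p u = (\<lambda>f. if f \<in> smooth_funs M then deriv_at (in_chart M U \<phi> f) (\<phi> p) u else 0)"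

context
  fixes M :: "('a, 'e::euclidean_space) manifold" and U \<phi> p
  assumes M: "smooth_manifold M" and chart: "(U, \<phi>) \<in> mfd_atlas M" and p: "p \<in> U"
begin

lemma in_chart_has_derivative:
  "f \<in> smooth_funs M \<Longrightarrow>
    (in_chart M U \<phi> f has_derivative deriv_at (in_chart M U \<phi> f) (\<phi> p)) (at (\<phi> p))"
  by (rule smooth_open_has_derivative[OF in_chart_smooth_funs[OF M chart] chart_in_vimage[OF M chart p p]])

lemma in_chart_at: "in_chart M U \<phi> f (\<phi> p) = f p"
  by (simp add: chart_proj[OF M chart p] chart_inv[OF M chart p])

lemma tvec_in_tangent_space: "tvec M U \<phi> p u \<in> tangent_space M p"
  unfolding tangent_space_def
proof (rule CollectI, intro conjI ballI allI impI)
  fix f g a b assume fg: "f \<in> smooth_funs M" "g \<in> smooth_funs M"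
  note d = in_chart_has_derivative[OF fg(1)] in_chart_has_derivative[OF fg(2)]
  have "((\<lambda>x. a * in_chart M U \<phi> f x + b * in_chart M U \<phi> g x) has_derivative
      (\<lambda>u. a * deriv_at (in_chart M U \<phi> f) (\<phi> p) u + b * deriv_at (in_chart M U \<phi> g) (\<phi> p) u)) (at (\<phi> p))"
    by (intro has_derivative_add has_derivative_mult_right d)
  from frechet_derivative_at[OF this]
  show "tvec M U \<phi> p u (\<lambda>x. a * f x + b * g x) = a * tvec M U \<phi> p u f + b * tvec M U \<phi> p u g"
    by (simp add: tvec_def fg smooth_funs_lincomb fun_eq_iff)
next
  fix f g assume fg: "f \<in> smooth_funs M" "g \<in> smooth_funs M"
  note d = in_chart_has_derivative[OF fg(1)] in_chart_has_derivative[OF fg(2)]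
  from has_derivative_mult[OF d]
  have "((\<lambda>x. in_chart M U \<phi> f x * in_chart M U \<phi> g x) has_derivative
      (\<lambda>u. f p * deriv_at (in_chart M U \<phi> g) (\<phi> p) u + deriv_at (in_chart M U \<phi> f) (\<phi> p) u * g p)) (at (\<phi> p))"
    by (simp only: in_chart_at)
  from frechet_derivative_at[OF this]
  show "tvec M U \<phi> p u (\<lambda>x. f x * g x) = f p * tvec M U \<phi> p u g + tvec M U \<phi> p u f * g p"
    by (simp add: tvec_def fg smooth_funs_mult fun_eq_iff)
qed (simp add: tvec_def)

lemma tvec_lincomb: "tvec M U \<phi> p (a *\<^sub>R u + b *\<^sub>R w) = (\<lambda>f. a * tvec M U \<phi> p u f + b * tvec M U \<phi> p w f)"
proof
  fix f
  show "tvec M U \<phi> p (a *\<^sub>R u + b *\<^sub>R w) f = a * tvec M U \<phi> p u f + b * tvec M U \<phi> p w f"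
  proof (cases "f \<in> smooth_funs M")
    case True
    have "linear (deriv_at (in_chart M U \<phi> f) (\<phi> p))"
      using in_chart_has_derivative[OF True] by (rule has_derivative_linear)
    then show ?thesis using True by (simp add: tvec_def linear_add linear_scale)
  qed (simp add: tvec_def)
qed

lemma tvec_proj: "tvec M U \<phi> p (proj_on (mfd_model M) u) = tvec M U \<phi> p u"
proof
  fix f
  let ?P = "proj_on (mfd_model M)"
  show "tvec M U \<phi> p (?P u) f = tvec M U \<phi> p u f"
  proof (cases "f \<in> smooth_funs M")
    case True
    have "deriv_at (in_chart M U \<phi> f) (\<phi> p) u = deriv_at (in_chart M U \<phi> f) (\<phi> p) (?P u)"
      by (rule deriv_germ[OF M chart p chart_openin[OF M chart] subset_refl _
          in_chart_smooth_funs[OF M chart True] chart_in_vimage[OF M chart p p]])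
        (simp add: chart_proj[OF M chart] chart_inv[OF M chart])
    then show ?thesis by (simp add: tvec_def)
  qed (simp add: tvec_def)
qed

lemma tvec_inject:
  assumes "u \<in> mfd_model M" "w \<in> mfd_model M" "tvec M U \<phi> p u = tvec M U \<phi> p w"
  shows "u = w"
proof (rule euclidean_eqI)
  fix b :: 'e
  have h: "smooth_open UNIV (\<lambda>x. x \<bullet> b)"
    by (intro smooth_open_bounded_linear bounded_linear_inner_left) simp
  obtain f W where f: "f \<in> smooth_funs M" "openin (mfd_top M) W" "p \<in> W" "W \<subseteq> U" "\<forall>q\<in>W. f q = \<phi> q \<bullet> b"
    using smooth_funs_germ[OF M chart p h] by auto
  have "tvec M U \<phi> p u f = u \<bullet> b" if "u \<in> mfd_model M" for u
  proof -
    have "deriv_at (\<lambda>x. x \<bullet> b) (\<phi> p) = (\<lambda>v. v \<bullet> b)"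
      by (rule frechet_derivative_at[symmetric], rule bounded_linear_imp_has_derivative, rule bounded_linear_inner_left)
    then show ?thesis
      using deriv_germ[OF M chart f(3,2,4) _ h, of f u] f(1,5)
        proj_on_ident[OF smooth_manifold_model[OF M] that] by (simp add: tvec_def)
  qed
  then show "u \<bullet> b = w \<bullet> b" using assms by metis
qed

end

lemma tangent_space_lin:
  "v \<in> tangent_space M p \<Longrightarrow> f \<in> smooth_funs M \<Longrightarrow> g \<in> smooth_funs M \<Longrightarrow>
    v (\<lambda>x. a * f x + b * g x) = a * v f + b * v g"
  unfolding tangent_space_def by blast

lemma tangent_space_Leibniz:
  "v \<in> tangent_space M p \<Longrightarrow> f \<in> smooth_funs M \<Longrightarrow> g \<in> smooth_funs M \<Longrightarrow>
    v (\<lambda>x. f x * g x) = f p * v g + v f * g p"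
  unfolding tangent_space_def by blast

lemma tangent_space_outside: "v \<in> tangent_space M p \<Longrightarrow> f \<notin> smooth_funs M \<Longrightarrow> v f = 0"
  unfolding tangent_space_def by blast

lemma tangent_space_zero: "v \<in> tangent_space M p \<Longrightarrow> v (\<lambda>x. 0) = 0"
  using tangent_space_lin[of v M p "\<lambda>x. 0" "\<lambda>x. 0" 0 0] by (simp add: smooth_funs_zero)

lemma tangent_space_sum:
  assumes "v \<in> tangent_space M p" "\<And>i. i \<in> I \<Longrightarrow> f i \<in> smooth_funs M"
  shows "v (\<lambda>x. \<Sum>i\<in>I. f i x) = (\<Sum>i\<in>I. v (f i))"
  using assms(2)
proof (induction I rule: infinite_finite_induct)
  case (insert j I)
  then show ?case
    using tangent_space_lin[OF assms(1), of "f j" "\<lambda>x. \<Sum>i\<in>I. f i x" 1 1] smooth_funs_sum[of I f M] by simp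
qed (simp_all add: tangent_space_zero[OF assms(1)])

lemma tangent_space_const:
  assumes M: "smooth_manifold M" and v: "v \<in> tangent_space M p" and p: "p \<in> pts M"
  shows "v (\<lambda>x. if x \<in> pts M then c else 0) = 0"
proof -
  let ?c = "\<lambda>x. if x \<in> pts M then c else 0" and ?one = "\<lambda>x. if x \<in> pts M then 1 else (0::real)"
  note s = smooth_funs_const[OF M]
  have "(\<lambda>x. ?one x * ?one x) = ?one" by auto
  then have "v ?one = 0" using tangent_space_Leibniz[OF v s[of 1] s[of 1]] p by simp
  moreover have "(\<lambda>x. c * ?one x + 0 * ?one x) = ?c" by auto
  ultimately show ?thesis using tangent_space_lin[OF v s[of 1] s[of 1], of c 0] by simp
qed

text \<open>For a smooth \<open>b\<close> with \<open>b p = 1\<close> that vanishes off \<open>W\<close>, the product \<open>b (f - g)\<close> is 0; apply the Leibniz rule.\<close>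

lemma tangent_space_local:
  assumes M: "smooth_manifold M" and v: "v \<in> tangent_space M p"
    and W: "openin (mfd_top M) W" "p \<in> W" and fg: "f \<in> smooth_funs M" "g \<in> smooth_funs M"
    and eq: "\<And>q. q \<in> W \<Longrightarrow> f q = g q"
  shows "v f = v g"
proof -
  have "p \<in> pts M" using W openin_subset by blast
  then obtain U \<phi> where c: "(U, \<phi>) \<in> mfd_atlas M" "p \<in> U" using chart_exists[OF M] by blast
  obtain b T' where b: "b \<in> smooth_funs M" "open T'" "\<phi> p \<in> T'" 
    "\<And>x. x \<in> T' \<Longrightarrow> in_chart M U \<phi> b x = 1" "\<And>q. q \<notin> W \<Longrightarrow> b q = 0"
    using smooth_funs_extension[OF M c W smooth_open_const[OF open_UNIV, of 1] UNIV_I] by metis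
  have bp: "b p = 1" by (rule trans[OF in_chart_at[OF M c, of b, symmetric] b(4)[OF b(3)]])
  let ?d = "\<lambda>x. 1 * f x + (-1) * g x"
  have d: "?d \<in> smooth_funs M" by (rule smooth_funs_lincomb[OF fg])
  have "(\<lambda>x. b x * ?d x) = (\<lambda>x. 0)" using b(5) eq by fastforce
  then have "b p * v ?d + v b * ?d p = 0"
    using tangent_space_Leibniz[OF v b(1) d] tangent_space_zero[OF v] by simp
  then have "v ?d = 0" using bp eq[OF W(2)] by simp
  then show ?thesis using tangent_space_lin[OF v fg, of 1 "-1"] by simp
qed

text \<open>By Hadamard's lemma, \<open>f\<close> is near \<open>p\<close> a constant plus a sum of products of a coordinate function
  vanishing at \<open>p\<close> and a smooth function whose value at \<open>p\<close> is a partial derivative of \<open>f\<close>. So the values on the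
  coordinate functions determine a derivation.\<close>

lemma tangent_space_chart:
  fixes M :: "('a, 'e::euclidean_space) manifold"
  assumes M: "smooth_manifold M" and c: "(U, \<phi>) \<in> mfd_atlas M" and p: "p \<in> U"
  shows "tangent_space M p = tvec M U \<phi> p ` mfd_model M"
proof
  show "tvec M U \<phi> p ` mfd_model M \<subseteq> tangent_space M p" using tvec_in_tangent_space[OF M c p] by blast
  show "tangent_space M p \<subseteq> tvec M U \<phi> p ` mfd_model M"
  proof
    fix v assume v: "v \<in> tangent_space M p"
    let ?x0 = "\<phi> p" and ?V = "mfd_model M"
    note V = smooth_manifold_model[OF M]
    have "\<exists>X W. X \<in> smooth_funs M \<and> openin (mfd_top M) W \<and> p \<in> W \<and> W \<subseteq> U \<and> (\<forall>q\<in>W. X q = (\<phi> q - ?x0) \<bullet> b)" for b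
      by (rule smooth_funs_germ[OF M c p, of UNIV "\<lambda>x. (x - ?x0) \<bullet> b"])
        (auto intro!: smooth_open_inner smooth_open_diff)
    then obtain X W where X: "\<And>b. X b \<in> smooth_funs M" "\<And>b. openin (mfd_top M) (W b)" "\<And>b. p \<in> W b"
      "\<And>b. W b \<subseteq> U" "\<And>b q. q \<in> W b \<Longrightarrow> X b q = (\<phi> q - ?x0) \<bullet> b" by metis
    define u where "u = (\<Sum>b\<in>Basis. v (X b) *\<^sub>R b)"
    have "v f = tvec M U \<phi> p u f" for f
    proof (cases "f \<in> smooth_funs M")
      case f: True
      let ?F = "in_chart M U \<phi> f"
      note F = in_chart_smooth_funs[OF M c f]
      have mem: "?x0 \<in> chart_vimage M \<phi> U" by (rule chart_in_vimage[OF M c p p])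
      then obtain r where r: "r > 0" "ball ?x0 r \<subseteq> chart_vimage M \<phi> U"
        using smooth_open_imp_open[OF F] open_contains_ball by blast
      obtain g where g: "\<And>b. smooth_open (ball ?x0 r) (g b)"
        "\<And>x. x \<in> ball ?x0 r \<Longrightarrow> ?F x = ?F ?x0 + (\<Sum>b\<in>Basis. ((x - ?x0) \<bullet> b) * g b x)"
        "\<And>b. r > 0 \<Longrightarrow> g b ?x0 = deriv_at ?F ?x0 b"
        using Hadamard[OF smooth_open_subset[OF F open_ball r(2)]] by blast
      have "\<exists>G W. G \<in> smooth_funs M \<and> openin (mfd_top M) W \<and> p \<in> W \<and> W \<subseteq> U \<and> (\<forall>q\<in>W. G q = g b (\<phi> q))" for b
        by (rule smooth_funs_germ[OF M c p g(1)]) (simp add: r(1))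
      then obtain G W' where G: "\<And>b. G b \<in> smooth_funs M" "\<And>b. openin (mfd_top M) (W' b)" "\<And>b. p \<in> W' b"
        "\<And>b. W' b \<subseteq> U" "\<And>b q. q \<in> W' b \<Longrightarrow> G b q = g b (\<phi> q)" by metis
      let ?B = "{q \<in> U. \<phi> q \<in> ?V \<inter> ball ?x0 r}"
      let ?W = "?B \<inter> (\<Inter>b\<in>Basis. W b) \<inter> (\<Inter>b\<in>Basis. W' b)"
      have oB: "openin (mfd_top M) ?B" by (rule chart_open_preimage[OF M c]) (simp add: openin_open_Int)
      have oW: "openin (mfd_top M) ?W"
        by (intro openin_Int oB openin_INT2) (auto simp: X(2) G(2))
      have pW: "p \<in> ?W" using p X(3) G(3) r(1) chart_model[OF M c p] by simp
      let ?c = "\<lambda>x. if x \<in> pts M then f p else 0"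
      let ?S = "\<lambda>q. \<Sum>b\<in>Basis. X b q * G b q"
      have S: "(\<lambda>q. X b q * G b q) \<in> smooth_funs M" for b by (rule smooth_funs_mult[OF X(1) G(1)])
      have cS: "?c \<in> smooth_funs M" "?S \<in> smooth_funs M" by (rule smooth_funs_const[OF M], rule smooth_funs_sum[OF S])
      have "v f = v (\<lambda>q. 1 * ?c q + 1 * ?S q)"
      proof (rule tangent_space_local[OF M v oW pW f smooth_funs_lincomb[OF cS]])
        fix q assume q: "q \<in> ?W"
        then have qU: "q \<in> U" "q \<in> pts M" using chart_subset[OF M c] by auto
        have "f q = ?F (\<phi> q)" by (rule in_chart_at[OF M c qU(1), of f, symmetric])
        also have "\<dots> = ?F ?x0 + (\<Sum>b\<in>Basis. ((\<phi> q - ?x0) \<bullet> b) * g b (\<phi> q))"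
          by (rule g(2)) (use q in simp)
        also have "\<dots> = f p + ?S q"
        proof (rule arg_cong2[of _ _ _ _ "(+)", OF in_chart_at[OF M c p, of f]], rule sum.cong[OF refl])
          fix b :: 'e assume "b \<in> Basis"
          then have "q \<in> W b" "q \<in> W' b" using q by auto
          then show "((\<phi> q - ?x0) \<bullet> b) * g b (\<phi> q) = X b q * G b q" using X(5) G(5) by simp
        qed
        finally show "f q = 1 * ?c q + 1 * ?S q" using qU by simp
      qed
      also have "\<dots> = v ?S"
        using tangent_space_lin[OF v cS, of 1 1] tangent_space_const[OF M v] chart_subset[OF M c] p by auto
      also have "\<dots> = (\<Sum>b\<in>Basis. v (\<lambda>q. X b q * G b q))" by (rule tangent_space_sum[OF v S])
      also have "\<dots> = (\<Sum>b\<in>Basis. v (X b) *\<^sub>R deriv_at ?F ?x0 b)"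
        using tangent_space_Leibniz[OF v X(1) G(1)] X(5)[OF X(3)] G(5)[OF G(3)] g(3)[OF r(1)] by simp
      also have "\<dots> = deriv_at ?F ?x0 u"
      proof -
        have lin: "linear (deriv_at ?F ?x0)" using in_chart_has_derivative[OF M c p f] by (rule has_derivative_linear)
        show ?thesis unfolding u_def by (simp only: linear_sum[OF lin] linear_scale[OF lin])
      qed
      finally show ?thesis using f by (simp add: tvec_def)
    qed (simp add: tvec_def tangent_space_outside[OF v])
    then have "v = tvec M U \<phi> p (proj_on ?V u)" using tvec_proj[OF M c p] by auto
    then show "v \<in> tvec M U \<phi> p ` ?V" using proj_on_in[OF V] by blast
  qed
qed

lemma tangent_space_lincomb:
  assumes "smooth_manifold M" "p \<in> pts M" "v \<in> tangent_space M p" "w \<in> tangent_space M p"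
  shows "(\<lambda>f. a * v f + b * w f) \<in> tangent_space M p"
proof -
  obtain U \<phi> where c: "(U, \<phi>) \<in> mfd_atlas M" "p \<in> U" using chart_exists[OF assms(1,2)] by blast
  obtain x y where "v = tvec M U \<phi> p x" "w = tvec M U \<phi> p y"
    using assms(3,4) tangent_space_chart[OF assms(1) c] by blast
  then show ?thesis
    using tvec_in_tangent_space[OF assms(1) c, of "a *\<^sub>R x + b *\<^sub>R y"] tvec_lincomb[OF assms(1) c, of a x b y] by simp
qed

text \<open>In a chart a covector becomes a linear function on the model space, and that function of the
  coordinates has it as differential. Thus the value of the Nambu tensor on arbitrary covectors is given by
  brackets.\<close>

lemma cotangent_is_differential:
  fixes M :: "('a, 'e::euclidean_space) manifold"
  assumes M: "smooth_manifold M" and p: "p \<in> pts M" and \<beta>: "\<beta> \<in> cotangent_space M p"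
  obtains f where "f \<in> smooth_funs M" "differential M p f = \<beta>"
proof -
  obtain U \<phi> where c: "(U, \<phi>) \<in> mfd_atlas M" "p \<in> U" using chart_exists[OF M p] by blast
  let ?P = "proj_on (mfd_model M)"
  note V = smooth_manifold_model[OF M]
  define l where "l x = \<beta> (tvec M U \<phi> p x)" for x
  have comb: "l (a *\<^sub>R x + b *\<^sub>R y) = a * l x + b * l y" for a b x y
  proof -
    have "\<beta> (\<lambda>f. a * v f + b * w f) = a * \<beta> v + b * \<beta> w" if "v \<in> tangent_space M p" "w \<in> tangent_space M p" for v w
      using \<beta> that unfolding cotangent_space_def by blast
    from this[OF tvec_in_tangent_space[OF M c, of x] tvec_in_tangent_space[OF M c, of y]]
    show ?thesis by (simp add: l_def tvec_lincomb[OF M c])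
  qed
  have "linear l"
  proof (rule linearI)
    show "l (x + y) = l x + l y" for x y using comb[of 1 x 1 y] by simp
    show "l (a *\<^sub>R x) = a *\<^sub>R l x" for a x using comb[of a x 0 x] by simp
  qed
  then have bl: "bounded_linear l" by (simp add: linear_conv_bounded_linear)
  have h: "smooth_open UNIV l" by (rule smooth_open_bounded_linear[OF open_UNIV bl])
  obtain f W where f: "f \<in> smooth_funs M" "openin (mfd_top M) W" "p \<in> W" "W \<subseteq> U" "\<And>q. q \<in> W \<Longrightarrow> f q = l (\<phi> q)"
    using smooth_funs_germ[OF M c h UNIV_I] by blast
  have dl: "deriv_at l (\<phi> p) = l"
    by (rule frechet_derivative_at[symmetric], rule bounded_linear_imp_has_derivative[OF bl])
  have "differential M p f v = \<beta> v" for v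
  proof (cases "v \<in> tangent_space M p")
    case True
    then obtain u where u: "u \<in> mfd_model M" "v = tvec M U \<phi> p u" using tangent_space_chart[OF M c] by blast
    have "v f = deriv_at (in_chart M U \<phi> f) (\<phi> p) u" using f(1) u(2) by (simp add: tvec_def)
    also have "\<dots> = deriv_at l (\<phi> p) (?P u)" by (rule deriv_germ[OF M c(1) f(3,2,4,5) h UNIV_I])
    also have "\<dots> = \<beta> v" by (simp add: dl proj_on_ident[OF V u(1)]) (simp add: l_def u(2))
    finally show ?thesis using True by (simp add: differential_def)
  next
    case False
    then show ?thesis using \<beta> by (simp add: differential_def cotangent_space_def)
  qed
  then show ?thesis using that f(1) by blast
qed

section \<open>Smooth maps and push-forwards\<close>

text \<open>The chain rule for a function pulled back along a parametrised piece of a manifold.\<close>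

context
  fixes N :: "('a, 'k::euclidean_space) manifold" and W \<psi>
    and s :: "'e::euclidean_space \<Rightarrow> 'a" and T
  assumes N: "smooth_manifold N" and chart: "(W, \<psi>) \<in> mfd_atlas N"
    and sW: "\<And>x. x \<in> T \<Longrightarrow> s x \<in> W" and smooth: "smooth_open T (\<lambda>x. \<psi> (s x))"
begin

lemma pullback_param_eq: "x \<in> T \<Longrightarrow> in_chart N W \<psi> f (\<psi> (s x)) = f (s x)"
  using in_chart_at[OF N chart sW, of x f] by simp

lemma pullback_param_smooth:
  assumes f: "f \<in> smooth_funs N"
  shows "smooth_open T (\<lambda>x. f (s x))"
proof -
  have "smooth_open T (\<lambda>x. in_chart N W \<psi> f (\<psi> (s x)))"
  proof (rule smooth_open_compose[OF smooth in_chart_smooth_funs[OF N chart f]])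
    show "(\<lambda>x. \<psi> (s x)) ` T \<subseteq> chart_vimage N \<psi> W"
      using chart_in_vimage[OF N chart] sW by blast
  qed
  then show ?thesis by (rule smooth_open_cong) (rule pullback_param_eq)
qed

lemma pullback_param_deriv:
  assumes x: "x \<in> T"
  shows "(\<lambda>f. if f \<in> smooth_funs N then deriv_at (\<lambda>x. f (s x)) x u else 0) =
    tvec N W \<psi> (s x) (deriv_at (\<lambda>x. \<psi> (s x)) x u)"
proof
  fix f
  show "(if f \<in> smooth_funs N then deriv_at (\<lambda>x. f (s x)) x u else 0) =
    tvec N W \<psi> (s x) (deriv_at (\<lambda>x. \<psi> (s x)) x u) f"
  proof (cases "f \<in> smooth_funs N")
    case True
    note d = has_derivative_compose[OF smooth_open_has_derivative[OF smooth x]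
      in_chart_has_derivative[OF N chart sW[OF x] True]]
    have "deriv_at (\<lambda>x. f (s x)) x = deriv_at (\<lambda>x. in_chart N W \<psi> f (\<psi> (s x))) x"
      by (rule deriv_at_cong[OF d smooth_open_imp_open[OF smooth] x]) (rule pullback_param_eq)
    then show ?thesis using frechet_derivative_at[OF d] True by (simp add: tvec_def fun_eq_iff)
  qed (simp add: tvec_def)
qed

end

text \<open>The projection onto \<open>V\<close> fixes \<open>f\<close>, hence its derivative.\<close>

lemma deriv_at_in_subspace:
  fixes f :: "'a::real_normed_vector \<Rightarrow> 'b::euclidean_space"
  assumes V: "subspace V" and f: "smooth_open T f" and x: "x \<in> T"
    and fV: "\<And>y. y \<in> T \<Longrightarrow> f y \<in> V"
  shows "deriv_at f x u \<in> V"
proof -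
  note d = smooth_open_has_derivative[OF f x]
  have "bounded_linear (proj_on V)" using linear_proj_on[OF V] by (simp add: linear_conv_bounded_linear)
  from bounded_linear.has_derivative[OF this d]
  have d': "((\<lambda>y. proj_on V (f y)) has_derivative (\<lambda>u. proj_on V (deriv_at f x u))) (at x)" .
  have "deriv_at f x = deriv_at (\<lambda>y. proj_on V (f y)) x"
    by (rule deriv_at_cong[OF d' smooth_open_imp_open[OF f] x]) (simp add: proj_on_ident[OF V] fV)
  then have "deriv_at f x u = proj_on V (deriv_at f x u)"
    using fun_cong[OF frechet_derivative_at[OF d'], of u] by simp
  then show ?thesis by (rule ssubst[where P = "\<lambda>z. z \<in> V"]) (rule proj_on_in[OF V])
qed

lemma smooth_map_chart:
  fixes M :: "('a, 'e::euclidean_space) manifold" and N :: "('b, 'k::euclidean_space) manifold"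
  assumes M: "smooth_manifold M" and N: "smooth_manifold N" and F: "smooth_map M N F"
    and c: "(U, \<phi>) \<in> mfd_atlas M" and c': "(W, \<psi>) \<in> mfd_atlas N"
  shows "openin (mfd_top M) (U \<inter> F -` W)"
    and "smooth_open (chart_vimage M \<phi> (U \<inter> F -` W)) (in_chart M U \<phi> (\<lambda>q. \<psi> (F q)))"
proof -
  have "continuous_map (mfd_top M) (mfd_top N) F" using F by (simp add: smooth_map_def)
  from openin_continuous_map_preimage[OF this chart_openin[OF N c']]
  have "openin (mfd_top M) {x \<in> pts M. F x \<in> W}" .
  from openin_Int[OF chart_openin[OF M c] this]
  have *: "openin (mfd_top M) (U \<inter> {x \<in> pts M. F x \<in> W})" .
  show o: "openin (mfd_top M) (U \<inter> F -` W)"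
  proof -
    have "U \<inter> {x \<in> pts M. F x \<in> W} = U \<inter> F -` W" using chart_subset[OF M c] by auto
    with * show ?thesis by simp
  qed
  have "smooth_on (\<phi> ` (U \<inter> F -` W)) (\<psi> \<circ> F \<circ> inv_into U \<phi>)"
    using F c c' unfolding smooth_map_def by blast
  then have "smooth_on (\<phi> ` (U \<inter> F -` W)) (\<lambda>x. \<psi> (F (inv_into U \<phi> x)))" by (simp add: o_def)
  from smooth_on_imp_smooth_open[OF smooth_manifold_model[OF M] chart_open_image[OF M c o] this]
  show "smooth_open (chart_vimage M \<phi> (U \<inter> F -` W)) (in_chart M U \<phi> (\<lambda>q. \<psi> (F q)))" by simp
qed

context
  fixes M :: "('a, 'e::euclidean_space) manifold" and N :: "('b, 'k::euclidean_space) manifold" and F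
  assumes M: "smooth_manifold M" and N: "smooth_manifold N" and F: "smooth_map M N F"
begin

lemma smooth_map_pts: "p \<in> pts M \<Longrightarrow> F p \<in> pts N"
  using F continuous_map_image_subset_topspace[of "mfd_top M" "mfd_top N" F] by (auto simp: smooth_map_def)

lemma smooth_map_in_chart:
  assumes c: "(U, \<phi>) \<in> mfd_atlas M" and c': "(W, \<psi>) \<in> mfd_atlas N" and f: "f \<in> smooth_funs N"
  shows "smooth_open (chart_vimage M \<phi> (U \<inter> F -` W)) (in_chart M U \<phi> (\<lambda>q. f (F q)))"
proof (rule pullback_param_smooth[OF N c' _ smooth_map_chart(2)[OF M N F c c'] f])
  fix x assume "x \<in> chart_vimage M \<phi> (U \<inter> F -` W)"
  then have "proj_on (mfd_model M) x \<in> \<phi> ` (U \<inter> F -` W)" by simp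
  then obtain q where "q \<in> U" "F q \<in> W" "proj_on (mfd_model M) x = \<phi> q" by blast
  then show "F (inv_into U \<phi> (proj_on (mfd_model M) x)) \<in> W" by (simp add: chart_inv[OF M c])
qed

lemma pullback_smooth:
  assumes f: "f \<in> smooth_funs N"
  shows "pullback M F f \<in> smooth_funs M"
  unfolding smooth_funs_iff
proof (intro conjI allI impI smooth_fun_on_local[OF M])
  fix p assume p: "p \<in> pts M"
  obtain U \<phi> where c: "(U, \<phi>) \<in> mfd_atlas M" "p \<in> U" using chart_exists[OF M p] by blast
  obtain W \<psi> where c': "(W, \<psi>) \<in> mfd_atlas N" "F p \<in> W" using chart_exists[OF N smooth_map_pts[OF p]] by blast
  let ?T = "U \<inter> F -` W"
  have "smooth_on (\<phi> ` (?T \<inter> pts M)) (in_chart M U \<phi> (\<lambda>q. f (F q)))"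
    by (rule smooth_open_imp_smooth_on[OF smooth_map_in_chart[OF c(1) c'(1) f]])
      (use chart_proj[OF M c(1)] in force)
  then have "smooth_on (\<phi> ` (?T \<inter> pts M)) (\<lambda>x. pullback M F f (inv_into U \<phi> x))"
    by (rule smooth_on_cong) (auto simp: pullback_def chart_inv[OF M c(1)] chart_proj[OF M c(1)])
  then show "\<exists>U \<phi> T. (U, \<phi>) \<in> mfd_atlas M \<and> p \<in> T \<and> openin (mfd_top M) T \<and> T \<subseteq> U \<and>
      smooth_on (\<phi> ` (T \<inter> pts M)) (\<lambda>x. pullback M F f (inv_into U \<phi> x))"
    using c c' smooth_map_chart(1)[OF M N F c(1) c'(1)]
    by (intro exI[of _ U] exI[of _ \<phi>] exI[of _ ?T]) auto
qed (simp add: pullback_def)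

lemma pushforward_tvec_eq:
  assumes c: "(U, \<phi>) \<in> mfd_atlas M" and q: "q \<in> U"
  shows "pushforward M N F (tvec M U \<phi> q u) =
    (\<lambda>f. if f \<in> smooth_funs N then deriv_at (in_chart M U \<phi> (\<lambda>q. f (F q))) (\<phi> q) u else 0)"
proof
  fix f
  show "pushforward M N F (tvec M U \<phi> q u) f =
    (if f \<in> smooth_funs N then deriv_at (in_chart M U \<phi> (\<lambda>q. f (F q))) (\<phi> q) u else 0)"
  proof (cases "f \<in> smooth_funs N")
    case True
    note s = pullback_smooth[OF True]
    note o = smooth_open_imp_open[OF in_chart_smooth_funs[OF M c s]]
    have "deriv_at (in_chart M U \<phi> (\<lambda>q. f (F q))) (\<phi> q) = deriv_at (in_chart M U \<phi> (pullback M F f)) (\<phi> q)"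
    proof (rule deriv_at_cong[OF in_chart_has_derivative[OF M c q s] o chart_in_vimage[OF M c q q]])
      fix y assume "y \<in> chart_vimage M \<phi> U"
      then obtain q' where "q' \<in> U" "proj_on (mfd_model M) y = \<phi> q'" by auto
      then show "in_chart M U \<phi> (pullback M F f) y = in_chart M U \<phi> (\<lambda>q. f (F q)) y"
        using chart_subset[OF M c] by (auto simp: pullback_def chart_inv[OF M c])
    qed
    then show ?thesis using True s by (simp add: pushforward_def tvec_def)
  qed (simp add: pushforward_def)
qed

lemma pushforward_tvec:
  assumes c: "(U, \<phi>) \<in> mfd_atlas M" and c': "(W, \<psi>) \<in> mfd_atlas N" and q: "q \<in> U" "F q \<in> W"
  shows "pushforward M N F (tvec M U \<phi> q u) =
    tvec N W \<psi> (F q) (deriv_at (in_chart M U \<phi> (\<lambda>q. \<psi> (F q))) (\<phi> q) u)"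
proof -
  let ?T = "chart_vimage M \<phi> (U \<inter> F -` W)"
  have sW: "F (inv_into U \<phi> (proj_on (mfd_model M) x)) \<in> W" if "x \<in> ?T" for x
  proof -
    have "proj_on (mfd_model M) x \<in> \<phi> ` (U \<inter> F -` W)" using that by simp
    then obtain q where "q \<in> U" "F q \<in> W" "proj_on (mfd_model M) x = \<phi> q" by blast
    then show ?thesis by (simp add: chart_inv[OF M c])
  qed
  have mem: "\<phi> q \<in> ?T" using chart_in_vimage[OF M c q(1)] q by blast
  show ?thesis
    using pullback_param_deriv[OF N c' sW smooth_map_chart(2)[OF M N F c c'] mem, of u]
      pushforward_tvec_eq[OF c q(1), of u] chart_proj[OF M c q(1)] chart_inv[OF M c q(1)] by simp
qed

lemma pushforward_in_tangent_space:
  assumes "p \<in> pts M" "v \<in> tangent_space M p"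
  shows "pushforward M N F v \<in> tangent_space N (F p)"
proof -
  obtain U \<phi> where c: "(U, \<phi>) \<in> mfd_atlas M" "p \<in> U" using chart_exists[OF M assms(1)] by blast
  obtain W \<psi> where c': "(W, \<psi>) \<in> mfd_atlas N" "F p \<in> W" using chart_exists[OF N smooth_map_pts[OF assms(1)]] by blast
  obtain u where "v = tvec M U \<phi> p u" using assms(2) tangent_space_chart[OF M c] by blast
  then show ?thesis using pushforward_tvec[OF c(1) c'(1) c(2) c'(2)] tvec_in_tangent_space[OF N c'] by simp
qed

end

section \<open>Plaques\<close>

text \<open>The image in \<open>N\<close> of the coordinate vector \<open>u\<close> of the plaque chart, as a derivation.\<close>

definition pvec ::
  "('a, 'k::euclidean_space) manifold \<Rightarrow> 'k set \<Rightarrow> 'a set \<Rightarrow> ('a \<Rightarrow> 'k) \<Rightarrow> 'a \<Rightarrow> 'k \<Rightarrow> 'a tangent" where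
  "pvec N V U \<phi> q u = (\<lambda>f. if f \<in> smooth_funs N
     then deriv_at (\<lambda>x. f (inv_into U \<phi> (proj_on V x))) (\<phi> q) u else 0)"

text \<open>A plaque chart of a distribution \<open>F\<close> on \<open>N\<close> is a chart, with values in the model space \<open>V\<close>,
  of a piece of an integral manifold of \<open>F\<close>. It is described without reference to a manifold
  structure on that piece, which is what allows to glue overlapping pieces.\<close>

definition plaque ::
  "('a, 'k::euclidean_space) manifold \<Rightarrow> ('a \<Rightarrow> 'a tangent set) \<Rightarrow> 'k set \<Rightarrow> 'a set \<Rightarrow> ('a \<Rightarrow> 'k) \<Rightarrow> bool" where
  "plaque N F V U \<phi> \<longleftrightarrow> subspace V \<and> U \<subseteq> pts N \<and> inj_on \<phi> U \<and>
     (\<forall>G. openin (mfd_top N) G \<longrightarrow> openin (top_of_set V) (\<phi> ` (U \<inter> G))) \<and>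
     (\<forall>(W, \<psi>) \<in> mfd_atlas N. smooth_on (\<phi> ` (U \<inter> W)) (\<lambda>x. \<psi> (inv_into U \<phi> x))) \<and>
     (\<forall>q\<in>U. pvec N V U \<phi> q ` V = F q \<and> inj_on (pvec N V U \<phi> q) V)"

lemma
  assumes "plaque N F V U \<phi>"
  shows plaque_subspace: "subspace V" and plaque_subset: "U \<subseteq> pts N" and plaque_inj: "inj_on \<phi> U"
    and plaque_open: "\<And>G. openin (mfd_top N) G \<Longrightarrow> openin (top_of_set V) (\<phi> ` (U \<inter> G))"
    and plaque_smooth_on: "\<And>W \<psi>. (W, \<psi>) \<in> mfd_atlas N \<Longrightarrow> smooth_on (\<phi> ` (U \<inter> W)) (\<lambda>x. \<psi> (inv_into U \<phi> x))"
    and plaque_image: "\<And>q. q \<in> U \<Longrightarrow> pvec N V U \<phi> q ` V = F q"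
    and plaque_inj_pvec: "\<And>q. q \<in> U \<Longrightarrow> inj_on (pvec N V U \<phi> q) V"
proof -
  note * = assms[unfolded plaque_def]
  show "subspace V" "U \<subseteq> pts N" "inj_on \<phi> U" using * by simp_all
  show "\<And>G. openin (mfd_top N) G \<Longrightarrow> openin (top_of_set V) (\<phi> ` (U \<inter> G))" using * by blast
  show "smooth_on (\<phi> ` (U \<inter> W)) (\<lambda>x. \<psi> (inv_into U \<phi> x))" if "(W, \<psi>) \<in> mfd_atlas N" for W \<psi>
  proof -
    have "\<forall>(W, \<psi>) \<in> mfd_atlas N. smooth_on (\<phi> ` (U \<inter> W)) (\<lambda>x. \<psi> (inv_into U \<phi> x))" using * by (elim conjE)
    from bspec[OF this that] show ?thesis by simp
  qed
  show "\<And>q. q \<in> U \<Longrightarrow> pvec N V U \<phi> q ` V = F q" "\<And>q. q \<in> U \<Longrightarrow> inj_on (pvec N V U \<phi> q) V" using * by simp_all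
qed

context
  fixes N :: "('a, 'k::euclidean_space) manifold" and F V U \<phi>
  assumes N: "smooth_manifold N" and pl: "plaque N F V U \<phi>"
begin

lemma plaque_inv: "q \<in> U \<Longrightarrow> inv_into U \<phi> (\<phi> q) = q"
  by (rule inv_into_f_f[OF plaque_inj[OF pl]])

lemma plaque_open_image: "openin (top_of_set V) (\<phi> ` U)"
  using plaque_open[OF pl openin_topspace] plaque_subset[OF pl] by (simp add: Int_absorb2)

lemma plaque_model: "q \<in> U \<Longrightarrow> \<phi> q \<in> V"
  using openin_subset[OF plaque_open_image] by auto

lemma plaque_proj: "q \<in> U \<Longrightarrow> proj_on V (\<phi> q) = \<phi> q"
  by (rule proj_on_ident[OF plaque_subspace[OF pl] plaque_model])

lemma plaque_in_chart:
  assumes c: "(W, \<psi>) \<in> mfd_atlas N"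
  shows "smooth_open (proj_on V -` (\<phi> ` (U \<inter> W))) (\<lambda>x. \<psi> (inv_into U \<phi> (proj_on V x)))"
    and "x \<in> proj_on V -` (\<phi> ` (U \<inter> W)) \<Longrightarrow> inv_into U \<phi> (proj_on V x) \<in> U \<inter> W"
proof -
  show "smooth_open (proj_on V -` (\<phi> ` (U \<inter> W))) (\<lambda>x. \<psi> (inv_into U \<phi> (proj_on V x)))"
    by (rule smooth_on_imp_smooth_open[OF plaque_subspace[OF pl] plaque_open[OF pl chart_openin[OF N c]]
      plaque_smooth_on[OF pl c]])
  show "inv_into U \<phi> (proj_on V x) \<in> U \<inter> W" if "x \<in> proj_on V -` (\<phi> ` (U \<inter> W))"
    using that by (auto simp: plaque_inv)
qed

lemma pvec_eq_tvec:
  assumes c: "(W, \<psi>) \<in> mfd_atlas N" and q: "q \<in> U" "q \<in> W"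
  shows "pvec N V U \<phi> q u = tvec N W \<psi> q (deriv_at (\<lambda>x. \<psi> (inv_into U \<phi> (proj_on V x))) (\<phi> q) u)"
proof -
  let ?T = "proj_on V -` (\<phi> ` (U \<inter> W))"
  have sW: "inv_into U \<phi> (proj_on V x) \<in> W" if "x \<in> ?T" for x using plaque_in_chart(2)[OF c that] by blast
  have mem: "\<phi> q \<in> ?T" using q plaque_proj[OF q(1)] by auto
  show ?thesis
    using pullback_param_deriv[OF N c sW plaque_in_chart(1)[OF c] mem, of u] 
    unfolding pvec_def by (simp add: plaque_proj[OF q(1)] plaque_inv[OF q(1)])
qed

lemma plaque_fun_smooth:
  assumes f: "f \<in> smooth_funs N"
  shows "smooth_open (proj_on V -` (\<phi> ` U)) (\<lambda>x. f (inv_into U \<phi> (proj_on V x)))"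
proof (rule smooth_open_local)
  show "open (proj_on V -` (\<phi> ` U))" by (rule open_vimage_proj_on[OF plaque_subspace[OF pl] plaque_open_image])
  fix x assume "x \<in> proj_on V -` (\<phi> ` U)"
  then obtain q where q: "q \<in> U" "proj_on V x = \<phi> q" by auto
  obtain W \<psi> where c: "(W, \<psi>) \<in> mfd_atlas N" "q \<in> W" using chart_exists[OF N] plaque_subset[OF pl] q(1) by blast
  let ?T = "proj_on V -` (\<phi> ` (U \<inter> W))"
  have sW: "inv_into U \<phi> (proj_on V x) \<in> W" if "x \<in> ?T" for x using plaque_in_chart(2)[OF c(1) that] by blast
  have "smooth_open ?T (\<lambda>x. f (inv_into U \<phi> (proj_on V x)))"
    by (rule pullback_param_smooth[OF N c(1) sW plaque_in_chart(1)[OF c(1)] f])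
  moreover have "x \<in> ?T" using q c(2) by auto
  ultimately show "\<exists>T. x \<in> T \<and> smooth_open T (\<lambda>x. f (inv_into U \<phi> (proj_on V x)))" by (intro exI[of _ ?T] conjI)
qed

lemma pvec_proj:
  assumes q: "q \<in> U"
  shows "pvec N V U \<phi> q (proj_on V u) = pvec N V U \<phi> q u"
proof
  fix f
  note V = plaque_subspace[OF pl]
  let ?P = "proj_on V"
  show "pvec N V U \<phi> q (?P u) f = pvec N V U \<phi> q u f"
  proof (cases "f \<in> smooth_funs N")
    case True
    let ?h = "\<lambda>x. f (inv_into U \<phi> (?P x))"
    have mem: "\<phi> q \<in> ?P -` (\<phi> ` U)" using q plaque_proj by auto
    note d = smooth_open_has_derivative[OF plaque_fun_smooth[OF True] mem]
    have dP: "(?P has_derivative ?P) (at (\<phi> q))"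
      using linear_proj_on[OF V] by (auto intro!: bounded_linear_imp_has_derivative simp: linear_conv_bounded_linear)
    have "(?h has_derivative deriv_at ?h (\<phi> q)) (at (?P (\<phi> q)))" using d plaque_proj[OF q] by simp
    from has_derivative_compose[OF dP this]
    have "(?h has_derivative (\<lambda>u. deriv_at ?h (\<phi> q) (?P u))) (at (\<phi> q))"
      by (simp add: proj_on_ident[OF V proj_on_in[OF V]])
    from has_derivative_unique[OF d this] show ?thesis by (simp add: pvec_def True fun_eq_iff)
  qed (simp add: pvec_def)
qed

end

text \<open>For a chart of an integral manifold, \<open>pvec\<close> is the push-forward of \<open>tvec\<close> along the inclusion.\<close>

lemma integral_manifold_plaque:
  fixes N :: "('a, 'k::euclidean_space) manifold"
  assumes N: "smooth_manifold N" and S: "integral_manifold N F S" and c: "(U, \<phi>) \<in> mfd_atlas S"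
  shows "plaque N F (mfd_model S) U \<phi>"
proof -
  have SM: "smooth_manifold S" and sub: "pts S \<subseteq> pts N" and imm: "smooth_map S N id"
    "\<And>p. p \<in> pts S \<Longrightarrow> inj_on (pushforward S N id) (tangent_space S p)"
    and img: "\<And>q. q \<in> pts S \<Longrightarrow> pushforward S N id ` tangent_space S q = F q"
    using S by (auto simp: integral_manifold_def submanifold_def immersion_def)
  have push: "pushforward S N id (tvec S U \<phi> q u) = pvec N (mfd_model S) U \<phi> q u" if "q \<in> U" for q u
    using pushforward_tvec_eq[OF SM N imm(1) c that, of u] unfolding pvec_def id_apply .
  show ?thesis unfolding plaque_def
  proof (intro conjI allI impI ballI)
    show "subspace (mfd_model S)" by (rule smooth_manifold_model[OF SM])
    show "U \<subseteq> pts N" using chart_subset[OF SM c] sub by blast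
    show "inj_on \<phi> U" by (rule chart_inj[OF SM c])
    fix G assume G: "openin (mfd_top N) G"
    have "continuous_map (mfd_top S) (mfd_top N) id" using imm(1) by (simp add: smooth_map_def)
    from openin_continuous_map_preimage[OF this G] have "openin (mfd_top S) {x \<in> pts S. x \<in> G}" by simp
    from openin_Int[OF chart_openin[OF SM c] this]
    have "openin (mfd_top S) (U \<inter> {x \<in> pts S. x \<in> G})" .
    moreover have "U \<inter> {x \<in> pts S. x \<in> G} = U \<inter> G" using chart_subset[OF SM c] by auto
    ultimately have "openin (mfd_top S) (U \<inter> G)" by simp
    then show "openin (top_of_set (mfd_model S)) (\<phi> ` (U \<inter> G))" by (rule chart_open_image[OF SM c]) simp
  next
    fix x assume "x \<in> mfd_atlas N"
    then obtain W \<psi> where x: "x = (W, \<psi>)" "(W, \<psi>) \<in> mfd_atlas N" by (cases x) auto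
    have "smooth_on (\<phi> ` (U \<inter> id -` W)) (\<psi> \<circ> id \<circ> inv_into U \<phi>)"
      using imm(1) c x(2) unfolding smooth_map_def by blast
    then show "case x of (W, \<psi>) \<Rightarrow> smooth_on (\<phi> ` (U \<inter> W)) (\<lambda>x. \<psi> (inv_into U \<phi> x))"
      using x by (simp add: o_def)
  next
    fix q assume q: "q \<in> U"
    then have qS: "q \<in> pts S" using chart_subset[OF SM c] by blast
    show "pvec N (mfd_model S) U \<phi> q ` mfd_model S = F q"
      using img[OF qS] push[OF q] by (simp add: tangent_space_chart[OF SM c q] image_image)
    show "inj_on (pvec N (mfd_model S) U \<phi> q) (mfd_model S)"
    proof (rule inj_onI)
      fix u w assume uw: "u \<in> mfd_model S" "w \<in> mfd_model S" "pvec N (mfd_model S) U \<phi> q u = pvec N (mfd_model S) U \<phi> q w"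
      then have "tvec S U \<phi> q u = tvec S U \<phi> q w"
        using inj_onD[OF imm(2)[OF qS]] push[OF q] tvec_in_tangent_space[OF SM c q] by metis
      then show "u = w" using tvec_inject[OF SM c q] uw by blast
    qed
  qed
qed

section \<open>Uniqueness of plaques\<close>

lemma smooth_deriv_bound:
  fixes f :: "'a::euclidean_space \<Rightarrow> 'b::real_normed_vector"
  assumes f: "smooth_open T f" and x0: "x0 \<in> T"
  shows "\<exists>e C. e > 0 \<and> C \<ge> 0 \<and> ball x0 e \<subseteq> T \<and> (\<forall>x\<in>ball x0 e. \<forall>u. norm (deriv_at f x u) \<le> C * norm u)"
proof -
  note T = smooth_open_imp_open[OF f]
  have "eventually (\<lambda>x. norm (deriv_at f x b) < norm (deriv_at f x0 b) + 1) (nhds x0)" for b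
  proof -
    have "isCont (\<lambda>x. norm (deriv_at f x b)) x0"
      using smooth_open_cont[OF smooth_open_deriv[OF f, of b]] x0 T
      by (intro continuous_intros) (simp add: continuous_on_eq_continuous_at)
    then have "((\<lambda>x. norm (deriv_at f x b)) \<longlongrightarrow> norm (deriv_at f x0 b)) (nhds x0)"
      by (simp add: isCont_def tendsto_nhds_iff)
    then show ?thesis by (rule order_tendstoD) simp
  qed
  then have "eventually (\<lambda>x. \<forall>b\<in>Basis. norm (deriv_at f x b) < norm (deriv_at f x0 b) + 1) (nhds x0)"
    by (intro eventually_ball_finite) auto
  moreover have "eventually (\<lambda>x. x \<in> T) (nhds x0)" using T x0 by (rule eventually_nhds_in_open)
  ultimately have "eventually (\<lambda>x. x \<in> T \<and> (\<forall>b\<in>Basis. norm (deriv_at f x b) < norm (deriv_at f x0 b) + 1)) (nhds x0)"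
    by (intro eventually_conj)
  then obtain e where e: "e > 0"
    "\<And>x. dist x x0 < e \<Longrightarrow> x \<in> T \<and> (\<forall>b\<in>Basis. norm (deriv_at f x b) < norm (deriv_at f x0 b) + 1)"
    by (auto simp: eventually_nhds_metric)
  define C where "C = (\<Sum>b\<in>Basis. norm (deriv_at f x0 b) + 1)"
  have "norm (deriv_at f x u) \<le> C * norm u" if "x \<in> ball x0 e" for x u
  proof -
    have x: "x \<in> T" "\<And>b. b \<in> Basis \<Longrightarrow> norm (deriv_at f x b) < norm (deriv_at f x0 b) + 1"
      using e(2)[of x] that by (auto simp: dist_commute)
    have lin: "linear (deriv_at f x)" using smooth_open_has_derivative[OF f x(1)] by (rule has_derivative_linear)
    have "norm (deriv_at f x u) = norm (\<Sum>b\<in>Basis. (u \<bullet> b) *\<^sub>R deriv_at f x b)"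
      by (simp only: linear_Basis_expansion[OF lin])
    also have "\<dots> \<le> (\<Sum>b\<in>Basis. norm ((u \<bullet> b) *\<^sub>R deriv_at f x b))" by (rule norm_sum)
    also have "\<dots> \<le> (\<Sum>b\<in>Basis. norm u * (norm (deriv_at f x0 b) + 1))"
      unfolding norm_scaleR
      by (intro sum_mono mult_mono) (use x(2) in \<open>auto intro: Basis_le_norm less_imp_le\<close>)
    finally show ?thesis by (simp add: C_def sum_distrib_left mult.commute)
  qed
  moreover have "ball x0 e \<subseteq> T" using e(2) by (auto simp: dist_commute)
  moreover have "C \<ge> 0" by (simp add: C_def sum_nonneg)
  ultimately show ?thesis using e(1) by blast
qed

lemma smooth_Lipschitz:
  fixes f :: "'a::euclidean_space \<Rightarrow> 'b::real_normed_vector"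
  assumes f: "smooth_open T f" and x0: "x0 \<in> T"
  shows "\<exists>e C. e > 0 \<and> C \<ge> 0 \<and> (\<forall>x\<in>ball x0 e. \<forall>y\<in>ball x0 e. norm (f x - f y) \<le> C * norm (x - y))"
proof -
  obtain e C where e: "e > 0" "C \<ge> 0" "ball x0 e \<subseteq> T" "\<forall>x\<in>ball x0 e. \<forall>u. norm (deriv_at f x u) \<le> C * norm u"
    using smooth_deriv_bound[OF assms] by blast
  have "norm (f x - f y) \<le> C * norm (x - y)" if "x \<in> ball x0 e" "y \<in> ball x0 e" for x y
  proof (rule differentiable_bound[OF convex_ball _ _ that])
    fix z assume z: "z \<in> ball x0 e"
    then show "(f has_derivative deriv_at f z) (at z within ball x0 e)"
      using smooth_open_has_derivative[OF f] e(3) has_derivative_at_withinI by blast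
    show "onorm (deriv_at f z) \<le> C" using e(2,4) z by (intro onorm_bound) auto
  qed
  then show ?thesis using e by blast
qed

text \<open>The derivative of \<open>exp (- 2 C t) |d t|\<^sup>2\<close> is nonpositive, so this function stays 0.\<close>

lemma Gronwall_zero:
  fixes d :: "real \<Rightarrow> 'a::real_inner"
  assumes der: "\<And>t. 0 \<le> t \<Longrightarrow> t \<le> 1 \<Longrightarrow> (d has_vector_derivative d' t) (at t)"
    and bound: "\<And>t. 0 \<le> t \<Longrightarrow> t \<le> 1 \<Longrightarrow> norm (d' t) \<le> C * norm (d t)" and "d 0 = 0"
  shows "d 1 = 0"
proof -
  let ?g = "\<lambda>t. (d t \<bullet> d t) * exp (- 2 * C * t)"
  have "?g 1 \<le> ?g 0"
  proof (rule DERIV_nonpos_imp_nonincreasing[where f = ?g])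
    fix t :: real assume t: "0 \<le> t" "t \<le> 1"
    have "(d has_derivative (\<lambda>h. h *\<^sub>R d' t)) (at t)" using der[OF t] by (simp add: has_vector_derivative_def)
    from has_derivative_inner[OF this this]
    have "((\<lambda>t. d t \<bullet> d t) has_derivative (\<lambda>h. h * (2 * (d t \<bullet> d' t)))) (at t)"
      by (simp add: inner_commute algebra_simps)
    then have 1: "((\<lambda>t. d t \<bullet> d t) has_real_derivative 2 * (d t \<bullet> d' t)) (at t)"
      unfolding has_field_derivative_def by (rule has_derivative_eq_rhs) (simp add: fun_eq_iff)
    have 2: "((\<lambda>t. exp (- 2 * C * t)) has_real_derivative exp (- 2 * C * t) * (- 2 * C)) (at t)"
      by (auto intro!: derivative_eq_intros)
    have "d t \<bullet> d' t \<le> norm (d t) * norm (d' t)" by (rule norm_cauchy_schwarz)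
    also have "\<dots> \<le> norm (d t) * (C * norm (d t))" by (intro mult_left_mono bound t) simp
    finally have "d t \<bullet> d' t \<le> C * (d t \<bullet> d t)" by (simp add: dot_square_norm power2_eq_square algebra_simps)
    then have "2 * (d t \<bullet> d' t) * exp (- 2 * C * t) \<le> 2 * (C * (d t \<bullet> d t)) * exp (- 2 * C * t)"
      by (intro mult_right_mono) auto
    then have "2 * (d t \<bullet> d' t) * exp (- 2 * C * t) + exp (- 2 * C * t) * (- 2 * C) * (d t \<bullet> d t) \<le> 0"
      by (simp add: algebra_simps)
    with DERIV_mult[OF 1 2] show "\<exists>y. (?g has_real_derivative y) (at t) \<and> y \<le> 0"
      by (intro exI conjI)
  qed simp
  then have "d 1 \<bullet> d 1 \<le> 0" using assms(3) by (simp add: mult_le_0_iff)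
  then have "d 1 \<bullet> d 1 = 0" using inner_ge_zero[of "d 1"] by linarith
  then show ?thesis by (simp only: inner_eq_zero_iff)
qed

text \<open>Two vectors in the spans of a smooth frame at nearby points, with the same projection to the span at a
  reference point, differ by at most a constant times the distance of the points: near the reference
  point the span is the graph of a Lipschitz family of linear maps.\<close>

lemma frame_Lipschitz:
  fixes Y :: "nat \<Rightarrow> 'a::euclidean_space \<Rightarrow> 'a"
  assumes Y: "\<And>j. j < r \<Longrightarrow> smooth_open T (Y j)" and y0: "y0 \<in> T"
    and indep: "\<And>c. (\<Sum>j<r. c j *\<^sub>R Y j y0) = 0 \<Longrightarrow> \<forall>j<r. c j = 0"
    and L: "linear L" "\<And>j. j < r \<Longrightarrow> L (Y j y0) = Y j y0"
  shows "\<exists>e K. e > 0 \<and> K \<ge> 0 \<and> (\<forall>y\<in>ball y0 e. \<forall>y'\<in>ball y0 e. \<forall>c c'.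
    L (\<Sum>j<r. c j *\<^sub>R Y j y) = L (\<Sum>j<r. c' j *\<^sub>R Y j y') \<longrightarrow>
    norm ((\<Sum>j<r. c j *\<^sub>R Y j y) - (\<Sum>j<r. c' j *\<^sub>R Y j y')) \<le>
      K * norm (y - y') * norm (L (\<Sum>j<r. c' j *\<^sub>R Y j y')))"
proof -
  define B where "B = (\<lambda>j. Y j y0) ` {..<r}"
  have inj: "inj_on (\<lambda>j. Y j y0) {..<r}"
  proof (rule inj_onI, rule ccontr)
    fix i j assume ij: "i \<in> {..<r}" "j \<in> {..<r}" "Y i y0 = Y j y0" "i \<noteq> j"
    define c :: "nat \<Rightarrow> real" where "c k = (if k = i then 1 else 0) + (if k = j then -1 else 0)" for k
    have "(\<Sum>k<r. c k *\<^sub>R Y k y0) = (\<Sum>k<r. (if k = i then Y k y0 else 0) + (if k = j then - Y k y0 else 0))"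
      by (rule sum.cong) (auto simp: c_def ij(4))
    also have "\<dots> = Y i y0 - Y j y0" using ij(1,2) by (simp add: sum.distrib)
    finally have "\<forall>k<r. c k = 0" using indep[of c] ij(3) by simp
    then show False using ij by (auto simp: c_def)
  qed
  have "independent B"
  proof (rule independent_if_scalars_zero)
    show "finite B" by (simp add: B_def)
    fix f x assume f: "(\<Sum>x\<in>B. f x *\<^sub>R x) = 0" and x: "x \<in> B"
    have "(\<Sum>j<r. f (Y j y0) *\<^sub>R Y j y0) = 0" using f by (simp add: B_def sum.reindex[OF inj])
    then show "f x = 0" using indep[of "\<lambda>j. f (Y j y0)"] x by (auto simp: B_def)
  qed
  have "\<exists>g. linear g \<and> (\<forall>i<r. g (Y i y0) = (if i = j then 1 else 0 :: real))" if "j < r" for j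
  proof -
    obtain g where g: "linear g" "\<forall>x\<in>B. g x = (if x = Y j y0 then 1 else 0 :: real)"
      using linear_independent_extend[OF \<open>independent B\<close>, of "\<lambda>x. if x = Y j y0 then 1 else 0 :: real"] by blast
    have "g (Y i y0) = (if i = j then 1 else 0)" if "i < r" for i
      using g(2) that \<open>j < r\<close> inj_onD[OF inj] by (force simp: B_def)
    then show ?thesis using g(1) by blast
  qed
  then obtain d where d: "\<And>j. j < r \<Longrightarrow> linear (d j)"
    "\<And>i j. j < r \<Longrightarrow> i < r \<Longrightarrow> d j (Y i y0) = (if i = j then 1 else 0 :: real)"
    by metis
  obtain D1 where D1: "D1 > 0" "\<And>x. norm (L x) \<le> D1 * norm x"
    using linear_bounded_pos[OF L(1)] by blast
  have "\<exists>D. D > 0 \<and> (\<forall>j<r. \<forall>x. \<bar>d j x\<bar> \<le> D * norm x)"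
  proof -
    have "\<exists>D. \<forall>x. \<bar>d j x\<bar> \<le> D * norm x" if "j < r" for j
      using linear_bounded_pos[OF d(1)[OF that]] by (metis real_norm_def)
    then obtain D where D: "\<And>j x. j < r \<Longrightarrow> \<bar>d j x\<bar> \<le> D j * norm x" by metis
    have "\<bar>d j x\<bar> \<le> (1 + (\<Sum>j<r. \<bar>D j\<bar>)) * norm x" if "j < r" for j x
    proof -
      have "D j \<le> \<bar>D j\<bar>" by simp
      also have "\<dots> \<le> (\<Sum>j<r. \<bar>D j\<bar>)" using that by (intro member_le_sum) auto
      finally have "D j * norm x \<le> (1 + (\<Sum>j<r. \<bar>D j\<bar>)) * norm x" by (intro mult_right_mono) auto
      then show ?thesis using D[OF that, of x] by linarith
    qed
    moreover have "1 + (\<Sum>j<r. \<bar>D j\<bar>) > 0" by (intro add_pos_nonneg sum_nonneg) auto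
    ultimately show ?thesis by blast
  qed
  then obtain D where D: "D > 0" "\<And>j x. j < r \<Longrightarrow> \<bar>d j x\<bar> \<le> D * norm x" by blast
  \<comment> \<open>Entries this close to those of the identity matrix keep the matrix of the coordinates \<open>d\<close> of the projected frame within 1/2 of the identity in the sum norm.\<close>
  define eta where "eta = 1 / (2 * (real r + 1))"
  have eta: "eta > 0" "real r * eta \<le> 1/2" by (auto simp: eta_def field_simps)
  have contY: "isCont (Y i) y0" if "i < r" for i
    using smooth_open_cont[OF Y[OF that]] smooth_open_imp_open[OF Y[OF that]] y0
    by (simp add: continuous_on_eq_continuous_at)
  have ev1: "eventually (\<lambda>y. \<forall>j\<in>{..<r}. \<forall>i\<in>{..<r}. \<bar>d j (L (Y i y)) - (if i = j then 1 else 0)\<bar> < eta) (nhds y0)"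
  proof (intro eventually_ball_finite ballI)
    fix i j assume ij: "j \<in> {..<r}" "i \<in> {..<r}"
    have "linear (\<lambda>x. d j (L x))" using linear_compose[OF L(1) d(1)] ij by (simp add: o_def)
    then have "bounded_linear (\<lambda>x. d j (L x))" by (simp add: linear_conv_bounded_linear)
    then have "isCont (\<lambda>y. d j (L (Y i y))) y0"
      by (rule bounded_linear.isCont) (use contY ij in auto)
    then have "isCont (\<lambda>y. \<bar>d j (L (Y i y)) - (if i = j then 1 else 0)\<bar>) y0" by (intro continuous_intros)
    then have "((\<lambda>y. \<bar>d j (L (Y i y)) - (if i = j then 1 else 0)\<bar>) \<longlongrightarrow> \<bar>d j (L (Y i y0)) - (if i = j then 1 else 0)\<bar>) (nhds y0)"
      by (simp add: isCont_def tendsto_nhds_iff)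
    moreover have "\<bar>d j (L (Y i y0)) - (if i = j then 1 else 0)\<bar> < eta" using ij eta by (simp add: L(2) d(2))
    ultimately show "eventually (\<lambda>y. \<bar>d j (L (Y i y)) - (if i = j then 1 else 0)\<bar> < eta) (nhds y0)"
      by (rule order_tendstoD)
  qed auto
  have ev2: "eventually (\<lambda>y. \<forall>i\<in>{..<r}. norm (Y i y) < norm (Y i y0) + 1) (nhds y0)"
  proof (intro eventually_ball_finite ballI)
    fix i assume "i \<in> {..<r}"
    then have "isCont (\<lambda>y. norm (Y i y)) y0" using contY by (intro continuous_intros) auto
    then have "((\<lambda>y. norm (Y i y)) \<longlongrightarrow> norm (Y i y0)) (nhds y0)" by (simp add: isCont_def tendsto_nhds_iff)
    then show "eventually (\<lambda>y. norm (Y i y) < norm (Y i y0) + 1) (nhds y0)" by (rule order_tendstoD) simp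
  qed auto
  obtain e1 where e1: "e1 > 0"
    "\<And>y. y \<in> ball y0 e1 \<Longrightarrow> \<forall>j\<in>{..<r}. \<forall>i\<in>{..<r}. \<bar>d j (L (Y i y)) - (if i = j then 1 else 0)\<bar> < eta"
    "\<And>y. y \<in> ball y0 e1 \<Longrightarrow> \<forall>i\<in>{..<r}. norm (Y i y) < norm (Y i y0) + 1"
    using eventually_conj[OF ev1 ev2] by (auto simp: eventually_nhds_metric dist_commute)
  define Ym where "Ym = (\<Sum>i<r. norm (Y i y0) + 1)"
  have Ym0: "Ym \<ge> 0" by (simp add: Ym_def sum_nonneg)
  have Ym: "norm (Y i y) \<le> Ym" if "y \<in> ball y0 e1" "i < r" for y i
  proof -
    have "norm (Y i y) \<le> norm (Y i y0) + 1" using e1(3)[OF that(1)] that(2) by (simp add: less_imp_le)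
    also have "\<dots> \<le> Ym" unfolding Ym_def using that(2) by (intro member_le_sum) auto
    finally show ?thesis .
  qed
  have "\<exists>e C. e > 0 \<and> C \<ge> 0 \<and> (\<forall>j<r. \<forall>x\<in>ball y0 e. \<forall>y\<in>ball y0 e. norm (Y j x - Y j y) \<le> C * norm (x - y))"
    if "r > 0"
  proof -
    have "\<exists>e C. e > 0 \<and> C \<ge> 0 \<and> (\<forall>x\<in>ball y0 e. \<forall>y\<in>ball y0 e. norm (Y j x - Y j y) \<le> C * norm (x - y))" if "j < r" for j
      by (rule smooth_Lipschitz[OF Y[OF that] y0])
    then obtain e C where eC: "\<And>j. j < r \<Longrightarrow> e j > 0" "\<And>j. j < r \<Longrightarrow> C j \<ge> 0"
      "\<And>j x y. j < r \<Longrightarrow> x \<in> ball y0 (e j) \<Longrightarrow> y \<in> ball y0 (e j) \<Longrightarrow> norm (Y j x - Y j y) \<le> C j * norm (x - y)"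
      by metis
    define e' where "e' = Min (e ` {..<r})"
    have "e ` {..<r} \<noteq> {}" using that by auto
    then have e': "e' > 0" "\<And>j. j < r \<Longrightarrow> e' \<le> e j"
      unfolding e'_def using eC(1) by (auto simp: Min_gr_iff)
    have "norm (Y j x - Y j y) \<le> (\<Sum>j<r. C j) * norm (x - y)" if "j < r" "x \<in> ball y0 e'" "y \<in> ball y0 e'" for j x y
    proof -
      have "C j \<le> (\<Sum>j<r. C j)" using that eC(2) by (intro member_le_sum) auto
      then have "C j * norm (x - y) \<le> (\<Sum>j<r. C j) * norm (x - y)" by (intro mult_right_mono) auto
      moreover have "x \<in> ball y0 (e j)" "y \<in> ball y0 (e j)" using that e'(2)[OF that(1)] by auto
      ultimately show ?thesis using eC(3)[OF that(1)] by force
    qed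
    moreover have "(\<Sum>j<r. C j) \<ge> 0" using eC(2) by (intro sum_nonneg) auto
    ultimately show ?thesis using e'(1) by blast
  qed
  moreover have "\<exists>e C. e > 0 \<and> C \<ge> 0 \<and> (\<forall>j<r. \<forall>x\<in>ball y0 e. \<forall>y\<in>ball y0 e. norm (Y j x - Y j y) \<le> C * norm (x - y))"
    if "r = 0" using that by (intro exI[of _ 1]) auto
  ultimately obtain e2 K0 where e2: "e2 > 0" "K0 \<ge> 0"
    "\<And>j x y. j < r \<Longrightarrow> x \<in> ball y0 e2 \<Longrightarrow> y \<in> ball y0 e2 \<Longrightarrow> norm (Y j x - Y j y) \<le> K0 * norm (x - y)"
    by (cases "r > 0") blast+
  \<comment> \<open>Hence the coefficients of a vector in the span are controlled by its projection.\<close>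
  define D2 where "D2 = 2 * real r * D"
  have D20: "D2 \<ge> 0" using D(1) by (simp add: D2_def)
  have coeff: "(\<Sum>j<r. \<bar>c j\<bar>) \<le> D2 * norm (L (\<Sum>j<r. c j *\<^sub>R Y j y))" if y: "y \<in> ball y0 e1" for c y
  proof -
    let ?u = "\<Sum>j<r. c j *\<^sub>R Y j y"
    have dL: "d j (L ?u) = (\<Sum>i<r. c i * d j (L (Y i y)))" if "j < r" for j
      by (simp add: linear_sum[OF L(1)] linear_scale[OF L(1)] linear_sum[OF d(1)[OF that]] linear_scale[OF d(1)[OF that]])
    have diff: "\<bar>c j - d j (L ?u)\<bar> \<le> (\<Sum>i<r. \<bar>c i\<bar>) * eta" if j: "j < r" for j
    proof -
      have cj: "c j = (\<Sum>i<r. c i * (if i = j then 1 else 0))" using j by (simp add: if_distrib cong: if_cong)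
      have "d j (L ?u) - c j = (\<Sum>i<r. c i * d j (L (Y i y))) - (\<Sum>i<r. c i * (if i = j then 1 else 0))"
        by (rule arg_cong2[of _ _ _ _ minus, OF dL[OF j] cj])
      also have "\<dots> = (\<Sum>i<r. c i * (d j (L (Y i y)) - (if i = j then 1 else 0)))"
        by (simp only: sum_subtractf[symmetric] right_diff_distrib)
      finally have "\<bar>d j (L ?u) - c j\<bar> \<le> (\<Sum>i<r. \<bar>c i * (d j (L (Y i y)) - (if i = j then 1 else 0))\<bar>)"
        by (simp only:) (rule sum_abs)
      also have "\<dots> \<le> (\<Sum>i<r. \<bar>c i\<bar> * eta)"
      proof (rule sum_mono)
        fix i assume "i \<in> {..<r}"
        then have "\<bar>d j (L (Y i y)) - (if i = j then 1 else 0)\<bar> < eta" using e1(2)[OF y] j by blast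
        from mult_left_mono[OF less_imp_le[OF this] abs_ge_zero[of "c i"]]
        show "\<bar>c i * (d j (L (Y i y)) - (if i = j then 1 else 0))\<bar> \<le> \<bar>c i\<bar> * eta"
          by (simp only: abs_mult)
      qed
      finally show ?thesis by (simp add: sum_distrib_right abs_minus_commute)
    qed
    have "(\<Sum>j<r. \<bar>c j\<bar>) \<le> (\<Sum>j<r. (\<Sum>i<r. \<bar>c i\<bar>) * eta + D * norm (L ?u))"
    proof (rule sum_mono)
      fix j assume "j \<in> {..<r}"
      then have j: "j < r" by simp
      show "\<bar>c j\<bar> \<le> (\<Sum>i<r. \<bar>c i\<bar>) * eta + D * norm (L ?u)"
        using diff[OF j] D(2)[OF j, of "L ?u"] by linarith
    qed
    also have "\<dots> = real r * eta * (\<Sum>i<r. \<bar>c i\<bar>) + real r * (D * norm (L ?u))"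
      by (simp add: algebra_simps)
    also have "\<dots> \<le> 1/2 * (\<Sum>i<r. \<bar>c i\<bar>) + real r * (D * norm (L ?u))"
      using eta(2) by (intro add_right_mono mult_right_mono sum_nonneg) auto
    finally show ?thesis by (simp add: D2_def algebra_simps)
  qed
  define e where "e = min e1 e2"
  define K where "K = (D2 * D1 * Ym + 1) * (D2 * K0)"
  have "norm ((\<Sum>j<r. c j *\<^sub>R Y j y) - (\<Sum>j<r. c' j *\<^sub>R Y j y')) \<le> K * norm (y - y') * norm (L (\<Sum>j<r. c' j *\<^sub>R Y j y'))"
    if y: "y \<in> ball y0 e" "y' \<in> ball y0 e" and eqL: "L (\<Sum>j<r. c j *\<^sub>R Y j y) = L (\<Sum>j<r. c' j *\<^sub>R Y j y')" for y y' c c'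
  proof -
    let ?u' = "\<Sum>j<r. c' j *\<^sub>R Y j y'"
    define v where "v = (\<Sum>j<r. (c j - c' j) *\<^sub>R Y j y)"
    define x where "x = (\<Sum>j<r. c' j *\<^sub>R (Y j y - Y j y'))"
    have y1: "y \<in> ball y0 e1" "y' \<in> ball y0 e1" "y \<in> ball y0 e2" "y' \<in> ball y0 e2" using y by (auto simp: e_def)
    have split: "(\<Sum>j<r. c j *\<^sub>R Y j y) - ?u' = v + x"
      unfolding v_def x_def by (simp add: sum.distrib[symmetric] sum_subtractf[symmetric] algebra_simps)
    have Lv: "L v = - L x"
      using eqL linear_add[OF L(1), of v x] linear_diff[OF L(1), of "\<Sum>j<r. c j *\<^sub>R Y j y" ?u'] split
      by (simp add: eq_neg_iff_add_eq_0)
    have "norm x \<le> (\<Sum>j<r. norm (c' j *\<^sub>R (Y j y - Y j y')))" unfolding x_def by (rule norm_sum)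
    also have "\<dots> \<le> (\<Sum>j<r. \<bar>c' j\<bar> * (K0 * norm (y - y')))"
      using e2(3) y1 by (intro sum_mono) (auto intro!: mult_left_mono)
    also have "\<dots> = (\<Sum>j<r. \<bar>c' j\<bar>) * (K0 * norm (y - y'))" by (simp add: sum_distrib_right)
    also have "\<dots> \<le> D2 * norm (L ?u') * (K0 * norm (y - y'))"
      using coeff[OF y1(2), of c'] e2(2) by (intro mult_right_mono) auto
    finally have x: "norm x \<le> D2 * norm (L ?u') * (K0 * norm (y - y'))" .
    have "norm v \<le> (\<Sum>j<r. norm ((c j - c' j) *\<^sub>R Y j y))" unfolding v_def by (rule norm_sum)
    also have "\<dots> \<le> (\<Sum>j<r. \<bar>c j - c' j\<bar> * Ym)"
      using Ym[OF y1(1)] by (intro sum_mono) (auto intro!: mult_left_mono)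
    also have "\<dots> = (\<Sum>j<r. \<bar>c j - c' j\<bar>) * Ym" by (simp add: sum_distrib_right)
    also have "\<dots> \<le> D2 * norm (L v) * Ym"
      using coeff[OF y1(1), of "\<lambda>j. c j - c' j"] Ym0 unfolding v_def by (intro mult_right_mono) auto
    also have "norm (L v) \<le> D1 * norm x" using D1(2)[of x] by (simp add: Lv)
    finally have "norm v \<le> D2 * (D1 * norm x) * Ym" using D20 Ym0 by (simp add: mult_left_mono mult_right_mono)
    then have "norm (v + x) \<le> (D2 * D1 * Ym + 1) * norm x"
      using norm_triangle_ineq[of v x] by (simp add: algebra_simps)
    also have "\<dots> \<le> (D2 * D1 * Ym + 1) * (D2 * norm (L ?u') * (K0 * norm (y - y')))"
      using x D20 D1(1) Ym0 by (intro mult_left_mono) auto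
    finally show ?thesis unfolding split K_def by (simp add: algebra_simps)
  qed
  note main = this
  have e_pos: "e > 0" using e1(1) e2(1) by (simp add: e_def)
  have K_nonneg: "K \<ge> 0" using D20 D1(1) Ym0 e2(2) by (simp add: K_def)
  show ?thesis
    by (rule exI[of _ e], rule exI[of _ K]) (intro conjI ballI allI impI e_pos K_nonneg main)
qed

lemma tvec_sum:
  assumes M: "smooth_manifold M" and c: "(U, \<phi>) \<in> mfd_atlas M" and p: "p \<in> U"
  shows "tvec M U \<phi> p (\<Sum>j\<in>I. c j *\<^sub>R u j) = (\<lambda>f. \<Sum>j\<in>I. c j * tvec M U \<phi> p (u j) f)"
proof
  fix f
  show "tvec M U \<phi> p (\<Sum>j\<in>I. c j *\<^sub>R u j) f = (\<Sum>j\<in>I. c j * tvec M U \<phi> p (u j) f)"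
  proof (cases "f \<in> smooth_funs M")
    case True
    have "linear (deriv_at (in_chart M U \<phi> f) (\<phi> p))"
      using in_chart_has_derivative[OF M c p True] by (rule has_derivative_linear)
    then show ?thesis using True by (simp add: tvec_def linear_sum linear_scale)
  qed (simp add: tvec_def)
qed

lemma local_frameD:
  assumes "local_frame M N S U r X"
  shows "openin (mfd_top N) U"
    and "\<And>i q. i < r \<Longrightarrow> q \<in> U \<Longrightarrow> X i q \<in> tangent_space M q"
    and "\<And>i f. i < r \<Longrightarrow> f \<in> smooth_funs M \<Longrightarrow> smooth_fun_on N U (\<lambda>q. X i q f)"
    and "\<And>q. q \<in> U \<Longrightarrow> S q = {(\<lambda>f. \<Sum>i<r. c i * X i q f) | c. True}"
    and "\<And>q c. q \<in> U \<Longrightarrow> (\<lambda>f. \<Sum>i<r. c i * X i q f) = (\<lambda>_. 0) \<Longrightarrow> \<forall>i<r. c i = 0"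
  using assms unfolding local_frame_def by blast+

text \<open>The coordinates of the frame fields are their values on smooth functions that agree with the coordinate
  functions near \<open>z\<close>, so they are smooth.\<close>

lemma frame_in_chart:
  fixes N :: "('a, 'k::euclidean_space) manifold"
  assumes N: "smooth_manifold N" and c: "(W, \<psi>) \<in> mfd_atlas N" and z: "z \<in> W" "z \<in> U0"
    and fr: "local_frame N N F U0 r X"
  shows "\<exists>T Y. \<psi> z \<in> T \<and> open T \<and> (\<forall>j<r. smooth_open T (Y j)) \<and>
    (\<forall>q\<in>W. \<psi> q \<in> T \<longrightarrow> q \<in> U0 \<and> (\<forall>j<r. X j q = tvec N W \<psi> q (Y j (\<psi> q)) \<and> Y j (\<psi> q) \<in> mfd_model N))"
proof -
  let ?V = "mfd_model N" and ?P = "proj_on (mfd_model N)"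
  note V = smooth_manifold_model[OF N] and fr = local_frameD[OF fr]
  have lin: "smooth_open UNIV (\<lambda>x. x \<bullet> b)" for b :: 'k
    by (intro smooth_open_bounded_linear bounded_linear_inner_left) simp
  have "\<exists>f G. f \<in> smooth_funs N \<and> openin (mfd_top N) G \<and> z \<in> G \<and> G \<subseteq> W \<and> (\<forall>q\<in>G. f q = \<psi> q \<bullet> b)" for b
    by (rule smooth_funs_germ[OF N c z(1) lin UNIV_I])
  then obtain f G where f: "\<And>b. f b \<in> smooth_funs N" "\<And>b. openin (mfd_top N) (G b)" "\<And>b. z \<in> G b"
    "\<And>b. G b \<subseteq> W" "\<And>b q. q \<in> G b \<Longrightarrow> f b q = \<psi> q \<bullet> b" by metis
  let ?G = "W \<inter> U0 \<inter> (\<Inter>b\<in>Basis. G b)"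
  have oG: "openin (mfd_top N) ?G"
    by (intro openin_Int openin_INT2 chart_openin[OF N c] fr(1)) (auto simp: f(2))
  have zG: "z \<in> ?G" using z f(3) by auto
  define T where "T = chart_vimage N \<psi> ?G"
  define Y where "Y j y = (\<Sum>b\<in>Basis. X j (inv_into W \<psi> (?P y)) (f b) *\<^sub>R b)" for j y
  have GW: "?G \<subseteq> W" by blast
  have oT: "open T" unfolding T_def by (rule open_vimage_proj_on[OF V chart_open_image[OF N c oG GW]])
  have sY: "smooth_open T (Y j)" if "j < r" for j
    unfolding Y_def
  proof (intro smooth_open_sum oT smooth_open_scaleR smooth_open_const)
    fix b :: 'k
    have "smooth_fun_on N ?G (\<lambda>q. X j q (f b))"
      by (rule smooth_fun_on_subset[OF fr(3)[OF that f(1)]]) blast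
    then show "smooth_open T (\<lambda>x. X j (inv_into W \<psi> (?P x)) (f b))"
      unfolding T_def by (rule in_chart_smooth[OF N c oG GW])
  qed
  have key: "q \<in> U0 \<and> (\<forall>j<r. X j q = tvec N W \<psi> q (Y j (\<psi> q)) \<and> Y j (\<psi> q) \<in> ?V)" if q: "q \<in> W" "\<psi> q \<in> T" for q
  proof -
    obtain q' where "q' \<in> ?G" "?P (\<psi> q) = \<psi> q'" using q(2) unfolding T_def by blast
    then have qG: "q \<in> ?G" using inj_onD[OF chart_inj[OF N c]] q(1) chart_proj[OF N c q(1)] by (metis IntE)
    have "X j q = tvec N W \<psi> q (Y j (\<psi> q)) \<and> Y j (\<psi> q) \<in> ?V" if j: "j < r" for j
    proof -
      have "X j q \<in> tangent_space N q" using fr(2)[OF j] qG by blast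
      then obtain x where x: "x \<in> ?V" "X j q = tvec N W \<psi> q x" using tangent_space_chart[OF N c q(1)] by blast
      have "X j q (f b) = x \<bullet> b" if "b \<in> Basis" for b
      proof -
        have qb: "q \<in> G b" using qG that by blast
        have "deriv_at (\<lambda>x. x \<bullet> b) (\<psi> q) = (\<lambda>v. v \<bullet> b)"
          by (rule frechet_derivative_at[symmetric], rule bounded_linear_imp_has_derivative, rule bounded_linear_inner_left)
        then show ?thesis
          using deriv_germ[where f = "f b" and h = "\<lambda>x. x \<bullet> b", OF N c qb f(2) f(4) f(5) lin UNIV_I, of x] f(1)
            proj_on_ident[OF V x(1)] by (simp add: x(2) tvec_def)
      qed
      then have "Y j (\<psi> q) = (\<Sum>b\<in>Basis. (x \<bullet> b) *\<^sub>R b)"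
        unfolding Y_def chart_proj[OF N c q(1)] chart_inv[OF N c q(1)] by (intro sum.cong) auto
      then have "Y j (\<psi> q) = x" by (simp add: euclidean_representation)
      then show ?thesis using x by simp
    qed
    then show ?thesis using qG by blast
  qed
  have "\<psi> z \<in> T" unfolding T_def by (rule chart_in_vimage[OF N c z(1) zG])
  then show ?thesis using oT sY key by (intro exI[of _ T] exI[of _ Y]) blast
qed

text \<open>Two plaques through a common point agree near it, and their charts are smoothly related. With the
  projection \<open>L\<close> onto the tangent plane of the distribution at the point, both plaques are graphs over
  that plane in a chart of \<open>N\<close>; along rays, both graphs solve the same Lipschitz differential equation.\<close>

lemma plaque_transition_local:
  fixes N :: "('a, 'k::euclidean_space) manifold"
  assumes N: "smooth_manifold N" and cr: "constant_rank_distribution N F"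
    and p1: "plaque N F V1 U1 \<phi>1" and p2: "plaque N F V2 U2 \<phi>2" and z: "z \<in> U1" "z \<in> U2"
  shows "\<exists>B \<kappa>. \<phi>1 z \<in> B \<and> smooth_open B \<kappa> \<and>
    (\<forall>y\<in>B \<inter> V1. y \<in> \<phi>1 ` (U1 \<inter> U2) \<and> \<phi>2 (inv_into U1 \<phi>1 y) = \<kappa> y)"
proof -
  have zN: "z \<in> pts N" using plaque_subset[OF p1] z(1) by blast
  obtain W \<psi> where c: "(W, \<psi>) \<in> mfd_atlas N" "z \<in> W" using chart_exists[OF N zN] by blast
  obtain U0 r X where fr: "z \<in> U0" "local_frame N N F U0 r X"
    using cr zN unfolding constant_rank_distribution_def by blast
  note frD = local_frameD[OF fr(2)]
  let ?V = "mfd_model N"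
  note V = smooth_manifold_model[OF N] and sub1 = plaque_subspace[OF p1] and sub2 = plaque_subspace[OF p2]
  obtain T Y where *: "\<psi> z \<in> T \<and> open T \<and> (\<forall>j<r. smooth_open T (Y j)) \<and>
    (\<forall>q\<in>W. \<psi> q \<in> T \<longrightarrow> q \<in> U0 \<and> (\<forall>j<r. X j q = tvec N W \<psi> q (Y j (\<psi> q)) \<and> Y j (\<psi> q) \<in> ?V))"
    using frame_in_chart[OF N c fr] by (elim exE)
  then have T: "\<psi> z \<in> T" "open T" and Y: "\<And>j. j < r \<Longrightarrow> smooth_open T (Y j)"
    and TY: "\<And>q. q \<in> W \<Longrightarrow> \<psi> q \<in> T \<Longrightarrow> q \<in> U0"
      "\<And>q j. q \<in> W \<Longrightarrow> \<psi> q \<in> T \<Longrightarrow> j < r \<Longrightarrow> X j q = tvec N W \<psi> q (Y j (\<psi> q))"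
      "\<And>q j. q \<in> W \<Longrightarrow> \<psi> q \<in> T \<Longrightarrow> j < r \<Longrightarrow> Y j (\<psi> q) \<in> ?V"
    by simp_all
  have sumV: "(\<Sum>j<r. a j *\<^sub>R Y j (\<psi> q)) \<in> ?V" if "q \<in> W" "\<psi> q \<in> T" for q and a :: "nat \<Rightarrow> real"
    using TY(3)[OF that] by (intro subspace_sum[OF V] subspace_scale[OF V]) auto
  have tsum: "tvec N W \<psi> q (\<Sum>j<r. a j *\<^sub>R Y j (\<psi> q)) = (\<lambda>f. \<Sum>j<r. a j * X j q f)"
    if "q \<in> W" "\<psi> q \<in> T" for q and a :: "nat \<Rightarrow> real"
    using tvec_sum[OF N c(1) that(1), of a "\<lambda>j. Y j (\<psi> q)" "{..<r}"] TY(2)[OF that] by simp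
  \<comment> \<open>A plaque is tangent to \<open>F\<close>, which the frame spans.\<close>
  have in_span: "\<exists>a. deriv_at (\<lambda>x. \<psi> (inv_into U \<phi> (proj_on V' x))) (\<phi> q) w = (\<Sum>j<r. a j *\<^sub>R Y j (\<psi> q))"
    if pl: "plaque N F V' U \<phi>" and q: "q \<in> U" "q \<in> W" "\<psi> q \<in> T" and w: "w \<in> V'" for V' U \<phi> q w
  proof -
    let ?i = "\<lambda>x. \<psi> (inv_into U \<phi> (proj_on V' x))"
    have mem: "\<phi> q \<in> proj_on V' -` (\<phi> ` (U \<inter> W))" using q plaque_proj[OF N pl q(1)] by auto
    have uV: "deriv_at ?i (\<phi> q) w \<in> ?V"
      by (rule deriv_at_in_subspace[OF V plaque_in_chart(1)[OF N pl c(1)] mem])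
        (use plaque_in_chart(2)[OF N pl c(1)] chart_model[OF N c(1)] in blast)
    have "pvec N V' U \<phi> q w \<in> F q" using plaque_image[OF pl q(1)] w by blast
    then obtain a where "pvec N V' U \<phi> q w = (\<lambda>f. \<Sum>j<r. a j * X j q f)"
      using frD(4)[OF TY(1)[OF q(2,3)]] by blast
    then have "tvec N W \<psi> q (deriv_at ?i (\<phi> q) w) = tvec N W \<psi> q (\<Sum>j<r. a j *\<^sub>R Y j (\<psi> q))"
      using pvec_eq_tvec[OF N pl c(1) q(1,2)] tsum[OF q(2,3)] by metis
    from tvec_inject[OF N c(1) q(2) uV sumV[OF q(2,3)] this] show ?thesis by blast
  qed
  let ?i1 = "\<lambda>x. \<psi> (inv_into U1 \<phi>1 (proj_on V1 x))" and ?i2 = "\<lambda>x. \<psi> (inv_into U2 \<phi>2 (proj_on V2 x))"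
  let ?O1 = "proj_on V1 -` (\<phi>1 ` (U1 \<inter> W))" and ?O2 = "proj_on V2 -` (\<phi>2 ` (U2 \<inter> W))"
  note i1 = plaque_in_chart[OF N p1 c(1)] and i2 = plaque_in_chart[OF N p2 c(1)]
  have m1: "\<phi>1 z \<in> ?O1" and m2: "\<phi>2 z \<in> ?O2"
    using z c(2) plaque_proj[OF N p1 z(1)] plaque_proj[OF N p2 z(2)] by auto
  have i1z: "?i1 (\<phi>1 z) = \<psi> z" and i2z: "?i2 (\<phi>2 z) = \<psi> z"
    by (simp_all add: plaque_proj[OF N p1 z(1)] plaque_proj[OF N p2 z(2)] plaque_inv[OF N p1 z(1)] plaque_inv[OF N p2 z(2)])
  define A where "A = span ((\<lambda>j. Y j (\<psi> z)) ` {..<r})"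
  define L where "L = proj_on A"
  have A: "subspace A" by (simp add: A_def)
  have L: "linear L" "\<And>x. L x \<in> A" "\<And>x. x \<in> A \<Longrightarrow> L x = x"
    unfolding L_def using linear_proj_on[OF A] proj_on_in[OF A] proj_on_ident[OF A] by auto
  have blL: "bounded_linear L" using L(1) by (simp add: linear_conv_bounded_linear)
  have LY: "L (Y j (\<psi> z)) = Y j (\<psi> z)" if "j < r" for j
    by (rule L(3)) (use that in \<open>auto simp: A_def intro: span_base\<close>)
  have indep: "\<forall>j<r. a j = 0" if "(\<Sum>j<r. a j *\<^sub>R Y j (\<psi> z)) = 0" for a
  proof -
    have "tvec N W \<psi> z 0 = (\<lambda>f. 0)" using tvec_lincomb[OF N c, of 0 0 0 0] by simp
    then have "(\<lambda>f. \<Sum>j<r. a j * X j z f) = (\<lambda>_. 0)" using tsum[OF c(2) T(1), of a] that by simp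
    then show ?thesis by (rule frD(5)[OF fr(1)])
  qed
  obtain e K where e: "e > 0" "K \<ge> 0" and Lip: "\<And>y y' a a'. y \<in> ball (\<psi> z) e \<Longrightarrow> y' \<in> ball (\<psi> z) e \<Longrightarrow>
    L (\<Sum>j<r. a j *\<^sub>R Y j y) = L (\<Sum>j<r. a' j *\<^sub>R Y j y') \<Longrightarrow>
    norm ((\<Sum>j<r. a j *\<^sub>R Y j y) - (\<Sum>j<r. a' j *\<^sub>R Y j y')) \<le>
      K * norm (y - y') * norm (L (\<Sum>j<r. a' j *\<^sub>R Y j y'))"
    using frame_Lipschitz[where Y = Y, OF Y T(1) indep L(1) LY] by blast
  \<comment> \<open>The tangent plane of the second plaque at \<open>z\<close> is \<open>A\<close>, so the projection of that plaque has a local section.\<close>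
  let ?x1 = "\<lambda>x. L (?i1 x)" and ?x2 = "\<lambda>x. L (?i2 x)"
  have x1: "smooth_open ?O1 ?x1" by (rule smooth_open_bounded_linear_comp[OF blL i1(1)])
  have x2: "smooth_open ?O2 ?x2" by (rule smooth_open_bounded_linear_comp[OF blL i2(1)])
  have dLi: "deriv_at (\<lambda>x. L (g x)) x w = L (deriv_at g x w)" if "smooth_open S g" "x \<in> S" for g :: "'k \<Rightarrow> 'k" and S x w
    using fun_cong[OF frechet_derivative_at[OF bounded_linear.has_derivative[OF blL smooth_open_has_derivative[OF that]]], of w] by simp
  have surj: "A \<subseteq> deriv_at ?x2 (\<phi>2 z) ` V2"
  proof -
    have lin: "linear (deriv_at ?i2 (\<phi>2 z))"
      using smooth_open_has_derivative[OF i2(1) m2] by (rule has_derivative_linear)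
    have "Y j (\<psi> z) \<in> deriv_at ?i2 (\<phi>2 z) ` V2" if j: "j < r" for j
    proof -
      have "X j z = (\<lambda>f. \<Sum>k<r. (if k = j then 1 else 0) * X k z f)"
        using j by (simp add: if_distrib[of "\<lambda>x. x * _"] cong: if_cong)
      then have "X j z \<in> F z"
        by (subst frD(4)[OF fr(1)]) (intro CollectI exI[of _ "\<lambda>k. if k = j then 1 else 0"] conjI TrueI)
      then obtain u where u: "u \<in> V2" "X j z = pvec N V2 U2 \<phi>2 z u" using plaque_image[OF p2 z(2)] by blast
      have uV: "deriv_at ?i2 (\<phi>2 z) u \<in> ?V"
        by (rule deriv_at_in_subspace[OF V i2(1) m2]) (use i2(2) chart_model[OF N c(1)] in blast)
      have "tvec N W \<psi> z (Y j (\<psi> z)) = tvec N W \<psi> z (deriv_at ?i2 (\<phi>2 z) u)"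
        by (simp only: TY(2)[OF c(2) T(1) j, symmetric] u(2) pvec_eq_tvec[OF N p2 c(1) z(2) c(2)])
      from tvec_inject[OF N c TY(3)[OF c(2) T(1) j] uV this] u(1) show ?thesis by blast
    qed
    then have sub: "A \<subseteq> deriv_at ?i2 (\<phi>2 z) ` V2"
      unfolding A_def by (intro span_minimal linear_subspace_image[OF lin sub2]) auto
    show ?thesis
    proof
      fix a assume a: "a \<in> A"
      then obtain u where "u \<in> V2" "a = deriv_at ?i2 (\<phi>2 z) u" using sub by blast
      then show "a \<in> deriv_at ?x2 (\<phi>2 z) ` V2" using L(3)[OF a] dLi[OF i2(1) m2, of u] by (intro image_eqI) simp_all
    qed
  qed
  have x2A: "\<And>x. x \<in> ?O2 \<Longrightarrow> x \<in> V2 \<Longrightarrow> ?x2 x \<in> A" by (rule L(2))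
  obtain B0 s where s: "?x2 (\<phi>2 z) \<in> B0" "smooth_open B0 s" "s (?x2 (\<phi>2 z)) = \<phi>2 z"
    "\<And>y. y \<in> B0 \<Longrightarrow> s y \<in> ?O2 \<and> s y \<in> V2" "\<And>y. y \<in> B0 \<Longrightarrow> y \<in> A \<Longrightarrow> ?x2 (s y) = y"
    using smooth_section[OF sub2 A x2 m2 plaque_model[OF N p2 z(2)] x2A surj] by blast
  \<comment> \<open>The candidate \<open>k\<close> for the transition map sends a point of the first plaque to the point of the second one with the same projection.\<close>
  define k where "k x = s (?x1 x)" for x
  let ?O = "?O1 \<inter> ?x1 -` B0"
  have oO: "open ?O" by (rule smooth_open_vimage[OF x1 smooth_open_imp_open[OF s(2)]])
  have x1O: "smooth_open ?O ?x1" and i1O: "smooth_open ?O ?i1"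
    by (rule smooth_open_subset[OF x1 oO Int_lower1], rule smooth_open_subset[OF i1(1) oO Int_lower1])
  have k: "smooth_open ?O k" unfolding k_def by (rule smooth_open_compose[OF x1O s(2)]) blast
  have kO2: "k x \<in> ?O2" "k x \<in> V2" if "x \<in> ?O" for x using s(4) that by (auto simp: k_def)
  have s1: "L (\<psi> z) \<in> B0" "s (L (\<psi> z)) = \<phi>2 z" using s(1,3) by (simp_all only: i2z)
  have kz: "k (\<phi>1 z) = \<phi>2 z" unfolding k_def i1z by (rule s1(2))
  have "?x1 (\<phi>1 z) \<in> B0" unfolding i1z by (rule s1(1))
  then have mO: "\<phi>1 z \<in> ?O" by (intro IntI m1 vimageI2)
  have i2k: "smooth_open ?O (\<lambda>x. ?i2 (k x))" by (rule smooth_open_compose[OF k i2(1)]) (use kO2 in blast)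
  have Lk: "L (?i2 (k x)) = ?x1 x" if "x \<in> ?O" for x unfolding k_def by (rule s(5)) (use that L(2) in auto)
  let ?G = "ball (\<psi> z) e \<inter> T"
  have oG: "open ?G" using T(2) by (intro open_Int) auto
  let ?O' = "(?O \<inter> ?i1 -` ?G) \<inter> (?O \<inter> (\<lambda>x. ?i2 (k x)) -` ?G)"
  have oO': "open ?O'" by (intro open_Int smooth_open_vimage[OF i1O oG] smooth_open_vimage[OF i2k oG])
  have mO': "\<phi>1 z \<in> ?O'"
  proof -
    have G: "\<psi> z \<in> ?G" using T(1) e(1) by simp
    have "?i1 (\<phi>1 z) \<in> ?G" unfolding i1z by (rule G)
    moreover have "?i2 (k (\<phi>1 z)) \<in> ?G" unfolding kz i2z by (rule G)
    ultimately show ?thesis by (intro IntI[OF IntI[OF mO] IntI[OF mO]] vimageI2)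
  qed
  have x1O': "smooth_open ?O' ?x1" by (rule smooth_open_subset[OF x1O oO']) blast
  obtain d C where d: "d > 0" "C \<ge> 0" "ball (\<phi>1 z) d \<subseteq> ?O'"
    "\<And>x u. x \<in> ball (\<phi>1 z) d \<Longrightarrow> norm (deriv_at ?x1 x u) \<le> C * norm u"
    using smooth_deriv_bound[OF x1O' mO'] by blast
  let ?B = "ball (\<phi>1 z) d"
  have diff_bound: "norm (deriv_at ?i1 x w - deriv_at (\<lambda>x. ?i2 (k x)) x w) \<le> K * C * norm w * norm (?i1 x - ?i2 (k x))"
    if x: "x \<in> ?B" "x \<in> V1" and w: "w \<in> V1" for x w
  proof -
    have xO: "x \<in> ?O" and G: "?i1 x \<in> ?G" "?i2 (k x) \<in> ?G" using x(1) d(3) by blast+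
    obtain q where q: "q \<in> U1" "q \<in> W" "x = \<phi>1 q" using xO proj_on_ident[OF sub1 x(2)] by auto
    have i1q: "?i1 x = \<psi> q" using q plaque_proj[OF N p1 q(1)] plaque_inv[OF N p1 q(1)] by simp
    obtain q' where q': "q' \<in> U2" "q' \<in> W" "k x = \<phi>2 q'" using kO2[OF xO] proj_on_ident[OF sub2] by auto
    have i2q: "?i2 (k x) = \<psi> q'" using q' plaque_proj[OF N p2 q'(1)] plaque_inv[OF N p2 q'(1)] by simp
    let ?u = "deriv_at ?i1 x w" and ?w' = "deriv_at k x w"
    let ?u' = "deriv_at (\<lambda>x. ?i2 (k x)) x w"
    have w': "?w' \<in> V2" by (rule deriv_at_in_subspace[OF sub2 k xO kO2(2)])
    have u'_eq: "?u' = deriv_at ?i2 (k x) ?w'"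
      using fun_cong[OF frechet_derivative_at[OF has_derivative_compose[OF smooth_open_has_derivative[OF k xO]
        smooth_open_has_derivative[OF i2(1) kO2(1)[OF xO]]]], of w] by simp
    obtain a where a: "?u = (\<Sum>j<r. a j *\<^sub>R Y j (\<psi> q))"
      using in_span[OF p1 q(1,2) _ w] G(1) i1q q(3) by auto
    obtain a' where a': "?u' = (\<Sum>j<r. a' j *\<^sub>R Y j (\<psi> q'))"
      using in_span[OF p2 q'(1,2) _ w'] G(2) i2q q'(3) u'_eq by auto
    have Lu: "L ?u = deriv_at ?x1 x w" by (rule dLi[OF i1O xO, symmetric])
    have "L ?u' = deriv_at (\<lambda>x. L (?i2 (k x))) x w" by (rule dLi[OF i2k xO, symmetric])
    also have "\<dots> = deriv_at ?x1 x w"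
      using fun_cong[OF deriv_at_cong[OF smooth_open_has_derivative[OF x1O xO] oO xO Lk[symmetric]], of w] .
    finally have Lu': "L ?u' = deriv_at ?x1 x w" .
    have "norm (?u - ?u') \<le> K * norm (\<psi> q - \<psi> q') * norm (L ?u')"
      unfolding a a' by (rule Lip) (use G i1q i2q Lu Lu' a a' in auto)
    also have "\<dots> \<le> K * norm (\<psi> q - \<psi> q') * (C * norm w)"
      using d(4)[OF x(1), of w] e(2) unfolding Lu' by (intro mult_left_mono) auto
    finally show ?thesis unfolding i1q i2q by (simp add: algebra_simps)
  qed
  \<comment> \<open>Along the ray to \<open>y\<close> the difference of the two points satisfies a linear differential inequality and starts at 0.\<close>
  have eq: "?i1 y = ?i2 (k y)" if y: "y \<in> ?B" "y \<in> V1" for y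
  proof -
    define w where "w = y - \<phi>1 z"
    define g where "g t = \<phi>1 z + t *\<^sub>R w" for t :: real
    have wV: "w \<in> V1" using y(2) plaque_model[OF N p1 z(1)] sub1 by (simp add: w_def subspace_diff)
    have gB: "g t \<in> ?B" "g t \<in> V1" if "0 \<le> t" "t \<le> 1" for t
    proof -
      have "t * norm w \<le> 1 * norm w" using that by (intro mult_right_mono) auto
      then show "g t \<in> ?B" using y(1) that by (simp add: g_def w_def dist_norm norm_minus_commute)
      show "g t \<in> V1" using wV plaque_model[OF N p1 z(1)] sub1 by (simp add: g_def subspace_add subspace_scale)
    qed
    have dg: "(g has_derivative (\<lambda>h. h *\<^sub>R w)) (at t)" for t
      unfolding g_def by (auto intro!: derivative_eq_intros)
    have "?i1 (g 1) - ?i2 (k (g 1)) = 0"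
    proof (rule Gronwall_zero)
      fix t :: real assume t: "0 \<le> t" "t \<le> 1"
      have gO: "g t \<in> ?O" using gB(1)[OF t] d(3) by blast
      have l1: "linear (deriv_at ?i1 (g t))" and l2: "linear (deriv_at (\<lambda>x. ?i2 (k x)) (g t))"
        using has_derivative_linear[OF smooth_open_has_derivative[OF i1O gO]]
          has_derivative_linear[OF smooth_open_has_derivative[OF i2k gO]] by auto
      have "((\<lambda>t. ?i1 (g t) - ?i2 (k (g t))) has_derivative
        (\<lambda>h. deriv_at ?i1 (g t) (h *\<^sub>R w) - deriv_at (\<lambda>x. ?i2 (k x)) (g t) (h *\<^sub>R w))) (at t)"
        by (rule has_derivative_diff[OF has_derivative_compose[OF dg smooth_open_has_derivative[OF i1O gO]]
          has_derivative_compose[OF dg smooth_open_has_derivative[OF i2k gO]]])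
      then show "((\<lambda>t. ?i1 (g t) - ?i2 (k (g t))) has_vector_derivative
        (deriv_at ?i1 (g t) w - deriv_at (\<lambda>x. ?i2 (k x)) (g t) w)) (at t)"
        unfolding has_vector_derivative_def
        by (simp only: linear_scale[OF l1] linear_scale[OF l2] scaleR_diff_right)
      show "norm (deriv_at ?i1 (g t) w - deriv_at (\<lambda>x. ?i2 (k x)) (g t) w) \<le>
        K * C * norm w * norm (?i1 (g t) - ?i2 (k (g t)))"
        by (rule diff_bound[OF gB[OF t] wV])
    next
      show "?i1 (g 0) - ?i2 (k (g 0)) = 0" using i1z i2z kz by (simp add: g_def)
    qed
    then show ?thesis by (simp add: g_def w_def)
  qed
  have main: "y \<in> \<phi>1 ` (U1 \<inter> U2) \<and> \<phi>2 (inv_into U1 \<phi>1 y) = k y" if y: "y \<in> ?B \<inter> V1" for y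
  proof -
    have yO: "y \<in> ?O" using y d(3) by blast
    obtain q where q: "q \<in> U1" "q \<in> W" "y = \<phi>1 q" using yO y proj_on_ident[OF sub1] by auto
    obtain q' where q': "q' \<in> U2" "q' \<in> W" "k y = \<phi>2 q'" using kO2[OF yO] proj_on_ident[OF sub2] by auto
    have "\<psi> q = \<psi> q'"
      using eq[of y] y q q' plaque_proj[OF N p1 q(1)] plaque_inv[OF N p1 q(1)]
        plaque_proj[OF N p2 q'(1)] plaque_inv[OF N p2 q'(1)] by simp
    then have "q = q'" using inj_onD[OF chart_inj[OF N c(1)]] q q' by blast
    then show ?thesis using q q' plaque_inv[OF N p1 q(1)] by auto
  qed
  have sm: "smooth_open ?B k" by (rule smooth_open_subset[OF k open_ball]) (use d(3) in blast)
  have mem: "\<phi>1 z \<in> ?B" using d(1) by simp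
  show ?thesis by (intro exI[of _ ?B] exI[of _ k]) (rule conjI[OF mem conjI[OF sm ballI[OF main]]])
qed

lemma plaque_transition:
  assumes N: "smooth_manifold N" and cr: "constant_rank_distribution N F"
    and p1: "plaque N F V1 U1 \<phi>1" and p2: "plaque N F V2 U2 \<phi>2"
  shows "openin (top_of_set V1) (\<phi>1 ` (U1 \<inter> U2))"
    and "smooth_on (\<phi>1 ` (U1 \<inter> U2)) (\<lambda>x. \<phi>2 (inv_into U1 \<phi>1 x))"
proof -
  show "openin (top_of_set V1) (\<phi>1 ` (U1 \<inter> U2))"
  proof (subst openin_subopen, intro ballI)
    fix x assume "x \<in> \<phi>1 ` (U1 \<inter> U2)"
    then obtain z where z: "z \<in> U1" "z \<in> U2" "x = \<phi>1 z" by blast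
    obtain B k where B: "\<phi>1 z \<in> B" "smooth_open B k" "\<forall>y\<in>B \<inter> V1. y \<in> \<phi>1 ` (U1 \<inter> U2) \<and> \<phi>2 (inv_into U1 \<phi>1 y) = k y"
      using plaque_transition_local[OF N cr p1 p2 z(1,2)] by (elim exE conjE)
    have "openin (top_of_set V1) (V1 \<inter> B)" using smooth_open_imp_open[OF B(2)] by (rule openin_open_Int)
    then show "\<exists>T. openin (top_of_set V1) T \<and> x \<in> T \<and> T \<subseteq> \<phi>1 ` (U1 \<inter> U2)"
      using B(1,3) z(3) plaque_model[OF N p1 z(1)] by (intro exI[of _ "V1 \<inter> B"]) auto
  qed
  show "smooth_on (\<phi>1 ` (U1 \<inter> U2)) (\<lambda>x. \<phi>2 (inv_into U1 \<phi>1 x))"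
  proof (rule smooth_onI)
    fix x assume "x \<in> \<phi>1 ` (U1 \<inter> U2)"
    then obtain z where z: "z \<in> U1" "z \<in> U2" "x = \<phi>1 z" by blast
    obtain B k where B: "\<phi>1 z \<in> B" "smooth_open B k" "\<forall>y\<in>B \<inter> V1. y \<in> \<phi>1 ` (U1 \<inter> U2) \<and> \<phi>2 (inv_into U1 \<phi>1 y) = k y"
      using plaque_transition_local[OF N cr p1 p2 z(1,2)] by (elim exE conjE)
    have "k y = \<phi>2 (inv_into U1 \<phi>1 y)" if "y \<in> B \<inter> \<phi>1 ` (U1 \<inter> U2)" for y
      using B(3) that plaque_model[OF N p1] by auto
    then show "\<exists>U g. x \<in> U \<and> smooth_open U g \<and> (\<forall>y\<in>U \<inter> \<phi>1 ` (U1 \<inter> U2). g y = \<phi>2 (inv_into U1 \<phi>1 y))"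
      using B(1,2) z(3) by (intro exI[of _ B] exI[of _ k]) auto
  qed
qed

section \<open>Gluing integral manifolds\<close>

text \<open>The leaf topology is the finest topology for which all inverses of plaque charts are continuous. If
  \<open>F\<close> is integrable, it makes \<open>N\<close> a manifold of dimension the rank of \<open>F\<close>, except that it need not be second
  countable; so only countably many plaques are used at a time below.\<close>

definition leaf_open :: "('a, 'k::euclidean_space) manifold \<Rightarrow> ('a \<Rightarrow> 'a tangent set) \<Rightarrow> 'a set \<Rightarrow> bool" where
  "leaf_open N F S \<longleftrightarrow> S \<subseteq> pts N \<and>
     (\<forall>V U \<phi>. plaque N F V U \<phi> \<longrightarrow> openin (top_of_set V) (\<phi> ` (S \<inter> U)))"

definition leaf_topology :: "('a, 'k::euclidean_space) manifold \<Rightarrow> ('a \<Rightarrow> 'a tangent set) \<Rightarrow> 'a topology" where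
  "leaf_topology N F = topology (leaf_open N F)"

lemma openin_leaf_topology: "openin (leaf_topology N F) = leaf_open N F"
  unfolding leaf_topology_def
proof (rule topology_inverse')
  show "istopology (leaf_open N F)"
    unfolding istopology_def
  proof (intro conjI allI impI)
    fix S T assume ST: "leaf_open N F S" "leaf_open N F T"
    have "openin (top_of_set V) (\<phi> ` (S \<inter> T \<inter> U))" if pl: "plaque N F V U \<phi>" for V U \<phi>
    proof -
      have "\<phi> ` (S \<inter> T \<inter> U) = \<phi> ` (S \<inter> U) \<inter> \<phi> ` (T \<inter> U)"
        using inj_on_image_Int[OF plaque_inj[OF pl], of "S \<inter> U" "T \<inter> U"] by (simp add: Int_ac)
      then show ?thesis using ST pl unfolding leaf_open_def by auto
    qed
    then show "leaf_open N F (S \<inter> T)" using ST unfolding leaf_open_def by auto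
  next
    fix K assume K: "\<forall>S\<in>K. leaf_open N F S"
    have "openin (top_of_set V) (\<phi> ` (\<Union>K \<inter> U))" if pl: "plaque N F V U \<phi>" for V U \<phi>
    proof -
      have "\<phi> ` (\<Union>K \<inter> U) = (\<Union>S\<in>K. \<phi> ` (S \<inter> U))" by auto
      moreover have "openin (top_of_set V) (\<Union>S\<in>K. \<phi> ` (S \<inter> U))"
        by (rule openin_Union) (use K pl in \<open>auto simp: leaf_open_def\<close>)
      ultimately show ?thesis by simp
    qed
    then show "leaf_open N F (\<Union>K)" using K unfolding leaf_open_def by blast
  qed
qed

lemma leaf_open_of_open:
  assumes G: "openin (mfd_top N) G"
  shows "leaf_open N F G"
  unfolding leaf_open_def
proof (intro conjI allI impI)
  show "G \<subseteq> pts N" by (rule openin_subset[OF G])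
  show "openin (top_of_set V) (\<phi> ` (G \<inter> U))" if "plaque N F V U \<phi>" for V U \<phi>
    using plaque_open[OF that G] by (simp add: Int_commute)
qed

lemma topspace_leaf_topology: "topspace (leaf_topology N F) = pts N"
proof
  show "topspace (leaf_topology N F) \<subseteq> pts N"
    using openin_topspace[of "leaf_topology N F"] unfolding openin_leaf_topology leaf_open_def by blast
  have "openin (leaf_topology N F) (pts N)"
    unfolding openin_leaf_topology by (rule leaf_open_of_open[OF openin_topspace])
  then show "pts N \<subseteq> topspace (leaf_topology N F)" by (rule openin_subset)
qed

lemma smooth_on_imp_continuous_on:
  assumes "smooth_on W f"
  shows "continuous_on W f"
  unfolding continuous_on_eq_continuous_within
proof
  fix x assume x: "x \<in> W"
  obtain U g where U: "x \<in> U" "smooth_open U g" "\<And>y. y \<in> U \<Longrightarrow> y \<in> W \<Longrightarrow> g y = f y"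
    using smooth_onE[OF assms x] by blast
  have oU: "open U" by (rule smooth_open_imp_open[OF U(2)])
  have "continuous_on U g" by (rule smooth_open_cont[OF U(2)])
  then have "isCont g x" using U(1) oU by (simp add: continuous_on_eq_continuous_at)
  then have "continuous (at x within W) g" by (rule continuous_at_imp_continuous_at_within)
  moreover have "eventually (\<lambda>y. g y = f y) (at x within W)"
    unfolding eventually_at_topological using oU U(1,3) by blast
  ultimately show "continuous (at x within W) f"
    unfolding continuous_within U(3)[OF U(1) x] by (rule Lim_transform_eventually)
qed

lemma leaf_open_plaque_preimage:
  fixes N :: "('a, 'k::euclidean_space) manifold"
  assumes N: "smooth_manifold N" and cr: "constant_rank_distribution N F"
    and pl: "plaque N F V U \<phi>" and T: "openin (top_of_set V) T"
  shows "leaf_open N F {q \<in> U. \<phi> q \<in> T}"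
  unfolding leaf_open_def
proof (intro conjI allI impI)
  show "{q \<in> U. \<phi> q \<in> T} \<subseteq> pts N" using plaque_subset[OF pl] by blast
  fix V' U' \<phi>' assume pl': "plaque N F V' U' \<phi>'"
  let ?g = "\<lambda>x. \<phi> (inv_into U' \<phi>' x)"
  have "continuous_on (\<phi>' ` (U' \<inter> U)) ?g"
    by (rule smooth_on_imp_continuous_on[OF plaque_transition(2)[OF N cr pl' pl]])
  moreover have "?g \<in> \<phi>' ` (U' \<inter> U) \<rightarrow> V"
    using plaque_inv[OF N pl'] plaque_model[OF N pl] by auto
  ultimately have "openin (top_of_set (\<phi>' ` (U' \<inter> U))) (\<phi>' ` (U' \<inter> U) \<inter> ?g -` T)"
    using T by (rule continuous_openin_preimage)
  then have "openin (top_of_set V') (\<phi>' ` (U' \<inter> U) \<inter> ?g -` T)"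
    using plaque_transition(1)[OF N cr pl' pl] openin_trans by blast
  moreover have "\<phi>' ` (U' \<inter> U) \<inter> ?g -` T = \<phi>' ` ({q \<in> U. \<phi> q \<in> T} \<inter> U')"
    using plaque_inv[OF N pl'] by auto
  ultimately show "openin (top_of_set V') (\<phi>' ` ({q \<in> U. \<phi> q \<in> T} \<inter> U'))" by simp
qed

lemma leaf_open_plaque:
  assumes N: "smooth_manifold N" and cr: "constant_rank_distribution N F" and pl: "plaque N F V U \<phi>"
  shows "leaf_open N F U"
proof -
  have "{q \<in> U. \<phi> q \<in> V} = U" using plaque_model[OF N pl] by auto
  then show ?thesis using leaf_open_plaque_preimage[OF N cr pl openin_subtopology_self] by simp
qed

text \<open>The plaque charts in \<open>\<A>\<close> serve as an atlas. Hausdorffness is inherited from \<open>N\<close>, second countability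
  follows from countability of \<open>\<A>\<close>, and the transition maps are smooth by uniqueness of plaques.\<close>

definition plaque_manifold ::
  "('a, 'k::euclidean_space) manifold \<Rightarrow> ('a \<Rightarrow> 'a tangent set) \<Rightarrow> 'k set \<Rightarrow>
   ('a set \<times> ('a \<Rightarrow> 'k)) set \<Rightarrow> ('a, 'k) manifold" where
  "plaque_manifold N F V \<A> = \<lparr>mfd_top = subtopology (leaf_topology N F) (\<Union>(U, \<phi>)\<in>\<A>. U),
     mfd_model = V, mfd_atlas = \<A>\<rparr>"

lemma pushforward_id_tvec:
  assumes "smooth_manifold S" "smooth_manifold N" "smooth_map S N id" "(U, \<phi>) \<in> mfd_atlas S" "q \<in> U"
  shows "pushforward S N id (tvec S U \<phi> q u) = pvec N (mfd_model S) U \<phi> q u"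
  using pushforward_tvec_eq[OF assms, of u] unfolding pvec_def id_apply .

context
  fixes N :: "('a, 'k::euclidean_space) manifold" and F V \<A>
  assumes N: "smooth_manifold N" and cr: "constant_rank_distribution N F"
    and V: "subspace V" and cnt: "countable \<A>" and pl: "\<And>U \<phi>. (U, \<phi>) \<in> \<A> \<Longrightarrow> plaque N F V U \<phi>"
begin

abbreviation (input) "glued \<equiv> plaque_manifold N F V \<A>"
abbreviation (input) "glued_pts \<equiv> \<Union>(U, \<phi>)\<in>\<A>. U"

lemma plaque_manifold_leaf_open: "leaf_open N F glued_pts"
proof -
  have "openin (leaf_topology N F) (\<Union>(U, \<phi>)\<in>\<A>. U)"
    by (rule openin_Union) (use leaf_open_plaque[OF N cr pl] in \<open>auto simp: openin_leaf_topology\<close>)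
  then show ?thesis by (simp add: openin_leaf_topology)
qed

lemma openin_plaque_manifold: "openin (mfd_top glued) S \<longleftrightarrow> leaf_open N F S \<and> S \<subseteq> glued_pts"
  using openin_open_subtopology[of "leaf_topology N F" glued_pts S] plaque_manifold_leaf_open
  by (simp add: plaque_manifold_def openin_leaf_topology)

lemma pts_plaque_manifold: "pts glued = glued_pts"
  using plaque_manifold_leaf_open unfolding leaf_open_def
  by (simp add: plaque_manifold_def topspace_leaf_topology Int_absorb1)

lemma plaque_manifold_sel [simp]: "mfd_model glued = V" "mfd_atlas glued = \<A>"
  by (simp_all add: plaque_manifold_def)

lemma plaque_manifold_homeomorphic:
  assumes c: "(U, \<phi>) \<in> \<A>"
  shows "homeomorphic_map (subtopology (mfd_top glued) U) (top_of_set (\<phi> ` U)) \<phi>"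
proof (rule bijective_open_imp_homeomorphic_map)
  note p = pl[OF c]
  have UX: "U \<subseteq> glued_pts" using c by blast
  have ts: "topspace (subtopology (mfd_top glued) U) = U" using UX pts_plaque_manifold by auto
  have oU: "openin (mfd_top glued) U" using leaf_open_plaque[OF N cr p] UX by (simp add: openin_plaque_manifold)
  have op: "openin (subtopology (mfd_top glued) U) S \<longleftrightarrow> leaf_open N F S \<and> S \<subseteq> U" for S
    using openin_open_subtopology[OF oU, of S] UX by (auto simp: openin_plaque_manifold)
  show "continuous_map (subtopology (mfd_top glued) U) (top_of_set (\<phi> ` U)) \<phi>"
    unfolding continuous_map_def
  proof (intro conjI allI impI)
    show "\<phi> \<in> topspace (subtopology (mfd_top glued) U) \<rightarrow> topspace (top_of_set (\<phi> ` U))" by (auto simp: ts)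
    fix G assume "openin (top_of_set (\<phi> ` U)) G"
    then have "openin (top_of_set V) G" using plaque_open_image[OF N p] openin_trans by blast
    from leaf_open_plaque_preimage[OF N cr p this]
    show "openin (subtopology (mfd_top glued) U) {x \<in> topspace (subtopology (mfd_top glued) U). \<phi> x \<in> G}"
      unfolding op ts by blast
  qed
  show "open_map (subtopology (mfd_top glued) U) (top_of_set (\<phi> ` U)) \<phi>"
    unfolding open_map_def
  proof (intro allI impI)
    fix S assume "openin (subtopology (mfd_top glued) U) S"
    then have S: "leaf_open N F S" "S \<subseteq> U" unfolding op by auto
    then have "openin (top_of_set V) (\<phi> ` (S \<inter> U))" using p unfolding leaf_open_def by blast
    then have "openin (top_of_set V) (\<phi> ` S)" using S(2) by (simp add: Int_absorb2)
    then show "openin (top_of_set (\<phi> ` U)) (\<phi> ` S)"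
      by (rule openin_subset_trans) (use S(2) plaque_model[OF N p] in auto)
  qed
  show "\<phi> ` topspace (subtopology (mfd_top glued) U) = topspace (top_of_set (\<phi> ` U))" unfolding ts by simp
  show "inj_on \<phi> (topspace (subtopology (mfd_top glued) U))" unfolding ts by (rule plaque_inj[OF p])
qed

lemma plaque_manifold_Hausdorff: "Hausdorff_space (mfd_top glued)"
  unfolding Hausdorff_space_def pts_plaque_manifold
proof (intro allI impI)
  fix x y assume xy: "x \<in> glued_pts \<and> y \<in> glued_pts \<and> x \<noteq> y"
  have XN: "glued_pts \<subseteq> pts N" using plaque_manifold_leaf_open unfolding leaf_open_def by blast
  obtain G H where GH: "openin (mfd_top N) G" "openin (mfd_top N) H" "x \<in> G" "y \<in> H" "disjnt G H"
    using smooth_manifold_Hausdorff[OF N, unfolded Hausdorff_space_def, rule_format, of x y] xy XN by blast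
  have "openin (mfd_top glued) (G \<inter> glued_pts)" if "openin (mfd_top N) G" for G
  proof -
    have "openin (leaf_topology N F) (G \<inter> glued_pts)"
      by (rule openin_Int) (simp_all only: openin_leaf_topology leaf_open_of_open[OF that] plaque_manifold_leaf_open)
    then show ?thesis by (simp add: openin_leaf_topology openin_plaque_manifold)
  qed
  then show "\<exists>U V. openin (mfd_top glued) U \<and> openin (mfd_top glued) V \<and> x \<in> U \<and> y \<in> V \<and> disjnt U V"
    using GH xy by (intro exI[of _ "G \<inter> glued_pts"] exI[of _ "H \<inter> glued_pts"]) (auto simp: disjnt_def)
qed

lemma plaque_manifold_second_countable: "second_countable (mfd_top glued)"
proof -
  obtain \<B> :: "'k set set" where B: "countable \<B>" "topological_basis \<B>" using ex_countable_basis by blast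
  define \<C> where "\<C> = (\<lambda>((U, \<phi>), b). {q \<in> U. \<phi> q \<in> V \<inter> b}) ` (\<A> \<times> \<B>)"
  have cnt_C: "countable \<C>" unfolding \<C>_def using cnt B(1) by (intro countable_image countable_SIGMA) auto
  have open_C: "openin (mfd_top glued) S" if S: "S \<in> \<C>" for S
  proof -
    obtain U \<phi> b where b: "(U, \<phi>) \<in> \<A>" "b \<in> \<B>" "S = {q \<in> U. \<phi> q \<in> V \<inter> b}"
      using S unfolding \<C>_def by auto
    have "openin (top_of_set V) (V \<inter> b)" using topological_basis_open[OF B(2) b(2)] by (rule openin_open_Int)
    from leaf_open_plaque_preimage[OF N cr pl[OF b(1)] this] show ?thesis
      using b by (auto simp: openin_plaque_manifold)
  qed
  have base_C: "\<exists>V\<in>\<C>. x \<in> V \<and> V \<subseteq> G" if G: "openin (mfd_top glued) G" "x \<in> G" for G x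
  proof -
    have "x \<in> glued_pts" using openin_subset[OF G(1)] G(2) pts_plaque_manifold by blast
    then obtain U \<phi> where c: "(U, \<phi>) \<in> \<A>" "x \<in> U" by blast
    note p = pl[OF c(1)]
    have "openin (top_of_set V) (\<phi> ` (G \<inter> U))"
      using G(1) p unfolding openin_plaque_manifold leaf_open_def by blast
    then obtain S where S: "open S" "\<phi> ` (G \<inter> U) = V \<inter> S" by (auto simp: openin_open)
    have "\<phi> x \<in> S" using S(2) G(2) c(2) by blast
    then obtain b where b: "b \<in> \<B>" "\<phi> x \<in> b" "b \<subseteq> S" using topological_basisE[OF B(2) S(1)] by blast
    have "{q \<in> U. \<phi> q \<in> V \<inter> b} \<subseteq> G"
    proof
      fix q assume q: "q \<in> {q \<in> U. \<phi> q \<in> V \<inter> b}"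
      then have "\<phi> q \<in> \<phi> ` (G \<inter> U)" using S(2) b(3) by blast
      then show "q \<in> G" using q inj_onD[OF plaque_inj[OF p]] by blast
    qed
    moreover have "{q \<in> U. \<phi> q \<in> V \<inter> b} \<in> \<C>"
      unfolding \<C>_def by (rule image_eqI[of _ _ "((U, \<phi>), b)"]) (use c(1) b(1) in simp_all)
    moreover have "x \<in> {q \<in> U. \<phi> q \<in> V \<inter> b}" using c(2) b(2) plaque_model[OF N p c(2)] by simp
    ultimately show ?thesis by (intro bexI[of _ "{q \<in> U. \<phi> q \<in> V \<inter> b}"] conjI)
  qed
  show ?thesis unfolding second_countable_def
  proof (rule exI[of _ \<C>], intro conjI ballI allI impI)
    show "countable \<C>" by (rule cnt_C)
    show "openin (mfd_top glued) S" if "S \<in> \<C>" for S by (rule open_C[OF that])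
    show "\<exists>V\<in>\<C>. x \<in> V \<and> V \<subseteq> G" if "openin (mfd_top glued) G \<and> x \<in> G" for G x
      using that by (elim conjE) (rule base_C)
  qed
qed

lemma smooth_plaque_manifold: "smooth_manifold glued"
  unfolding smooth_manifold_def plaque_manifold_sel
proof (intro conjI plaque_manifold_Hausdorff plaque_manifold_second_countable V)
  show "\<forall>(U, \<phi>)\<in>\<A>. openin (mfd_top glued) U \<and> openin (top_of_set V) (\<phi> ` U) \<and>
      homeomorphic_map (subtopology (mfd_top glued) U) (top_of_set (\<phi> ` U)) \<phi>"
  proof (intro ballI, clarify, intro conjI)
    fix U \<phi> assume c: "(U, \<phi>) \<in> \<A>"
    have "U \<subseteq> glued_pts" using c by blast
    then show "openin (mfd_top glued) U" using leaf_open_plaque[OF N cr pl[OF c]] by (simp add: openin_plaque_manifold)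
    show "openin (top_of_set V) (\<phi> ` U)" by (rule plaque_open_image[OF N pl[OF c]])
    show "homeomorphic_map (subtopology (mfd_top glued) U) (top_of_set (\<phi> ` U)) \<phi>"
      by (rule plaque_manifold_homeomorphic[OF c])
  qed
  show "(\<Union>(U, \<phi>)\<in>\<A>. U) = pts glued" by (simp add: pts_plaque_manifold)
  show "\<forall>(U, \<phi>)\<in>\<A>. \<forall>(U', \<psi>)\<in>\<A>. smooth_on (\<phi> ` (U \<inter> U')) (\<psi> \<circ> inv_into U \<phi>)"
    unfolding o_def using plaque_transition(2)[OF N cr pl pl] by blast
qed

lemma plaque_manifold_smooth_map: "smooth_map glued N id"
  unfolding smooth_map_def plaque_manifold_sel
proof (intro conjI)
  show "continuous_map (mfd_top glued) (mfd_top N) id"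
    unfolding continuous_map_def
  proof (intro conjI allI impI)
    show "id \<in> pts glued \<rightarrow> pts N"
      using plaque_manifold_leaf_open unfolding leaf_open_def pts_plaque_manifold by auto
    fix G assume G: "openin (mfd_top N) G"
    have "openin (leaf_topology N F) (G \<inter> glued_pts)"
      by (rule openin_Int) (simp_all only: openin_leaf_topology leaf_open_of_open[OF G] plaque_manifold_leaf_open)
    moreover have "{x \<in> pts glued. id x \<in> G} = G \<inter> glued_pts" unfolding pts_plaque_manifold by auto
    ultimately show "openin (mfd_top glued) {x \<in> pts glued. id x \<in> G}"
      by (simp add: openin_leaf_topology openin_plaque_manifold)
  qed
  show "\<forall>(U, \<phi>)\<in>\<A>. \<forall>(W, \<psi>)\<in>mfd_atlas N. smooth_on (\<phi> ` (U \<inter> id -` W)) (\<psi> \<circ> id \<circ> inv_into U \<phi>)"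
    unfolding o_def vimage_id id_apply using plaque_smooth_on[OF pl] by blast
qed

lemma plaque_manifold_integral: "integral_manifold N F glued"
  unfolding integral_manifold_def submanifold_def immersion_def
proof (intro conjI ballI smooth_plaque_manifold plaque_manifold_smooth_map)
  note S = smooth_plaque_manifold and sm = plaque_manifold_smooth_map
  show "pts glued \<subseteq> pts N" using plaque_manifold_leaf_open unfolding leaf_open_def pts_plaque_manifold by blast
  fix q assume "q \<in> pts glued"
  then obtain U \<phi> where c: "(U, \<phi>) \<in> \<A>" "q \<in> U" unfolding pts_plaque_manifold by blast
  have c': "(U, \<phi>) \<in> mfd_atlas glued" using c by simp
  have push: "pushforward glued N id (tvec glued U \<phi> q u) = pvec N V U \<phi> q u" for u
    using pushforward_id_tvec[OF S N sm c' c(2)] by simp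
  have ts: "tangent_space glued q = tvec glued U \<phi> q ` V" using tangent_space_chart[OF S c' c(2)] by simp
  show "pushforward glued N id ` tangent_space glued q = F q"
    unfolding ts image_image push by (rule plaque_image[OF pl[OF c(1)] c(2)])
  show "inj_on (pushforward glued N id) (tangent_space glued q)"
  proof (rule inj_onI)
    fix v w assume "v \<in> tangent_space glued q" "w \<in> tangent_space glued q"
      and eq: "pushforward glued N id v = pushforward glued N id w"
    then obtain x y where xy: "x \<in> V" "y \<in> V" "v = tvec glued U \<phi> q x" "w = tvec glued U \<phi> q y" unfolding ts by blast
    then have "x = y" using eq push inj_onD[OF plaque_inj_pvec[OF pl[OF c(1)] c(2)]] by simp
    then show "v = w" using xy by simp
  qed
qed

end

lemma plaque_restrict:
  assumes N: "smooth_manifold N" and pl: "plaque N F V U \<phi>"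
    and sub: "U' \<subseteq> U" and op: "openin (top_of_set V) (\<phi> ` U')"
  shows "plaque N F V U' \<phi>"
proof -
  note V = plaque_subspace[OF pl] and inj = plaque_inj[OF pl]
  have inj': "inj_on \<phi> U'" by (rule inj_on_subset[OF inj sub])
  have inv: "inv_into U' \<phi> y = inv_into U \<phi> y" if "y \<in> \<phi> ` U'" for y
  proof -
    obtain q where "q \<in> U'" "y = \<phi> q" using \<open>y \<in> \<phi> ` U'\<close> by blast
    then show ?thesis using inv_into_f_f[OF inj'] inv_into_f_f[OF inj] sub by auto
  qed
  have pv: "pvec N V U' \<phi> q u = pvec N V U \<phi> q u" if q: "q \<in> U'" for q u
  proof
    fix f
    show "pvec N V U' \<phi> q u f = pvec N V U \<phi> q u f"
    proof (cases "f \<in> smooth_funs N")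
      case True
      have qU: "q \<in> U" using q sub by blast
      have "\<phi> q \<in> proj_on V -` (\<phi> ` U)" "\<phi> q \<in> proj_on V -` (\<phi> ` U')"
        using plaque_proj[OF N pl qU] q qU by auto
      from deriv_at_cong[OF smooth_open_has_derivative[OF plaque_fun_smooth[OF N pl True] this(1)]
        open_vimage_proj_on[OF V op] this(2), of "\<lambda>x. f (inv_into U' \<phi> (proj_on V x))"]
      have "deriv_at (\<lambda>x. f (inv_into U' \<phi> (proj_on V x))) (\<phi> q) =
          deriv_at (\<lambda>x. f (inv_into U \<phi> (proj_on V x))) (\<phi> q)"
        using inv by simp
      then show ?thesis by (simp add: pvec_def)
    qed (simp add: pvec_def)
  qed
  show ?thesis unfolding plaque_def
  proof (intro conjI allI impI ballI V inj')
    show "U' \<subseteq> pts N" using plaque_subset[OF pl] sub by blast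
    show "openin (top_of_set V) (\<phi> ` (U' \<inter> G))" if "openin (mfd_top N) G" for G
    proof -
      have "\<phi> ` (U' \<inter> G) = \<phi> ` U' \<inter> \<phi> ` (U \<inter> G)"
        using inj_on_image_Int[OF inj sub, of "U \<inter> G"] sub by (simp add: Int_absorb2 Int_assoc[symmetric])
      then show ?thesis using openin_Int[OF op plaque_open[OF pl that]] by (simp only:)
    qed
    show "case x of (W, \<psi>) \<Rightarrow> smooth_on (\<phi> ` (U' \<inter> W)) (\<lambda>x. \<psi> (inv_into U' \<phi> x))" if "x \<in> mfd_atlas N" for x
    proof -
      obtain W \<psi> where x: "x = (W, \<psi>)" "(W, \<psi>) \<in> mfd_atlas N" using \<open>x \<in> mfd_atlas N\<close> by (cases x) auto
      have "smooth_on (\<phi> ` (U' \<inter> W)) (\<lambda>x. \<psi> (inv_into U \<phi> x))"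
        by (rule smooth_on_subset[OF plaque_smooth_on[OF pl x(2)]]) (use sub in blast)
      then have "smooth_on (\<phi> ` (U' \<inter> W)) (\<lambda>x. \<psi> (inv_into U' \<phi> x))"
        by (rule smooth_on_cong) (use inv in auto)
      then show ?thesis using x by simp
    qed
    show "pvec N V U' \<phi> q ` V = F q" if "q \<in> U'" for q
      using plaque_image[OF pl, of q] pv[OF that] that sub by auto
    show "inj_on (pvec N V U' \<phi> q) V" if "q \<in> U'" for q
      using plaque_inj_pvec[OF pl, of q] pv[OF that] that sub by (auto simp: inj_on_def)
  qed
qed

text \<open>Integral manifolds may be modelled on different subspaces. A linear isomorphism brings their charts
  to a common model, as an atlas requires.\<close>

lemma plaque_change_model:
  fixes N :: "('a, 'k::euclidean_space) manifold" and l l' :: "'k \<Rightarrow> 'k"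
  assumes N: "smooth_manifold N" and pl: "plaque N F V U \<phi>" and V': "subspace V'"
    and l: "linear l" "linear l'" "l ` V = V'" "l' ` V' = V"
      "\<And>x. x \<in> V \<Longrightarrow> l' (l x) = x" "\<And>y. y \<in> V' \<Longrightarrow> l (l' y) = y"
  shows "plaque N F V' U (\<lambda>q. l (\<phi> q))"
proof -
  let ?p = "\<lambda>q. l (\<phi> q)"
  note V = plaque_subspace[OF pl] and inj = plaque_inj[OF pl] and model = plaque_model[OF N pl]
  have inj': "inj_on ?p U"
  proof (rule inj_onI)
    fix q q' assume "q \<in> U" "q' \<in> U" "l (\<phi> q) = l (\<phi> q')"
    then have "\<phi> q = \<phi> q'" using l(5) model by metis
    then show "q = q'" using inj_onD[OF inj] \<open>q \<in> U\<close> \<open>q' \<in> U\<close> by blast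
  qed
  have inv: "inv_into U ?p (l (\<phi> q)) = q" if "q \<in> U" for q by (rule inv_into_f_f[OF inj' that])
  have open_l: "openin (top_of_set V') (l ` T)" if T: "openin (top_of_set V) T" for T
  proof -
    have TV: "T \<subseteq> V" using openin_subset[OF T] by simp
    have "openin (top_of_set V') (V' \<inter> l' -` T)"
      by (rule continuous_openin_preimage[OF linear_continuous_on[OF l(2)[unfolded linear_conv_bounded_linear]] _ T])
        (use l(4) in auto)
    moreover have "V' \<inter> l' -` T = l ` T"
    proof
      show "V' \<inter> l' -` T \<subseteq> l ` T" using l(6) by (auto simp: image_iff) metis
      show "l ` T \<subseteq> V' \<inter> l' -` T" using TV l(3,5) by auto
    qed
    ultimately show ?thesis by simp
  qed
  have img: "?p ` S = l ` (\<phi> ` S)" for S by (simp add: image_image)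
  have opU: "openin (top_of_set V') (?p ` U)" unfolding img by (rule open_l[OF plaque_open_image[OF N pl]])
  have pv: "pvec N V' U ?p q u = pvec N V U \<phi> q (l' u)" if q: "q \<in> U" and u: "u \<in> V'" for q u
  proof
    fix f
    show "pvec N V' U ?p q u f = pvec N V U \<phi> q (l' u) f"
    proof (cases "f \<in> smooth_funs N")
      case True
      let ?h = "\<lambda>x. f (inv_into U \<phi> (proj_on V x))"
      let ?g = "\<lambda>x. l' (proj_on V' x)"
      have g: "linear ?g" using linear_compose[OF linear_proj_on[OF V'] l(2)] by (simp add: o_def)
      have qV': "l (\<phi> q) \<in> V'" using l(3) model[OF q] by blast
      have gq: "?g (l (\<phi> q)) = \<phi> q" using proj_on_ident[OF V' qV'] l(5)[OF model[OF q]] by simp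
      have mem: "\<phi> q \<in> proj_on V -` (\<phi> ` U)" using plaque_proj[OF N pl q] q by auto
      have dg: "(?g has_derivative ?g) (at (l (\<phi> q)))"
        using g by (auto intro!: bounded_linear_imp_has_derivative simp: linear_conv_bounded_linear)
      have "(?h has_derivative deriv_at ?h (\<phi> q)) (at (?g (l (\<phi> q))))"
        unfolding gq by (rule smooth_open_has_derivative[OF plaque_fun_smooth[OF N pl True] mem])
      from has_derivative_compose[OF dg this]
      have d: "((\<lambda>x. ?h (?g x)) has_derivative (\<lambda>v. deriv_at ?h (\<phi> q) (?g v))) (at (l (\<phi> q)))" .
      have "deriv_at (\<lambda>x. f (inv_into U ?p (proj_on V' x))) (l (\<phi> q)) = deriv_at (\<lambda>x. ?h (?g x)) (l (\<phi> q))"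
      proof (rule deriv_at_cong[OF d open_vimage_proj_on[OF V' opU]])
        show "l (\<phi> q) \<in> proj_on V' -` (?p ` U)" using proj_on_ident[OF V' qV'] q by auto
        fix y assume "y \<in> proj_on V' -` (?p ` U)"
        then have "proj_on V' y \<in> ?p ` U" by simp
        then obtain q' where q': "q' \<in> U" "proj_on V' y = l (\<phi> q')" by blast
        then show "?h (?g y) = f (inv_into U ?p (proj_on V' y))"
          by (simp add: inv l(5)[OF model] plaque_proj[OF N pl] plaque_inv[OF N pl])
      qed
      then have "deriv_at (\<lambda>x. f (inv_into U ?p (proj_on V' x))) (l (\<phi> q)) u = deriv_at ?h (\<phi> q) (?g u)"
        using fun_cong[OF frechet_derivative_at[OF d], of u] by simp
      then show ?thesis using proj_on_ident[OF V' u] by (simp add: pvec_def True)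
    qed (simp add: pvec_def)
  qed
  show ?thesis unfolding plaque_def
  proof (intro conjI allI impI ballI V' inj')
    show "U \<subseteq> pts N" by (rule plaque_subset[OF pl])
    show "openin (top_of_set V') (?p ` (U \<inter> G))" if "openin (mfd_top N) G" for G
      unfolding img by (rule open_l[OF plaque_open[OF pl that]])
    show "case x of (W, \<psi>) \<Rightarrow> smooth_on (?p ` (U \<inter> W)) (\<lambda>x. \<psi> (inv_into U ?p x))" if "x \<in> mfd_atlas N" for x
    proof -
      obtain W \<psi> where x: "x = (W, \<psi>)" "(W, \<psi>) \<in> mfd_atlas N" using \<open>x \<in> mfd_atlas N\<close> by (cases x) auto
      have l's: "smooth_on (?p ` (U \<inter> W)) l'"
        by (rule smooth_open_imp_smooth_on[OF smooth_open_linear[OF open_UNIV l(2)]]) simp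
      have "smooth_on (?p ` (U \<inter> W)) (\<lambda>x. \<psi> (inv_into U \<phi> (l' x)))"
        by (rule smooth_on_compose[OF l's plaque_smooth_on[OF pl x(2)]])
          (use l(5) model in auto)
      then have "smooth_on (?p ` (U \<inter> W)) (\<lambda>x. \<psi> (inv_into U ?p x))"
        by (rule smooth_on_cong) (auto simp: inv l(5)[OF model] plaque_inv[OF N pl])
      then show ?thesis using x by simp
    qed
    fix q assume q: "q \<in> U"
    have "pvec N V' U ?p q ` V' = pvec N V U \<phi> q ` (l' ` V')"
      unfolding image_image by (rule image_cong[OF refl pv[OF q]])
    then show "pvec N V' U ?p q ` V' = F q" using plaque_image[OF pl q] l(4) by simp
    show "inj_on (pvec N V' U ?p q) V'"
    proof (rule inj_onI)
      fix u w assume uw: "u \<in> V'" "w \<in> V'" "pvec N V' U ?p q u = pvec N V' U ?p q w"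
      then have "l' u = l' w" using pv[OF q] inj_onD[OF plaque_inj_pvec[OF pl q]] l(4) by (metis imageI)
      then show "u = w" using l(6) uw by metis
    qed
  qed
qed

text \<open>The right-hand side does not involve the plaque, so the models of plaques through a common point have the same dimension.\<close>

lemma plaque_dim:
  fixes N :: "('a, 'k::euclidean_space) manifold"
  assumes N: "smooth_manifold N" and pl: "plaque N F V U \<phi>" and z: "z \<in> U"
    and c: "(W, \<psi>) \<in> mfd_atlas N" "z \<in> W"
  shows "dim V = dim {u \<in> mfd_model N. tvec N W \<psi> z u \<in> F z}"
proof -
  let ?D = "deriv_at (\<lambda>x. \<psi> (inv_into U \<phi> (proj_on V x))) (\<phi> z)"
  note V = plaque_subspace[OF pl]
  have mem: "\<phi> z \<in> proj_on V -` (\<phi> ` (U \<inter> W))" using z c(2) plaque_proj[OF N pl z] by auto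
  have lin: "linear ?D"
    using smooth_open_has_derivative[OF plaque_in_chart(1)[OF N pl c(1)] mem] by (rule has_derivative_linear)
  have DV: "?D u \<in> mfd_model N" for u
    by (rule deriv_at_in_subspace[OF smooth_manifold_model[OF N] plaque_in_chart(1)[OF N pl c(1)] mem])
      (use plaque_in_chart(2)[OF N pl c(1)] chart_model[OF N c(1)] in blast)
  note eq = pvec_eq_tvec[OF N pl c(1) z c(2)]
  have inj: "inj_on ?D V"
    using plaque_inj_pvec[OF pl z] eq by (auto simp: inj_on_def)
  have "?D ` V = {u \<in> mfd_model N. tvec N W \<psi> z u \<in> F z}"
  proof
    show "?D ` V \<subseteq> {u \<in> mfd_model N. tvec N W \<psi> z u \<in> F z}"
      using DV eq plaque_image[OF pl z] by auto
    show "{u \<in> mfd_model N. tvec N W \<psi> z u \<in> F z} \<subseteq> ?D ` V"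
    proof
      fix u assume u: "u \<in> {u \<in> mfd_model N. tvec N W \<psi> z u \<in> F z}"
      then obtain v where v: "v \<in> V" "tvec N W \<psi> z u = pvec N V U \<phi> z v"
        using plaque_image[OF pl z] by blast
      then have "u = ?D v" using tvec_inject[OF N c _ DV] u eq by auto
      then show "u \<in> ?D ` V" using v(1) by blast
    qed
  qed
  moreover have "span V = V" using V by (simp only: span_eq_iff)
  then have "inj_on ?D (span V)" using inj by (simp only:)
  then have "dim (?D ` V) = dim V" by (rule dim_image_eq[OF lin])
  ultimately show ?thesis by simp
qed

lemma countable_subatlas:
  assumes S: "smooth_manifold S"
  obtains \<A> where "countable \<A>" "\<A> \<subseteq> mfd_atlas S" "(\<Union>(U, \<phi>)\<in>\<A>. U) = pts S"
proof -
  obtain \<B> where "countable \<B> \<and> (\<forall>V\<in>\<B>. openin (mfd_top S) V) \<and>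
      (\<forall>G x. openin (mfd_top S) G \<and> x \<in> G \<longrightarrow> (\<exists>b\<in>\<B>. x \<in> b \<and> b \<subseteq> G))"
    using smooth_manifold_second_countable[OF S] unfolding second_countable_def by (elim exE)
  then have B: "countable \<B>" "\<And>b. b \<in> \<B> \<Longrightarrow> openin (mfd_top S) b"
    "\<And>G x. openin (mfd_top S) G \<Longrightarrow> x \<in> G \<Longrightarrow> \<exists>b\<in>\<B>. x \<in> b \<and> b \<subseteq> G" by simp_all
  define \<B>' where "\<B>' = {b \<in> \<B>. \<exists>c\<in>mfd_atlas S. b \<subseteq> fst c}"
  have "\<forall>b\<in>\<B>'. \<exists>c\<in>mfd_atlas S. b \<subseteq> fst c" by (simp add: \<B>'_def)
  then obtain c where c: "\<And>b. b \<in> \<B>' \<Longrightarrow> c b \<in> mfd_atlas S" "\<And>b. b \<in> \<B>' \<Longrightarrow> b \<subseteq> fst (c b)" by metis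
  have 1: "countable (c ` \<B>')"
    by (rule countable_image[OF countable_subset[OF _ B(1)]]) (auto simp: \<B>'_def)
  have 2: "c ` \<B>' \<subseteq> mfd_atlas S" by (rule image_subsetI) (rule c(1))
  have "(\<Union>(U, \<phi>)\<in>c ` \<B>'. U) = pts S"
  proof
    show "(\<Union>(U, \<phi>)\<in>c ` \<B>'. U) \<subseteq> pts S"
    proof
      fix x assume "x \<in> (\<Union>(U, \<phi>)\<in>c ` \<B>'. U)"
      then obtain k where k: "k \<in> c ` \<B>'" "x \<in> (case k of (U, \<phi>) \<Rightarrow> U)" by (rule UN_E)
      obtain U \<phi> where "k = (U, \<phi>)" by (cases k)
      then show "x \<in> pts S" using chart_subset[OF S subsetD[OF 2]] k by auto
    qed
    show "pts S \<subseteq> (\<Union>(U, \<phi>)\<in>c ` \<B>'. U)"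
    proof
      fix x assume "x \<in> pts S"
      then obtain U \<phi> where U: "(U, \<phi>) \<in> mfd_atlas S" "x \<in> U" using chart_exists[OF S] by blast
      obtain b where b: "b \<in> \<B>" "x \<in> b" "b \<subseteq> U" using B(3)[OF chart_openin[OF S U(1)] U(2)] by blast
      have b': "b \<in> \<B>'"
        unfolding \<B>'_def using b U(1) by (intro CollectI conjI bexI[of _ "(U, \<phi>)"]) simp_all
      obtain U' \<phi>' where cb: "c b = (U', \<phi>')" by (cases "c b")
      have "(U', \<phi>') \<in> c ` \<B>'" using imageI[OF b', of c] cb by simp
      moreover have "x \<in> U'" using c(2)[OF b'] cb b(2) by auto
      ultimately show "x \<in> (\<Union>(U, \<phi>)\<in>c ` \<B>'. U)" by (intro UN_I[of "(U', \<phi>')"]) simp_all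
    qed
  qed
  then show ?thesis using that 1 2 by blast
qed

text \<open>This transports connectedness of integral manifolds to the leaf topology.\<close>

lemma integral_manifold_leaf_continuous:
  fixes N :: "('a, 'k::euclidean_space) manifold"
  assumes N: "smooth_manifold N" and S: "integral_manifold N F S"
  shows "continuous_map (mfd_top S) (leaf_topology N F) id"
proof -
  have SM: "smooth_manifold S" and sub: "pts S \<subseteq> pts N" using S by (auto simp: integral_manifold_def submanifold_def)
  show ?thesis unfolding continuous_map_def
  proof (intro conjI allI impI)
    show "id \<in> pts S \<rightarrow> topspace (leaf_topology N F)" using sub by (auto simp: topspace_leaf_topology)
    fix G assume "openin (leaf_topology N F) G"
    then have G: "leaf_open N F G" by (simp add: openin_leaf_topology)
    show "openin (mfd_top S) {x \<in> pts S. id x \<in> G}"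
    proof (subst openin_subopen, intro ballI)
      fix x assume x: "x \<in> {x \<in> pts S. id x \<in> G}"
      then obtain U \<phi> where c: "(U, \<phi>) \<in> mfd_atlas S" "x \<in> U" using chart_exists[OF SM] by blast
      have "openin (top_of_set (mfd_model S)) (\<phi> ` (G \<inter> U))"
        using G integral_manifold_plaque[OF N S c(1)] unfolding leaf_open_def by blast
      from chart_open_preimage[OF SM c(1) this]
      have "openin (mfd_top S) {q \<in> U. \<phi> q \<in> \<phi> ` (G \<inter> U)}" .
      moreover have "{q \<in> U. \<phi> q \<in> \<phi> ` (G \<inter> U)} = G \<inter> U" using inj_onD[OF chart_inj[OF SM c(1)]] by blast
      ultimately show "\<exists>T. openin (mfd_top S) T \<and> x \<in> T \<and> T \<subseteq> {x \<in> pts S. id x \<in> G}"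
        using x c(2) chart_subset[OF SM c(1)] by (intro exI[of _ "G \<inter> U"]) auto
    qed
  qed
qed

text \<open>Take countable atlases of both manifolds, brought to a common model. The union is connected in the leaf
  topology because \<open>z\<close> lies in both.\<close>

lemma glue_integral_manifolds:
  fixes N :: "('a, 'k::euclidean_space) manifold"
  assumes N: "smooth_manifold N" and cr: "constant_rank_distribution N F"
    and S1: "integral_manifold N F S1" "connected_space (mfd_top S1)"
    and S2: "integral_manifold N F S2" "connected_space (mfd_top S2)"
    and z: "z \<in> pts S1" "z \<in> pts S2"
  obtains S where "integral_manifold N F S" "connected_space (mfd_top S)" "pts S = pts S1 \<union> pts S2"
proof -
  have M1: "smooth_manifold S1" and M2: "smooth_manifold S2" and sub: "pts S1 \<subseteq> pts N"
    using S1 S2 by (auto simp: integral_manifold_def submanifold_def)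
  let ?V1 = "mfd_model S1" and ?V2 = "mfd_model S2"
  obtain U1 \<phi>1 where c1: "(U1, \<phi>1) \<in> mfd_atlas S1" "z \<in> U1" using chart_exists[OF M1 z(1)] by blast
  obtain U2 \<phi>2 where c2: "(U2, \<phi>2) \<in> mfd_atlas S2" "z \<in> U2" using chart_exists[OF M2 z(2)] by blast
  obtain W \<psi> where c: "(W, \<psi>) \<in> mfd_atlas N" "z \<in> W" using chart_exists[OF N] z(1) sub by blast
  have dims: "dim ?V2 = dim ?V1"
    using plaque_dim[OF N integral_manifold_plaque[OF N S1(1) c1(1)] c1(2) c]
      plaque_dim[OF N integral_manifold_plaque[OF N S2(1) c2(1)] c2(2) c] by simp
  obtain l l' :: "'k \<Rightarrow> 'k" where l: "linear l" "linear l'" "l ` ?V2 = ?V1" "l' ` ?V1 = ?V2"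
      "\<And>x. x \<in> ?V2 \<Longrightarrow> l' (l x) = x" "\<And>y. y \<in> ?V1 \<Longrightarrow> l (l' y) = y"
    using isometries_subspaces[OF smooth_manifold_model[OF M2] smooth_manifold_model[OF M1] dims] by metis
  obtain A1 where A1: "countable A1" "A1 \<subseteq> mfd_atlas S1" "(\<Union>(U, \<phi>)\<in>A1. U) = pts S1"
    using countable_subatlas[OF M1] by blast
  obtain A2 where A2: "countable A2" "A2 \<subseteq> mfd_atlas S2" "(\<Union>(U, \<phi>)\<in>A2. U) = pts S2"
    using countable_subatlas[OF M2] by blast
  define A where "A = A1 \<union> (\<lambda>(U, \<phi>). (U, \<lambda>q. l (\<phi> q))) ` A2"
  have cA: "countable A" using A1(1) A2(1) by (simp add: A_def)
  have pl: "plaque N F ?V1 U \<phi>" if in_A: "(U, \<phi>) \<in> A" for U \<phi>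
  proof (cases "(U, \<phi>) \<in> A1")
    case True then show ?thesis using A1(2) integral_manifold_plaque[OF N S1(1)] by blast
  next
    case False
    then obtain \<phi>' where p: "(U, \<phi>') \<in> A2" "\<phi> = (\<lambda>q. l (\<phi>' q))" using in_A by (auto simp: A_def)
    then have "plaque N F ?V2 U \<phi>'" using A2(2) integral_manifold_plaque[OF N S2(1)] by blast
    from plaque_change_model[OF N this smooth_manifold_model[OF M1] l] show ?thesis using p(2) by simp
  qed
  have UA: "(\<Union>(U, \<phi>)\<in>A. U) = pts S1 \<union> pts S2"
    unfolding A1(3)[symmetric] A2(3)[symmetric] A_def by (auto split: prod.splits)
  let ?S = "plaque_manifold N F ?V1 A"
  note V1 = smooth_manifold_model[OF M1]
  have int: "integral_manifold N F ?S" by (rule plaque_manifold_integral[OF N cr V1 cA pl])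
  have pts: "pts ?S = pts S1 \<union> pts S2" using pts_plaque_manifold[OF N cr V1 cA pl] UA by simp
  have conn: "connectedin (leaf_topology N F) (pts S)" if "integral_manifold N F S" "connected_space (mfd_top S)" for S :: "('a, 'k) manifold"
    using connectedin_continuous_map_image[OF integral_manifold_leaf_continuous[OF N that(1)], of "pts S"] that(2)
    by (simp add: connectedin_topspace)
  have "connectedin (leaf_topology N F) (pts S1 \<union> pts S2)"
    by (rule connectedin_Un[OF conn[OF S1] conn[OF S2]]) (use z in blast)
  then have "connected_space (mfd_top ?S)"
    by (simp add: plaque_manifold_def UA connectedin_def)
  then show ?thesis using that int pts by blast
qed

section \<open>Leaves\<close>

lemma mem_leaf_iff:
  "q \<in> leaf N F p \<longleftrightarrow> (\<exists>S. integral_manifold N F S \<and> connected_space (mfd_top S) \<and> p \<in> pts S \<and> q \<in> pts S)"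
  unfolding leaf_def by blast

text \<open>Leaves are defined by a single integral manifold through two points; by gluing, this relation is transitive.\<close>

lemma leaf_eq:
  assumes N: "smooth_manifold N" and cr: "constant_rank_distribution N F"
    and S: "integral_manifold N F S" "connected_space (mfd_top S)" "p \<in> pts S" "q \<in> pts S"
  shows "leaf N F p = leaf N F q"
proof -
  have sub: "leaf N F p \<subseteq> leaf N F q" if pq: "p \<in> pts S" "q \<in> pts S" for p q
  proof
    fix r assume "r \<in> leaf N F p"
    then obtain S' where S': "integral_manifold N F S'" "connected_space (mfd_top S')" "p \<in> pts S'" "r \<in> pts S'"
      by (auto simp: mem_leaf_iff)
    obtain S'' where "integral_manifold N F S''" "connected_space (mfd_top S'')" "pts S'' = pts S \<union> pts S'"
      using glue_integral_manifolds[OF N cr S(1,2) S'(1,2) pq(1) S'(3)] by blast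
    then show "r \<in> leaf N F q" using pq S'(4) by (auto simp: mem_leaf_iff)
  qed
  then show ?thesis using S(3,4) by blast
qed

text \<open>Restrict a chart of an integral manifold to the preimage of a ball around \<open>p\<close>, which is connected.\<close>

lemma small_plaque:
  fixes N :: "('a, 'k::euclidean_space) manifold"
  assumes N: "smooth_manifold N" and cr: "constant_rank_distribution N F"
    and int: "integrable_distribution N F" and p: "p \<in> pts N"
  obtains V U \<phi> S where "plaque N F V U \<phi>" "p \<in> U" "integral_manifold N F S" "connected_space (mfd_top S)" "pts S = U"
proof -
  obtain S0 where S0: "integral_manifold N F S0" "p \<in> pts S0" using int p unfolding integrable_distribution_def by blast
  have M0: "smooth_manifold S0" using S0 by (simp add: integral_manifold_def submanifold_def)
  obtain U0 \<phi> where c: "(U0, \<phi>) \<in> mfd_atlas S0" "p \<in> U0" using chart_exists[OF M0 S0(2)] by blast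
  let ?V = "mfd_model S0"
  note V = smooth_manifold_model[OF M0]
  have p0: "plaque N F ?V U0 \<phi>" by (rule integral_manifold_plaque[OF N S0(1) c(1)])
  obtain T where T: "open T" "\<phi> ` U0 = ?V \<inter> T" using chart_image_openin[OF M0 c(1)] by (auto simp: openin_open)
  have "\<phi> p \<in> T" using T(2) c(2) by blast
  then obtain e where e: "e > 0" "ball (\<phi> p) e \<subseteq> T" using T(1) open_contains_ball by blast
  define U where "U = {q \<in> U0. \<phi> q \<in> ball (\<phi> p) e}"
  have img: "\<phi> ` U = ?V \<inter> ball (\<phi> p) e"
  proof
    show "\<phi> ` U \<subseteq> ?V \<inter> ball (\<phi> p) e" using chart_model[OF M0 c(1)] by (auto simp: U_def)
    show "?V \<inter> ball (\<phi> p) e \<subseteq> \<phi> ` U"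
    proof
      fix y assume y: "y \<in> ?V \<inter> ball (\<phi> p) e"
      then have "y \<in> \<phi> ` U0" using T(2) e(2) by blast
      then show "y \<in> \<phi> ` U" using y by (auto simp: U_def)
    qed
  qed
  have pU: "plaque N F ?V U \<phi>"
    by (rule plaque_restrict[OF N p0]) (auto simp: U_def[symmetric] img openin_open_Int, auto simp: U_def)
  let ?A = "{(U, \<phi>)}"
  have pl: "plaque N F ?V U' \<phi>'" if "(U', \<phi>') \<in> ?A" for U' \<phi>' using that pU by simp
  let ?S = "plaque_manifold N F ?V ?A"
  have cA: "countable ?A" by simp
  have int: "integral_manifold N F ?S" by (rule plaque_manifold_integral[OF N cr V cA pl])
  have pts: "pts ?S = U" using pts_plaque_manifold[OF N cr V cA pl] by simp
  have M: "smooth_manifold ?S" by (rule smooth_plaque_manifold[OF N cr V cA pl])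
  have c': "(U, \<phi>) \<in> mfd_atlas ?S" by (simp add: plaque_manifold_def)
  have "connected (\<phi> ` U)" unfolding img
    by (intro convex_connected convex_Int convex_ball subspace_imp_convex V)
  then have "connectedin (top_of_set (\<phi> ` U)) (\<phi> ` U)"
    by (simp add: connectedin_subtopology)
  from connectedin_continuous_map_image[OF chart_inv_continuous[OF M c'] this]
  have "connectedin (subtopology (mfd_top ?S) U) (inv_into U \<phi> ` (\<phi> ` U))" .
  moreover have "inv_into U \<phi> ` (\<phi> ` U) = U" using chart_inv[OF M c'] by (force simp: image_image)
  ultimately have "connectedin (mfd_top ?S) U" by (simp add: connectedin_subtopology)
  then have "connected_space (mfd_top ?S)" using pts by (metis connectedin_topspace)
  moreover have "p \<in> U" using c(2) e(1) by (simp add: U_def)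
  ultimately show ?thesis using that[OF pU _ int _ pts] by blast
qed

lemma leaf_self:
  assumes "smooth_manifold N" "constant_rank_distribution N F" "integrable_distribution N F" "p \<in> pts N"
  shows "p \<in> leaf N F p"
  using small_plaque[OF assms] unfolding mem_leaf_iff by metis

text \<open>A small plaque around \<open>p\<close> lies in a single leaf, so \<open>f\<close> is constant on it, and \<open>F p\<close> consists of
  derivatives along the plaque.\<close>

lemma distribution_kills_leafwise_constant:
  fixes N :: "('a, 'k::euclidean_space) manifold"
  assumes N: "smooth_manifold N" and cr: "constant_rank_distribution N F" and int: "integrable_distribution N F"
    and p: "p \<in> pts N" and v: "v \<in> F p" and f: "f \<in> smooth_funs N"
    and const: "\<And>q. q \<in> pts N \<Longrightarrow> leaf N F q = leaf N F p \<Longrightarrow> f q = f p"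
  shows "v f = 0"
proof -
  obtain V U \<phi> S where pl: "plaque N F V U \<phi>" "p \<in> U"
    and S: "integral_manifold N F S" "connected_space (mfd_top S)" "pts S = U"
    using small_plaque[OF N cr int p] by metis
  obtain u where "v = pvec N V U \<phi> p u" using plaque_image[OF pl] v by blast
  then have v: "v f = deriv_at (\<lambda>x. f (inv_into U \<phi> (proj_on V x))) (\<phi> p) u" using f by (simp add: pvec_def)
  have "deriv_at (\<lambda>x. f (inv_into U \<phi> (proj_on V x))) (\<phi> p) = deriv_at (\<lambda>x. f p) (\<phi> p)"
  proof (rule deriv_at_cong[OF has_derivative_const open_vimage_proj_on[OF plaque_subspace[OF pl(1)] plaque_open_image[OF N pl(1)]]])
    show "\<phi> p \<in> proj_on V -` (\<phi> ` U)" using plaque_proj[OF N pl] pl(2) by auto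
    fix y assume "y \<in> proj_on V -` (\<phi> ` U)"
    then have "proj_on V y \<in> \<phi> ` U" by simp
    then obtain q where q: "q \<in> U" "proj_on V y = \<phi> q" by blast
    have "leaf N F q = leaf N F p" by (rule leaf_eq[OF N cr S(1,2)]) (use S(3) q pl(2) in auto)
    then show "f p = f (inv_into U \<phi> (proj_on V y))"
      using const[of q] q plaque_inv[OF N pl(1)] plaque_subset[OF pl(1)] by auto
  qed
  then show ?thesis by (simp add: v)
qed

text \<open>On an integral manifold the derivative of \<open>f\<close> vanishes, so \<open>f\<close> is locally constant; a leaf is covered by
  connected integral manifolds.\<close>

lemma killed_by_distribution_leafwise_constant:
  fixes N :: "('a, 'k::euclidean_space) manifold"
  assumes N: "smooth_manifold N" and f: "f \<in> smooth_funs N"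
    and kill: "\<And>p v. p \<in> pts N \<Longrightarrow> v \<in> F p \<Longrightarrow> v f = 0"
    and q: "q \<in> leaf N F p"
  shows "f q = f p"
proof -
  obtain S where S: "integral_manifold N F S" "connected_space (mfd_top S)" "p \<in> pts S" "q \<in> pts S"
    using q by (auto simp: mem_leaf_iff)
  have M: "smooth_manifold S" and sub: "pts S \<subseteq> pts N" using S(1) by (auto simp: integral_manifold_def submanifold_def)
  let ?V = "mfd_model S"
  note V = smooth_manifold_model[OF M]
  have loc: "\<exists>T. openin (mfd_top S) T \<and> x \<in> T \<and> T \<subseteq> pts S \<and> (\<forall>y\<in>T. f y = f x)" if x: "x \<in> pts S" for x
  proof -
    obtain U \<phi> where c: "(U, \<phi>) \<in> mfd_atlas S" "x \<in> U" using chart_exists[OF M x] by blast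
    note pl = integral_manifold_plaque[OF N S(1) c(1)]
    let ?h = "\<lambda>x. f (inv_into U \<phi> (proj_on ?V x))"
    obtain G where G: "open G" "\<phi> ` U = ?V \<inter> G" using chart_image_openin[OF M c(1)] by (auto simp: openin_open)
    have "\<phi> x \<in> G" using G(2) c(2) by blast
    then obtain e where e: "e > 0" "ball (\<phi> x) e \<subseteq> G" using G(1) open_contains_ball by blast
    let ?B = "?V \<inter> ball (\<phi> x) e"
    have "(?h has_derivative (\<lambda>h. 0)) (at y within ?B)" if y: "y \<in> ?B" for y
    proof -
      have "y \<in> \<phi> ` U" using y G(2) e(2) by blast
      then obtain q where q: "q \<in> U" "y = \<phi> q" by blast
      have mem: "\<phi> q \<in> proj_on ?V -` (\<phi> ` U)" using q plaque_proj[OF N pl q(1)] by auto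
      have "deriv_at ?h (\<phi> q) u = 0" for u
      proof -
        have "pvec N ?V U \<phi> q (proj_on ?V u) \<in> F q" using plaque_image[OF pl q(1)] proj_on_in[OF V] by blast
        then have "pvec N ?V U \<phi> q u f = 0"
          using kill[of q] plaque_subset[OF pl] q(1) pvec_proj[OF N pl q(1)] by auto
        then show ?thesis using f by (simp add: pvec_def)
      qed
      then have "deriv_at ?h (\<phi> q) = (\<lambda>h. 0)" by blast
      then show ?thesis using smooth_open_has_derivative[OF plaque_fun_smooth[OF N pl f] mem] q(2)
        by (auto intro: has_derivative_at_withinI)
    qed
    then obtain k where k: "\<And>y. y \<in> ?B \<Longrightarrow> ?h y = k"
      using has_derivative_zero_constant[of ?B ?h] V
      by (metis (no_types, lifting) convex_Int convex_ball subspace_imp_convex)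
    let ?T = "{q \<in> U. \<phi> q \<in> ?B}"
    have "f y = k" if "y \<in> ?T" for y
    proof -
      have y: "y \<in> U" "\<phi> y \<in> ?B" using that by auto
      show ?thesis using k[OF y(2)] by (simp add: chart_proj[OF M c(1) y(1)] chart_inv[OF M c(1) y(1)])
    qed
    moreover have xT: "x \<in> ?T" using c(2) e(1) chart_model[OF M c] by simp
    moreover have "openin (mfd_top S) ?T" by (rule chart_open_preimage[OF M c(1)]) (simp add: openin_open_Int)
    moreover have "?T \<subseteq> pts S" using chart_subset[OF M c(1)] by blast
    ultimately show ?thesis by (intro exI[of _ ?T]) simp
  qed
  let ?E1 = "{x \<in> pts S. f x = f p}" and ?E2 = "{x \<in> pts S. f x \<noteq> f p}"
  have o1: "openin (mfd_top S) ?E1"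
  proof (subst openin_subopen, intro ballI)
    fix x assume x: "x \<in> ?E1"
    then have "x \<in> pts S" by simp
    from loc[OF this] obtain T where T: "openin (mfd_top S) T" "x \<in> T" "T \<subseteq> pts S" "\<forall>y\<in>T. f y = f x"
      by (elim exE conjE)
    have "T \<subseteq> ?E1"
    proof
      fix y assume y: "y \<in> T"
      have "f y = f x" by (rule bspec[OF T(4) y])
      then show "y \<in> ?E1" using x subsetD[OF T(3) y] by simp
    qed
    then show "\<exists>T. openin (mfd_top S) T \<and> x \<in> T \<and> T \<subseteq> ?E1" by (intro exI[of _ T] conjI T(1,2))
  qed
  have o2: "openin (mfd_top S) ?E2"
  proof (subst openin_subopen, intro ballI)
    fix x assume x: "x \<in> ?E2"
    then have "x \<in> pts S" by simp
    from loc[OF this] obtain T where T: "openin (mfd_top S) T" "x \<in> T" "T \<subseteq> pts S" "\<forall>y\<in>T. f y = f x"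
      by (elim exE conjE)
    have "T \<subseteq> ?E2"
    proof
      fix y assume y: "y \<in> T"
      have "f y = f x" by (rule bspec[OF T(4) y])
      then show "y \<in> ?E2" using x subsetD[OF T(3) y] by simp
    qed
    then show "\<exists>T. openin (mfd_top S) T \<and> x \<in> T \<and> T \<subseteq> ?E2" by (intro exI[of _ T] conjI T(1,2))
  qed
  have un: "?E1 \<union> ?E2 = pts S" and disj: "?E1 \<inter> ?E2 = {}" by auto
  have ne1: "?E1 \<noteq> {}" using S(3) by blast
  show ?thesis
  proof (rule ccontr)
    assume "f q \<noteq> f p"
    then have ne2: "?E2 \<noteq> {}" using S(4) by blast
    have "\<exists>E1 E2. openin (mfd_top S) E1 \<and> openin (mfd_top S) E2 \<and> E1 \<union> E2 = pts S \<and>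
        E1 \<inter> E2 = {} \<and> E1 \<noteq> {} \<and> E2 \<noteq> {}"
      by (intro exI[of _ ?E1] exI[of _ ?E2] conjI o1 o2 un disj ne1 ne2)
    then show False using S(2) unfolding connected_space_eq by (rule notE[rotated])
  qed
qed

section \<open>Descent along a submersion\<close>

text \<open>Near each point, \<open>g\<close> is the composition of \<open>h\<close> with a smooth local section of \<open>\<pi>\<close>.\<close>

lemma submersion_descent:
  fixes N :: "('a, 'k::euclidean_space) manifold" and Q :: "('b, 'q::euclidean_space) manifold"
  assumes N: "smooth_manifold N" and Q: "smooth_manifold Q" and sub: "submersion N Q \<pi>"
    and onto: "\<pi> ` pts N = pts Q" and h: "h \<in> smooth_funs N"
    and g: "\<And>q. q \<in> pts N \<Longrightarrow> g (\<pi> q) = h q" and g0: "\<And>y. y \<notin> pts Q \<Longrightarrow> g y = 0"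
  shows "g \<in> smooth_funs Q"
  unfolding smooth_funs_iff
proof (intro conjI allI impI g0 smooth_fun_on_local[OF Q])
  have sm: "smooth_map N Q \<pi>"
    and surj: "\<And>p. p \<in> pts N \<Longrightarrow> pushforward N Q \<pi> ` tangent_space N p = tangent_space Q (\<pi> p)"
    using sub by (auto simp: submersion_def)
  fix y assume "y \<in> pts Q"
  then obtain p where p: "p \<in> pts N" "y = \<pi> p" using onto by blast
  obtain U \<phi> where c: "(U, \<phi>) \<in> mfd_atlas N" "p \<in> U" using chart_exists[OF N p(1)] by blast
  obtain W \<psi> where d: "(W, \<psi>) \<in> mfd_atlas Q" "y \<in> W" using chart_exists[OF Q \<open>y \<in> pts Q\<close>] by blast
  let ?V = "mfd_model N" and ?A = "mfd_model Q" and ?O = "chart_vimage N \<phi> (U \<inter> \<pi> -` W)"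
  let ?f = "in_chart N U \<phi> (\<lambda>q. \<psi> (\<pi> q))"
  note V = smooth_manifold_model[OF N] and A = smooth_manifold_model[OF Q]
  have f: "smooth_open ?O ?f" by (rule smooth_map_chart(2)[OF N Q sm c(1) d(1)])
  have inO: "\<exists>q. q \<in> U \<and> \<pi> q \<in> W \<and> proj_on ?V x = \<phi> q \<and> ?f x = \<psi> (\<pi> q)" if x: "x \<in> ?O" for x
  proof -
    have "proj_on ?V x \<in> \<phi> ` (U \<inter> \<pi> -` W)" using x by simp
    then obtain q where "q \<in> U" "\<pi> q \<in> W" "proj_on ?V x = \<phi> q" by blast
    then show ?thesis by (intro exI[of _ q]) (simp add: chart_inv[OF N c(1)])
  qed
  have fA: "?f x \<in> ?A" if x: "x \<in> ?O" for x using inO[OF x] chart_model[OF Q d(1)] by auto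
  have mem: "\<phi> p \<in> ?O" using chart_in_vimage[OF N c] c(2) d(2) p(2) by blast
  have fp: "?f (\<phi> p) = \<psi> y" by (simp add: chart_proj[OF N c] chart_inv[OF N c] p(2))
  have onto_A: "?A \<subseteq> deriv_at ?f (\<phi> p) ` ?V"
  proof
    fix a assume a: "a \<in> ?A"
    have dW: "\<pi> p \<in> W" using d(2) p(2) by simp
    have "tvec Q W \<psi> (\<pi> p) a \<in> tangent_space Q (\<pi> p)" by (rule tvec_in_tangent_space[OF Q d(1) dW])
    then obtain v where v: "v \<in> tangent_space N p" "tvec Q W \<psi> (\<pi> p) a = pushforward N Q \<pi> v"
      using surj[OF p(1)] by blast
    then obtain u where u: "u \<in> ?V" "v = tvec N U \<phi> p u" using tangent_space_chart[OF N c] by blast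
    have "deriv_at ?f (\<phi> p) u \<in> ?A" by (rule deriv_at_in_subspace[OF A f mem fA])
    moreover have "tvec Q W \<psi> (\<pi> p) a = tvec Q W \<psi> (\<pi> p) (deriv_at ?f (\<phi> p) u)"
      using v(2) pushforward_tvec[OF N Q sm c(1) d(1) c(2) dW, of u] u(2) by simp
    ultimately have "a = deriv_at ?f (\<phi> p) u" using tvec_inject[OF Q d(1) dW a] by blast
    then show "a \<in> deriv_at ?f (\<phi> p) ` ?V" using u(1) by blast
  qed
  have fA': "\<And>x. x \<in> ?O \<Longrightarrow> x \<in> ?V \<Longrightarrow> ?f x \<in> ?A" by (rule fA)
  obtain B s where s: "?f (\<phi> p) \<in> B" "smooth_open B s" "s (?f (\<phi> p)) = \<phi> p"
    "\<And>b. b \<in> B \<Longrightarrow> s b \<in> ?O \<and> s b \<in> ?V" "\<And>b. b \<in> B \<Longrightarrow> b \<in> ?A \<Longrightarrow> ?f (s b) = b"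
    using smooth_section[OF V A f mem chart_model[OF N c] fA' onto_A] by blast
  let ?T = "{y \<in> W. \<psi> y \<in> ?A \<inter> B}"
  have oT: "openin (mfd_top Q) ?T"
    by (rule chart_open_preimage[OF Q d(1)]) (simp add: openin_open_Int smooth_open_imp_open[OF s(2)])
  have yT: "y \<in> ?T" using d(2) chart_model[OF Q d] s(1) unfolding fp by simp
  have OU: "?O \<subseteq> chart_vimage N \<phi> U" by (intro vimage_mono image_mono) simp
  have sU: "s ` B \<subseteq> chart_vimage N \<phi> U"
    by (rule image_subsetI) (rule subsetD[OF OU conjunct1[OF s(4)]])
  have "smooth_open B (\<lambda>b. in_chart N U \<phi> h (s b))"
    by (rule smooth_open_compose[OF s(2) in_chart_smooth_funs[OF N c(1) h] sU])
  then have "smooth_on (\<psi> ` (?T \<inter> pts Q)) (\<lambda>b. in_chart N U \<phi> h (s b))"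
    by (rule smooth_open_imp_smooth_on) auto
  then have "smooth_on (\<psi> ` (?T \<inter> pts Q)) (\<lambda>b. g (inv_into W \<psi> b))"
  proof (rule smooth_on_cong)
    fix b assume "b \<in> \<psi> ` (?T \<inter> pts Q)"
    then obtain x where x: "x \<in> W" "\<psi> x \<in> ?A" "\<psi> x \<in> B" "b = \<psi> x" by blast
    have bB: "b \<in> B" "b \<in> ?A" using x by auto
    obtain q where q: "q \<in> U" "\<pi> q \<in> W" "proj_on ?V (s b) = \<phi> q" "?f (s b) = \<psi> (\<pi> q)"
      using inO[of "s b"] s(4)[OF bB(1)] by blast
    have "\<psi> (\<pi> q) = \<psi> x" using s(5)[OF bB] q(4) x(4) by simp
    then have "\<pi> q = x" using inj_onD[OF chart_inj[OF Q d(1)]] q(2) x(1) by blast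
    moreover have "q \<in> pts N" using q(1) chart_subset[OF N c(1)] by blast
    ultimately have "g x = h q" using g[of q] by simp
    moreover have "in_chart N U \<phi> h (s b) = h q" by (simp only: q(3) chart_inv[OF N c(1) q(1)])
    moreover have "g (inv_into W \<psi> b) = g x" by (simp only: x(4) chart_inv[OF Q d(1) x(1)])
    ultimately show "in_chart N U \<phi> h (s b) = g (inv_into W \<psi> b)" by simp
  qed
  then show "\<exists>U \<phi> T. (U, \<phi>) \<in> mfd_atlas Q \<and> y \<in> T \<and> openin (mfd_top Q) T \<and> T \<subseteq> U \<and>
      smooth_on (\<phi> ` (T \<inter> pts Q)) (\<lambda>x. g (inv_into U \<phi> x))"
    using d(1) yT oT by (intro exI[of _ W] exI[of _ \<psi>] exI[of _ ?T] conjI) auto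
qed

section \<open>The Nambu tensor\<close>

lemma differential_in_cotangent_space:
  assumes "smooth_manifold M" "p \<in> pts M"
  shows "differential M p f \<in> cotangent_space M p"
  unfolding cotangent_space_def differential_def using tangent_space_lincomb[OF assms] by simp

lemma wedge_lincomb:
  assumes lin: "\<And>\<alpha>. \<alpha> \<in> set \<alpha>s \<Longrightarrow> \<alpha> x = a * \<alpha> u + b * \<alpha> v"
    and len: "length ws = length \<alpha>s" and i: "i < length \<alpha>s"
  shows "wedge \<alpha>s (ws[i := x]) = a * wedge \<alpha>s (ws[i := u]) + b * wedge \<alpha>s (ws[i := v])"
proof -
  let ?k = "length \<alpha>s"
  let ?t = "\<lambda>\<sigma> x. \<Prod>j<?k. (\<alpha>s ! j) (ws[i := x] ! \<sigma> j)"
  have split: "?t \<sigma> x = a * ?t \<sigma> u + b * ?t \<sigma> v" if s: "\<sigma> permutes {..<?k}" for \<sigma>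
  proof -
    obtain j where j: "j < ?k" "\<sigma> j = i" using permutes_image[OF s] i by (metis imageE lessThan_iff)
    have r: "?t \<sigma> y = (\<alpha>s ! j) y * (\<Prod>l\<in>{..<?k} - {j}. (\<alpha>s ! l) (ws ! \<sigma> l))" for y
    proof -
      have "?t \<sigma> y = (\<alpha>s ! j) (ws[i := y] ! \<sigma> j) * (\<Prod>l\<in>{..<?k} - {j}. (\<alpha>s ! l) (ws[i := y] ! \<sigma> l))"
        using j(1) by (intro prod.remove) auto
      also have "(\<Prod>l\<in>{..<?k} - {j}. (\<alpha>s ! l) (ws[i := y] ! \<sigma> l)) = (\<Prod>l\<in>{..<?k} - {j}. (\<alpha>s ! l) (ws ! \<sigma> l))"
      proof (rule prod.cong[OF refl])
        fix l assume "l \<in> {..<?k} - {j}"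
        then have "\<sigma> l \<noteq> i" using j(2) inj_onD[OF permutes_inj_on[OF s, of UNIV], of l j] by auto
        then show "(\<alpha>s ! l) (ws[i := y] ! \<sigma> l) = (\<alpha>s ! l) (ws ! \<sigma> l)" by simp
      qed
      finally show ?thesis using j(2) i len by simp
    qed
    have "(\<alpha>s ! j) x = a * (\<alpha>s ! j) u + b * (\<alpha>s ! j) v" by (rule lin) (simp add: j(1))
    then show ?thesis unfolding r by (simp add: algebra_simps)
  qed
  have "(\<Sum>\<sigma> | \<sigma> permutes {..<?k}. of_int (sign \<sigma>) * ?t \<sigma> x) =
      (\<Sum>\<sigma> | \<sigma> permutes {..<?k}. a * (of_int (sign \<sigma>) * ?t \<sigma> u) + b * (of_int (sign \<sigma>) * ?t \<sigma> v))"
    by (rule sum.cong[OF refl]) (simp add: split algebra_simps)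
  then show ?thesis using len by (simp add: wedge_def sum.distrib sum_distrib_left)
qed

text \<open>Composing permutations with the transposition of \<open>i\<close> and \<open>j\<close> changes the sign of each summand and nothing else.\<close>

lemma wedge_alternating:
  assumes len: "length ws = length \<alpha>s" and ij: "i < j" "j < length \<alpha>s" and eq: "ws ! i = ws ! j"
  shows "wedge \<alpha>s ws = 0"
proof -
  let ?k = "length \<alpha>s" and ?\<tau> = "Transposition.transpose i j"
  let ?g = "\<lambda>\<sigma>. of_int (sign \<sigma>) * (\<Prod>l<?k. (\<alpha>s ! l) (ws ! \<sigma> l)) :: real"
  have \<tau>: "?\<tau> permutes {..<?k}" using ij by (intro permutes_swap_id) auto
  have neg: "?g (?\<tau> \<circ> \<sigma>) = - ?g \<sigma>" if s: "\<sigma> permutes {..<?k}" for \<sigma>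
  proof -
    have "sign (?\<tau> \<circ> \<sigma>) = - sign \<sigma>"
      using sign_compose[of ?\<tau> \<sigma>] permutes_imp_permutation[OF _ s] permutes_imp_permutation[OF _ \<tau>] ij
      by (simp add: sign_swap_id)
    moreover have "ws ! ?\<tau> l = ws ! l" for l using eq by (simp add: Transposition.transpose_def)
    ultimately show ?thesis by simp
  qed
  have "(\<Sum>\<sigma> | \<sigma> permutes {..<?k}. ?g \<sigma>) = (\<Sum>\<sigma> | \<sigma> permutes {..<?k}. ?g (?\<tau> \<circ> \<sigma>))"
    by (rule sum.reindex_bij_witness[of _ "\<lambda>\<sigma>. ?\<tau> \<circ> \<sigma>" "\<lambda>\<sigma>. ?\<tau> \<circ> \<sigma>"])
      (auto simp: comp_assoc[symmetric] intro: permutes_compose[OF _ \<tau>])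
  also have "\<dots> = - (\<Sum>\<sigma> | \<sigma> permutes {..<?k}. ?g \<sigma>)"
    by (simp only: sum_negf[symmetric]) (rule sum.cong[OF refl], rule neg, simp)
  finally show ?thesis using len by (simp add: wedge_def)
qed

lemma wedge_zero:
  assumes "w \<in> set ws" and zero: "\<And>\<alpha>. \<alpha> \<in> set \<alpha>s \<Longrightarrow> \<alpha> w = 0"
  shows "wedge \<alpha>s ws = 0"
proof (cases "length ws = length \<alpha>s")
  case True
  obtain i where i: "i < length \<alpha>s" "ws ! i = w" using assms(1) True by (metis in_set_conv_nth)
  have "(\<Prod>l<length \<alpha>s. (\<alpha>s ! l) (ws ! \<sigma> l)) = 0" if s: "\<sigma> permutes {..<length \<alpha>s}" for \<sigma>
  proof -
    obtain j where j: "j < length \<alpha>s" "\<sigma> j = i" using permutes_image[OF s] i(1) by (metis imageE lessThan_iff)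
    then have "(\<alpha>s ! j) (ws ! \<sigma> j) = 0" using zero[of "\<alpha>s ! j"] i(2) by simp
    then show ?thesis using j(1) by (intro prod_zero) auto
  qed
  note zero_prod = this
  have "(\<Sum>\<sigma> | \<sigma> permutes {..<length \<alpha>s}. of_int (sign \<sigma>) * (\<Prod>l<length \<alpha>s. (\<alpha>s ! l) (ws ! \<sigma> l))) = 0"
    by (intro sum.neutral ballI) (simp only: zero_prod mem_Collect_eq mult_zero_right)
  then show ?thesis using True by (simp only: wedge_def if_cancel)
qed (simp add: wedge_def)

lemma wedge_in_ann_forms:
  assumes cot: "set \<alpha>s \<subseteq> cotangent_space M p"
    and kill: "\<And>\<alpha> v. \<alpha> \<in> set \<alpha>s \<Longrightarrow> v \<in> E p \<Longrightarrow> \<alpha> v = 0"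
  shows "wedge \<alpha>s \<in> ann_forms M (length \<alpha>s) E p"
proof -
  have lin: "\<alpha> (\<lambda>f. a * u f + b * v f) = a * \<alpha> u + b * \<alpha> v"
    if "\<alpha> \<in> set \<alpha>s" "u \<in> tangent_space M p" "v \<in> tangent_space M p" for \<alpha> u v a b
  proof -
    have "\<alpha> \<in> cotangent_space M p" using that(1) cot by blast
    then show ?thesis using that(2,3) unfolding cotangent_space_def by simp
  qed
  have out: "\<alpha> w = 0" if "\<alpha> \<in> set \<alpha>s" "w \<notin> tangent_space M p" for \<alpha> w
  proof -
    have "\<alpha> \<in> cotangent_space M p" using that(1) cot by blast
    then show ?thesis using that(2) unfolding cotangent_space_def by simp
  qed
  have "wedge \<alpha>s \<in> alt_forms M (length \<alpha>s) p"
    unfolding alt_forms_def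
  proof (rule CollectI, intro conjI allI impI)
    fix ws i u v a b
    assume *: "length ws = length \<alpha>s \<and> set ws \<subseteq> tangent_space M p \<and> i < length \<alpha>s \<and>
        u \<in> tangent_space M p \<and> v \<in> tangent_space M p"
    show "wedge \<alpha>s (ws[i := \<lambda>f. a * u f + b * v f]) = a * wedge \<alpha>s (ws[i := u]) + b * wedge \<alpha>s (ws[i := v])"
      by (rule wedge_lincomb) (use * lin in simp_all)
  next
    fix ws i j
    assume "length ws = length \<alpha>s \<and> set ws \<subseteq> tangent_space M p \<and> i < j \<and> j < length \<alpha>s \<and> ws ! i = ws ! j"
    then show "wedge \<alpha>s ws = 0" using wedge_alternating by blast
  next
    fix ws assume *: "\<not> (length ws = length \<alpha>s \<and> set ws \<subseteq> tangent_space M p)"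
    show "wedge \<alpha>s ws = 0"
    proof (cases "length ws = length \<alpha>s")
      case True
      then obtain w where "w \<in> set ws" "w \<notin> tangent_space M p" using * by blast
      then show ?thesis using wedge_zero out by blast
    qed (simp add: wedge_def)
  qed
  moreover have "interior_product v (wedge \<alpha>s) = (\<lambda>_. 0)" if v: "v \<in> E p" for v
  proof
    fix ws
    have "wedge \<alpha>s (v # ws) = 0" by (rule wedge_zero[of v]) (use kill v in simp_all)
    then show "interior_product v (wedge \<alpha>s) ws = 0" by (simp add: interior_product_def)
  qed
  ultimately show ?thesis by (simp add: ann_forms_def)
qed

lemma
  assumes "nambu_poisson_bracket n M br"
  shows nambu_lincomb: "\<And>fs i g h a b. length fs = n \<Longrightarrow> set fs \<subseteq> smooth_funs M \<Longrightarrow> i < n \<Longrightarrow>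
        g \<in> smooth_funs M \<Longrightarrow> h \<in> smooth_funs M \<Longrightarrow>
        br (fs[i := \<lambda>x. a * g x + b * h x]) = (\<lambda>x. a * br (fs[i := g]) x + b * br (fs[i := h]) x)"
    and nambu_skew: "\<And>fs i j. length fs = n \<Longrightarrow> set fs \<subseteq> smooth_funs M \<Longrightarrow> i < j \<Longrightarrow> j < n \<Longrightarrow>
        br (fs[i := fs ! j, j := fs ! i]) = (\<lambda>x. - br fs x)"
    and nambu_Leibniz: "\<And>fs g h. Suc (length fs) = n \<Longrightarrow> set fs \<subseteq> smooth_funs M \<Longrightarrow>
        g \<in> smooth_funs M \<Longrightarrow> h \<in> smooth_funs M \<Longrightarrow>
        br (fs @ [\<lambda>x. g x * h x]) = (\<lambda>x. g x * br (fs @ [h]) x + br (fs @ [g]) x * h x)"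
    and nambu_fundamental: "\<And>gs fs. Suc (length gs) = n \<Longrightarrow> set gs \<subseteq> smooth_funs M \<Longrightarrow>
        length fs = n \<Longrightarrow> set fs \<subseteq> smooth_funs M \<Longrightarrow>
        br (gs @ [br fs]) = (\<lambda>x. \<Sum>k<n. br (fs[k := br (gs @ [fs ! k])]) x)"
proof -
  note * = assms[unfolded nambu_poisson_bracket_def]
  note * = conjunct2[OF *]
  note 2 = conjunct1[OF *] and * = conjunct2[OF *]
  show "\<And>fs i g h a b. length fs = n \<Longrightarrow> set fs \<subseteq> smooth_funs M \<Longrightarrow> i < n \<Longrightarrow>
        g \<in> smooth_funs M \<Longrightarrow> h \<in> smooth_funs M \<Longrightarrow>
        br (fs[i := \<lambda>x. a * g x + b * h x]) = (\<lambda>x. a * br (fs[i := g]) x + b * br (fs[i := h]) x)"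
    by (rule 2[rule_format]) (intro conjI)
  note 3 = conjunct1[OF *] and * = conjunct2[OF *]
  show "\<And>fs i j. length fs = n \<Longrightarrow> set fs \<subseteq> smooth_funs M \<Longrightarrow> i < j \<Longrightarrow> j < n \<Longrightarrow>
        br (fs[i := fs ! j, j := fs ! i]) = (\<lambda>x. - br fs x)"
    by (rule 3[rule_format]) (intro conjI)
  note 4 = conjunct1[OF *] and * = conjunct2[OF *]
  show "\<And>fs g h. Suc (length fs) = n \<Longrightarrow> set fs \<subseteq> smooth_funs M \<Longrightarrow>
        g \<in> smooth_funs M \<Longrightarrow> h \<in> smooth_funs M \<Longrightarrow>
        br (fs @ [\<lambda>x. g x * h x]) = (\<lambda>x. g x * br (fs @ [h]) x + br (fs @ [g]) x * h x)"
    by (rule 4[rule_format]) (intro conjI)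
  show "\<And>gs fs. Suc (length gs) = n \<Longrightarrow> set gs \<subseteq> smooth_funs M \<Longrightarrow>
        length fs = n \<Longrightarrow> set fs \<subseteq> smooth_funs M \<Longrightarrow>
        br (gs @ [br fs]) = (\<lambda>x. \<Sum>k<n. br (fs[k := br (gs @ [fs ! k])]) x)"
    by (rule *[rule_format]) (intro conjI)
qed

text \<open>By skew-symmetry, every slot of the bracket behaves like the last one.\<close>

lemma nambu_slot:
  assumes br: "nambu_poisson_bracket n M br" and len: "length fs = n" and fs: "set fs \<subseteq> smooth_funs M" and i: "i < n"
  shows "\<exists>gs c. Suc (length gs) = n \<and> set gs \<subseteq> set fs \<and>
    (\<forall>x\<in>smooth_funs M. \<forall>p. br (fs[i := x]) p = c * br (gs @ [x]) p)"
proof (cases "i = n - 1")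
  case True
  have "fs[i := x] = butlast fs @ [x]" for x
    using True len i by (intro nth_equalityI) (auto simp: nth_append nth_butlast nth_list_update)
  then show ?thesis using len i
    by (intro exI[of _ "butlast fs"] exI[of _ 1]) (auto dest: in_set_butlastD)
next
  case False
  define gs where "gs = butlast (fs[i := fs ! (n - 1)])"
  have ij: "i < n - 1" "n - 1 < n" using False i by auto
  have "br (fs[i := x]) p = (-1) * br (gs @ [x]) p" if x: "x \<in> smooth_funs M" for x p
  proof -
    have s: "set (fs[i := x]) \<subseteq> smooth_funs M" using set_update_subset_insert[of fs i x] fs x by blast
    have "(fs[i := x])[i := fs[i := x] ! (n - 1), n - 1 := fs[i := x] ! i] = gs @ [x]"
      unfolding gs_def using len ij
      by (intro nth_equalityI) (auto simp: nth_append nth_butlast nth_list_update)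
    then have "br (gs @ [x]) = (\<lambda>p. - br (fs[i := x]) p)"
      using nambu_skew[OF br _ s ij] len by simp
    then show ?thesis by simp
  qed
  moreover have "set gs \<subseteq> set fs"
  proof
    fix x assume "x \<in> set gs"
    then have "x \<in> set (fs[i := fs ! (n - 1)])" unfolding gs_def by (rule in_set_butlastD)
    then show "x \<in> set fs" using set_update_subset_insert[of fs i "fs ! (n - 1)"] len ij(2) by auto
  qed
  moreover have "Suc (length gs) = n" using len i by (simp add: gs_def)
  ultimately show ?thesis by blast
qed

text \<open>This vector is \<open>\<Pi>\<^sup>\<sharp> (df\<^sub>1 \<and> \<dots> \<and> df\<^sub>n\<^sub>-\<^sub>1)\<close> at \<open>p\<close>. By the Leibniz rule it is a derivation, so
  nothing has to be constructed to see that it is tangent.\<close>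

definition nambu_vector ::
  "('a, 'e::euclidean_space) manifold \<Rightarrow> (('a \<Rightarrow> real) list \<Rightarrow> 'a \<Rightarrow> real) \<Rightarrow> ('a \<Rightarrow> real) list \<Rightarrow> 'a \<Rightarrow> 'a tangent" where
  "nambu_vector M br fs p = (\<lambda>g. if g \<in> smooth_funs M then br (fs @ [g]) p else 0)"

lemma nambu_vector_tangent:
  assumes br: "nambu_poisson_bracket n M br" and len: "Suc (length fs) = n" and fs: "set fs \<subseteq> smooth_funs M"
  shows "nambu_vector M br fs p \<in> tangent_space M p"
  unfolding tangent_space_def
proof (rule CollectI, intro conjI ballI allI impI)
  fix f g a b assume fg: "f \<in> smooth_funs M" "g \<in> smooth_funs M"
  have "br ((fs @ [f])[length fs := \<lambda>x. a * f x + b * g x]) =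
      (\<lambda>x. a * br ((fs @ [f])[length fs := f]) x + b * br ((fs @ [f])[length fs := g]) x)"
    by (rule nambu_lincomb[OF br]) (use len fs fg in auto)
  then show "nambu_vector M br fs p (\<lambda>x. a * f x + b * g x) =
      a * nambu_vector M br fs p f + b * nambu_vector M br fs p g"
    by (simp add: nambu_vector_def fg smooth_funs_lincomb)
next
  fix f g assume fg: "f \<in> smooth_funs M" "g \<in> smooth_funs M"
  show "nambu_vector M br fs p (\<lambda>x. f x * g x) = f p * nambu_vector M br fs p g + nambu_vector M br fs p f * g p"
    using nambu_Leibniz[OF br len fs fg] by (simp add: nambu_vector_def fg smooth_funs_mult)
qed (simp add: nambu_vector_def)

lemma nambu_slot_differential:
  assumes br: "nambu_poisson_bracket n M br" and len: "length fs = n" and fs: "set fs \<subseteq> smooth_funs M" and i: "i < n"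
    and gh: "g \<in> smooth_funs M" "h \<in> smooth_funs M" "differential M p g = differential M p h"
  shows "br (fs[i := g]) p = br (fs[i := h]) p"
proof -
  obtain gs c where gs: "Suc (length gs) = n" "set gs \<subseteq> set fs"
    "\<forall>x\<in>smooth_funs M. \<forall>p. br (fs[i := x]) p = c * br (gs @ [x]) p"
    using nambu_slot[OF br len fs i] by blast
  have v: "nambu_vector M br gs p \<in> tangent_space M p" by (rule nambu_vector_tangent[OF br gs(1)]) (use gs(2) fs in blast)
  have "nambu_vector M br gs p g = nambu_vector M br gs p h"
    using fun_cong[OF gh(3), of "nambu_vector M br gs p"] v by (simp add: differential_def)
  then show ?thesis using gs(3) gh by (simp add: nambu_vector_def)
qed

text \<open>To compare two brackets, change one argument at a time.\<close>

lemma change_slots: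
  assumes len: "length fs = n" "length gs = n"
    and step: "\<And>hs i. i < n \<Longrightarrow> length hs = n \<Longrightarrow> set hs \<subseteq> set fs \<union> set gs \<Longrightarrow>
      P (hs[i := fs ! i]) = P (hs[i := gs ! i])"
  shows "P fs = P gs"
proof -
  have "k \<le> n \<Longrightarrow> P (take k gs @ drop k fs) = P fs" for k
  proof (induction k)
    case (Suc k)
    let ?hs = "take k gs @ drop k fs"
    have k: "k < n" using Suc.prems by simp
    have e1: "?hs[k := fs ! k] = ?hs"
      using k len by (intro nth_equalityI) (auto simp: nth_append nth_list_update)
    have e2: "?hs[k := gs ! k] = take (Suc k) gs @ drop (Suc k) fs"
      using k len by (intro nth_equalityI) (auto simp: nth_append nth_list_update less_Suc_eq)
    have "P (?hs[k := fs ! k]) = P (?hs[k := gs ! k])"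
      by (rule step) (use k len in \<open>auto dest: in_set_takeD in_set_dropD\<close>)
    then show ?case using Suc.IH k unfolding e1 e2 by simp
  qed simp
  from this[of n] show ?thesis using len by simp
qed

text \<open>The functions chosen in the definition of the Nambu tensor have the same differentials as \<open>fs\<close>, and the
  bracket at \<open>p\<close> depends on its arguments through their differentials only.\<close>

lemma nambu_tensor_differential:
  assumes br: "nambu_poisson_bracket n M br" and len: "length fs = n" and fs: "set fs \<subseteq> smooth_funs M"
  shows "nambu_tensor M br p (map (differential M p) fs) = br fs p"
proof -
  define r where "r \<alpha> = (SOME f. f \<in> smooth_funs M \<and> differential M p f = \<alpha>)" for \<alpha>
  have r: "r (differential M p f) \<in> smooth_funs M \<and> differential M p (r (differential M p f)) = differential M p f"
    if "f \<in> smooth_funs M" for f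
    unfolding r_def by (rule someI[of "\<lambda>g. g \<in> smooth_funs M \<and> differential M p g = differential M p f" f]) (use that in simp)
  let ?gs = "map (\<lambda>f. r (differential M p f)) fs"
  have "br ?gs p = br fs p"
  proof (rule change_slots[of _ n _ "\<lambda>fs. br fs p"])
    fix hs i assume hs: "i < n" "length hs = n" "set hs \<subseteq> set ?gs \<union> set fs"
    have fi: "fs ! i \<in> smooth_funs M" using fs hs(1) len by auto
    show "br (hs[i := ?gs ! i]) p = br (hs[i := fs ! i]) p"
      by (rule nambu_slot_differential[OF br hs(2) _ hs(1)]) (use hs fs r r[OF fi] fi len in auto)
  qed (use len in auto)
  then show ?thesis unfolding nambu_tensor_def r_def[symmetric] by (simp add: o_def)
qed

lemma nambu_vector_sharp:
  assumes M: "smooth_manifold M" and br: "nambu_poisson_bracket n M br" and p: "p \<in> pts M"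
    and len: "Suc (length fs) = n" and fs: "set fs \<subseteq> smooth_funs M"
  shows "(wedge (map (differential M p) fs), nambu_vector M br fs p) \<in> nambu_sharp n M br p"
proof -
  let ?as = "map (differential M p) fs" and ?v = "nambu_vector M br fs p"
  have cot: "set ?as \<subseteq> cotangent_space M p" using differential_in_cotangent_space[OF M p] by auto
  have v: "?v \<in> tangent_space M p" by (rule nambu_vector_tangent[OF br len fs])
  have val: "\<beta> ?v = nambu_tensor M br p (?as @ [\<beta>])" if b: "\<beta> \<in> cotangent_space M p" for \<beta>
  proof -
    obtain g where g: "g \<in> smooth_funs M" "differential M p g = \<beta>" using cotangent_is_differential[OF M p b] by blast
    have "\<beta> ?v = br (fs @ [g]) p"
      unfolding g(2)[symmetric] differential_def using v g(1) by (simp add: nambu_vector_def)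
    also have "\<dots> = nambu_tensor M br p (map (differential M p) (fs @ [g]))"
      by (rule nambu_tensor_differential[OF br, symmetric]) (use len fs g(1) in auto)
    finally show ?thesis by (simp add: g(2))
  qed
  show ?thesis unfolding nambu_sharp_def
    by (rule CollectI, rule exI[of _ "[(1, ?as)]"], rule exI[of _ ?v]) (use cot v val len in simp)
qed

section \<open>Reduction\<close>

lemma local_frame_subset_tangent:
  assumes M: "smooth_manifold M" and sub: "pts N \<subseteq> pts M" and S: "vector_subbundle M N S" and p: "p \<in> pts N"
  shows "S p \<subseteq> tangent_space M p"
proof
  fix v assume v: "v \<in> S p"
  obtain U r X where fr: "p \<in> U" "local_frame M N S U r X"
    using S p unfolding vector_subbundle_def by blast
  note D = local_frameD[OF fr(2)]
  obtain a where a: "v = (\<lambda>f. \<Sum>i<r. a i * X i p f)" using v D(4)[OF fr(1)] by blast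
  have pM: "p \<in> pts M" using p sub by blast
  have "k \<le> r \<Longrightarrow> (\<lambda>f. \<Sum>i<k. a i * X i p f) \<in> tangent_space M p" for k
  proof (induction k)
    case 0
    obtain U \<phi> where c: "(U, \<phi>) \<in> mfd_atlas M" "p \<in> U" using chart_exists[OF M pM] by blast
    note t = tvec_in_tangent_space[OF M c, of 0]
    show ?case using tangent_space_lincomb[OF M pM t t, of 0 0] by simp
  next
    case (Suc k)
    then have "(\<lambda>f. 1 * (\<Sum>i<k. a i * X i p f) + a k * X k p f) \<in> tangent_space M p"
      using D(2)[OF _ fr(1)] by (intro tangent_space_lincomb[OF M pM]) auto
    then show ?case by simp
  qed
  then show "v \<in> tangent_space M p" unfolding a by blast
qed

lemma smooth_funs_annD:
  assumes "f \<in> smooth_funs_ann M A S" "p \<in> A" "v \<in> S p" "v \<in> tangent_space M p"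
  shows "v f = 0"
proof -
  have "differential M p f v = 0" using assms(1-3) unfolding smooth_funs_ann_def by blast
  then show ?thesis using assms(4) by (simp add: differential_def)
qed

lemma smooth_funs_ann_smooth: "smooth_funs_ann M A S \<subseteq> smooth_funs M"
  unfolding smooth_funs_ann_def by blast

lemma
  assumes "submanifold M N"
  shows submanifold_smooth_manifold: "smooth_manifold N" and submanifold_pts: "pts N \<subseteq> pts M"
    and submanifold_smooth_map: "smooth_map N M id"
  using assms by (auto simp: submanifold_def immersion_def)

text \<open>A bracket of functions annihilating \<open>E\<close> only depends on their restrictions to \<open>N\<close>. This is where the
  condition on \<open>\<Pi>\<^sup>\<sharp>\<close> enters.\<close>

context
  fixes n :: nat
    and M :: "('a, 'm::euclidean_space) manifold"
    and br :: "('a \<Rightarrow> real) list \<Rightarrow> 'a \<Rightarrow> real"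
    and N :: "('a, 'k::euclidean_space) manifold"
    and E D :: "'a \<Rightarrow> 'a tangent set"
  assumes M: "smooth_manifold M" and br: "nambu_poisson_bracket n M br"
    and N: "submanifold M N" and D: "vector_subbundle M N D"
    and DE: "\<forall>p\<in>pts N. D p \<subseteq> E p"
    and sharp: "\<forall>p\<in>pts N. nambu_sharp n M br p `` ann_forms M (n - 1) E p \<subseteq>
           {(\<lambda>f. u f + d f) | u d. u \<in> pushforward N M id ` tangent_space N p \<and> d \<in> D p}"
begin

abbreviation (input) "ann_E \<equiv> smooth_funs_ann M (pts N) E"
abbreviation (input) "ann_D \<equiv> smooth_funs_ann M (pts N) D"

lemma ann_E_subset_ann_D: "ann_E \<subseteq> ann_D"
  unfolding smooth_funs_ann_def using DE by blast

text \<open>With \<open>\<Pi>\<^sup>\<sharp> (df\<^sub>1 \<and> \<dots> \<and> df\<^sub>n\<^sub>-\<^sub>1) = u + d\<close>, where \<open>u\<close> is tangent to \<open>N\<close> and \<open>d\<close> is in \<open>D\<close>, the bracket is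
  \<open>u g + d g\<close>; the first summand vanishes as \<open>g\<close> is 0 on \<open>N\<close>, the second one as \<open>g\<close> annihilates \<open>D\<close>.\<close>

lemma bracket_vanishing_last:
  assumes p: "p \<in> pts N" and len: "Suc (length fs) = n" and fs: "set fs \<subseteq> ann_E"
    and g: "g \<in> ann_D" "pullback N id g = (\<lambda>_. 0)"
  shows "br (fs @ [g]) p = 0"
proof -
  have pM: "p \<in> pts M" using p submanifold_pts[OF N] by blast
  have fsM: "set fs \<subseteq> smooth_funs M" using fs smooth_funs_ann_smooth by blast
  have gM: "g \<in> smooth_funs M" using g(1) smooth_funs_ann_smooth by blast
  let ?as = "map (differential M p) fs" and ?v = "nambu_vector M br fs p"
  have kill: "\<forall>f\<in>set fs. \<forall>v\<in>E p. differential M p f v = 0"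
  proof
    fix f assume "f \<in> set fs"
    then have "f \<in> ann_E" using fs by blast
    then have 0: "\<forall>p\<in>pts N. \<forall>v\<in>E p. differential M p f v = 0" by (simp add: smooth_funs_ann_def)
    show "\<forall>v\<in>E p. differential M p f v = 0" by (rule bspec[OF 0 p])
  qed
  have cot: "set ?as \<subseteq> cotangent_space M p" using differential_in_cotangent_space[OF M pM] by auto
  have "wedge ?as \<in> ann_forms M (length ?as) E p"
    by (rule wedge_in_ann_forms[OF cot]) (use kill in auto)
  moreover have "length ?as = n - 1" using len by simp
  ultimately have ann: "wedge ?as \<in> ann_forms M (n - 1) E p" by (simp only:)
  have "?v \<in> nambu_sharp n M br p `` ann_forms M (n - 1) E p"
    by (rule ImageI[OF nambu_vector_sharp[OF M br pM len fsM] ann])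
  from subsetD[OF bspec[OF sharp p] this]
  obtain u d where ud: "?v = (\<lambda>f. u f + d f)" "u \<in> pushforward N M id ` tangent_space N p" "d \<in> D p"
    unfolding mem_Collect_eq by (elim exE conjE)
  obtain w where w: "w \<in> tangent_space N p" "u = pushforward N M id w" using ud(2) by blast
  have "u g = 0" using gM g(2) tangent_space_zero[OF w(1)] by (simp add: w(2) pushforward_def)
  moreover have "d \<in> tangent_space M p" using local_frame_subset_tangent[OF M submanifold_pts[OF N] D p] ud(3) by blast
  then have "d g = 0" by (rule smooth_funs_annD[where p = p, OF g(1) p ud(3)])
  ultimately have "?v g = 0" unfolding ud(1) by simp
  then show ?thesis using gM by (simp add: nambu_vector_def)
qed

text \<open>The arguments compared need to annihilate \<open>D\<close> only. The fundamental identity depends on this, since brackets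
  of functions in \<open>B\<close> annihilate \<open>D\<close> but perhaps not \<open>E\<close>.\<close>

lemma bracket_eq_slot:
  assumes p: "p \<in> pts N" and len: "length fs = n" and fs: "set fs \<subseteq> ann_E" and i: "i < n"
    and gh: "g \<in> ann_D" "h \<in> ann_D" "pullback N id g = pullback N id h"
  shows "br (fs[i := g]) p = br (fs[i := h]) p"
proof -
  have fsM: "set fs \<subseteq> smooth_funs M" using fs smooth_funs_ann_smooth by blast
  have ghM: "g \<in> smooth_funs M" "h \<in> smooth_funs M" using gh smooth_funs_ann_smooth by blast+
  obtain gs c where gs: "Suc (length gs) = n" "set gs \<subseteq> set fs"
    "\<forall>x\<in>smooth_funs M. \<forall>p. br (fs[i := x]) p = c * br (gs @ [x]) p"
    using nambu_slot[OF br len fsM i] by blast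
  let ?d = "\<lambda>x. 1 * g x + (-1) * h x"
  have dM: "?d \<in> smooth_funs M" by (rule smooth_funs_lincomb[OF ghM])
  have "?d \<in> ann_D"
    unfolding smooth_funs_ann_def
  proof (intro CollectI conjI ballI dM)
    fix q v assume q: "q \<in> pts N" "v \<in> D q"
    have v: "v \<in> tangent_space M q" using local_frame_subset_tangent[OF M submanifold_pts[OF N] D q(1)] q(2) by blast
    have "v g = 0" "v h = 0"
      by (rule smooth_funs_annD[where p = q, OF gh(1) q v], rule smooth_funs_annD[where p = q, OF gh(2) q v])
    then show "differential M q ?d v = 0"
      using tangent_space_lin[OF v ghM, of 1 "-1"] by (simp add: differential_def)
  qed
  moreover have "pullback N id ?d = (\<lambda>_. 0)"
    using gh(3) by (auto simp: pullback_def fun_eq_iff split: if_splits)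
  moreover have gsE: "set gs \<subseteq> ann_E" using gs(2) fs by blast
  ultimately have 0: "br (gs @ [?d]) p = 0"
    using bracket_vanishing_last[OF p gs(1) gsE] by blast
  have "nambu_vector M br gs p \<in> tangent_space M p"
    by (rule nambu_vector_tangent[OF br gs(1)]) (use gs(2) fsM in blast)
  from tangent_space_lin[OF this ghM, of 1 "-1"] have "br (gs @ [g]) p = br (gs @ [h]) p"
    using 0 dM ghM by (simp add: nambu_vector_def)
  then show ?thesis using gs(3) ghM by simp
qed

lemma bracket_eq_on_submanifold:
  assumes p: "p \<in> pts N" and len: "length fs = n" "length gs = n" and fs: "set fs \<subseteq> ann_E" "set gs \<subseteq> ann_E"
    and eq: "\<And>i. i < n \<Longrightarrow> pullback N id (fs ! i) = pullback N id (gs ! i)"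
  shows "br fs p = br gs p"
proof (rule change_slots[OF len, of "\<lambda>fs. br fs p"])
  fix hs i assume hs: "i < n" "length hs = n" "set hs \<subseteq> set fs \<union> set gs"
  show "br (hs[i := fs ! i]) p = br (hs[i := gs ! i]) p"
  proof (rule bracket_eq_slot[OF p hs(2) _ hs(1) _ _ eq[OF hs(1)]])
    show "set hs \<subseteq> ann_E" using hs(3) fs by blast
    have "fs ! i \<in> set fs" "gs ! i \<in> set gs" using len hs(1) by simp_all
    then show "fs ! i \<in> ann_D" "gs ! i \<in> ann_D" using fs ann_E_subset_ann_D by blast+
  qed
qed

end

theorem theorem4p1:
  fixes n :: nat
    and M :: "('a, 'm::euclidean_space) manifold"
    and br :: "('a \<Rightarrow> real) list \<Rightarrow> 'a \<Rightarrow> real"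
    and N :: "('a, 'k::euclidean_space) manifold"
    and E F D :: "'a \<Rightarrow> 'a tangent set"
    and Q :: "('a set, 'q::euclidean_space) manifold"
    and B :: "('a \<Rightarrow> real) set"
  assumes "nambu_poisson_manifold n M br"
    and "submanifold M N"
    and "vector_subbundle M N E"
    and "F = tangential_part M N E"
    and "regular_integrable N F Q"
    and "vector_subbundle M N D"
    and "\<forall>p\<in>pts N. pushforward N M id ` F p \<subseteq> D p \<and> D p \<subseteq> E p"
    and "\<forall>p\<in>pts N. nambu_sharp n M br p `` ann_forms M (n - 1) E p \<subseteq>
           {(\<lambda>f. u f + d f) | u d. u \<in> pushforward N M id ` tangent_space N p \<and> d \<in> D p}"
    and "mult_subalgebra B"
    and "B \<subseteq> smooth_funs_ann M (pts N) E"
    and "pullback N id ` B = smooth_funs_ann N (pts N) F"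
    and "\<forall>fs. length fs = n \<and> set fs \<subseteq> B \<longrightarrow> br fs \<in> smooth_funs_ann M (pts N) D"
  shows "nambu_reducible n M br N E Q"
proof -
  have M: "smooth_manifold M" and br: "nambu_poisson_bracket n M br"
    using assms(1) by (auto simp: nambu_poisson_manifold_def)
  note sub = assms(2) and F = assms(4) and D = assms(6)
  have cr: "constant_rank_distribution N F" and int: "integrable_distribution N F"
    and Q: "smooth_manifold Q" and ptsQ: "pts Q = leaf N F ` pts N" and subm: "submersion N Q (leaf N F)"
    using assms(5) by (auto simp: regular_integrable_def)
  have FD: "\<And>p. p \<in> pts N \<Longrightarrow> pushforward N M id ` F p \<subseteq> D p" and DE: "\<forall>p\<in>pts N. D p \<subseteq> E p"
    using assms(7) by auto
  note setting = M br sub D DE assms(8)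
  note N_mfd = submanifold_smooth_manifold[OF sub] and N_map = submanifold_smooth_map[OF sub]
  let ?\<pi> = "leaf N F" and ?CE = "smooth_funs_ann M (pts N) E" and ?CD = "smooth_funs_ann M (pts N) D"
  note CED = ann_E_subset_ann_D[OF setting, THEN subsetD]
  note eq_on = bracket_eq_on_submanifold[OF setting]
  note eq_slot = bracket_eq_slot[OF setting]
  have Ftan: "F p \<subseteq> tangent_space N p" for p unfolding F tangential_part_def by blast
  have pi_map: "smooth_map N Q ?\<pi>" using subm by (simp add: submersion_def)
  have BCE: "B \<subseteq> ?CE" by (rule assms(10))
  have BM: "B \<subseteq> smooth_funs M" using BCE smooth_funs_ann_smooth by blast
  have B_lin: "(\<lambda>x. a * f x + b * g x) \<in> B" if "f \<in> B" "g \<in> B" for f g a b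
    using assms(9) that unfolding mult_subalgebra_def by blast
  have B_mult: "(\<lambda>x. f x * g x) \<in> B" if "f \<in> B" "g \<in> B" for f g
    using assms(9) that unfolding mult_subalgebra_def by blast
  \<comment> \<open>A pull-back from the leaf space is constant on leaves, hence killed by \<open>F\<close>, hence the restriction of a function in \<open>B\<close>.\<close>
  have pull_F: "pullback N ?\<pi> f \<in> smooth_funs_ann N (pts N) F" if f: "f \<in> smooth_funs Q" for f
  proof -
    have s: "pullback N ?\<pi> f \<in> smooth_funs N" by (rule pullback_smooth[OF N_mfd Q pi_map f])
    moreover have "differential N p (pullback N ?\<pi> f) v = 0" if p: "p \<in> pts N" and v: "v \<in> F p" for p v
    proof -
      have "pullback N ?\<pi> f q = pullback N ?\<pi> f p" if "q \<in> pts N" "leaf N F q = leaf N F p" for q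
        unfolding pullback_def using that p by simp
      from distribution_kills_leafwise_constant[where F = F and v = v, OF N_mfd cr int p v s this]
      have "v (pullback N ?\<pi> f) = 0" .
      then show ?thesis by (simp add: differential_def)
    qed
    ultimately show ?thesis by (simp add: smooth_funs_ann_def)
  qed
  define e where "e f = (SOME b. b \<in> B \<and> pullback N id b = pullback N ?\<pi> f)" for f
  have e: "e f \<in> B" "pullback N id (e f) = pullback N ?\<pi> f" if f: "f \<in> smooth_funs Q" for f
  proof -
    have "\<exists>b. b \<in> B \<and> pullback N id b = pullback N ?\<pi> f"
      using pull_F[OF f] unfolding assms(11)[symmetric] by (metis imageE)
    then have "e f \<in> B \<and> pullback N id (e f) = pullback N ?\<pi> f" unfolding e_def by (rule someI_ex)
    then show "e f \<in> B" "pullback N id (e f) = pullback N ?\<pi> f" by auto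
  qed
  have eM: "e f \<in> smooth_funs M" if "f \<in> smooth_funs Q" for f using e(1)[OF that] BM by blast
  have eB: "set (map e fs) \<subseteq> B" if "set fs \<subseteq> smooth_funs Q" for fs using e(1) that by auto
  \<comment> \<open>The point chosen over \<open>y\<close> does not matter: the bracket annihilates \<open>D\<close>, hence \<open>F\<close>, so it is constant on leaves.\<close>
  define brQ where "brQ fs y = (if y \<in> pts Q then br (map e fs) (SOME q. q \<in> pts N \<and> ?\<pi> q = y) else 0)" for fs y
  have brCD: "br fs \<in> ?CD" if "length fs = n" "set fs \<subseteq> B" for fs using assms(12) that by blast
  have key0: "brQ fs \<in> smooth_funs Q \<and> (\<forall>q\<in>pts N. brQ fs (?\<pi> q) = br (map e fs) q)"
    if len: "length fs = n" and fs: "set fs \<subseteq> smooth_funs Q" for fs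
  proof -
    let ?H = "br (map e fs)"
    have H: "?H \<in> ?CD" by (rule brCD) (use len eB[OF fs] in auto)
    then have HM: "?H \<in> smooth_funs M" using smooth_funs_ann_smooth by blast
    have hN: "pullback N id ?H \<in> smooth_funs N" by (rule pullback_smooth[OF N_mfd M N_map HM])
    have kill: "F p \<subseteq> {v. v (pullback N id ?H) = 0}" if p: "p \<in> pts N" for p
    proof
      fix v assume v: "v \<in> F p"
      have "pushforward N M id v \<in> D p" using FD[OF p] v by blast
      moreover have "pushforward N M id v \<in> tangent_space M p"
        using pushforward_in_tangent_space[OF N_mfd M N_map p subsetD[OF Ftan v]] by simp
      ultimately have "pushforward N M id v ?H = 0" by (rule smooth_funs_annD[where p = p, OF H p])
      then show "v \<in> {v. v (pullback N id ?H) = 0}" using HM by (simp add: pushforward_def)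
    qed
    have val: "brQ fs (?\<pi> q) = pullback N id ?H q" if q: "q \<in> pts N" for q
    proof -
      define q' where "q' = (SOME q'. q' \<in> pts N \<and> ?\<pi> q' = ?\<pi> q)"
      have q': "q' \<in> pts N \<and> ?\<pi> q' = ?\<pi> q" unfolding q'_def by (rule someI[of _ q]) (use q in simp)
      then have "q' \<in> ?\<pi> q" using leaf_self[OF N_mfd cr int, of q'] by auto
      then have "pullback N id ?H q' = pullback N id ?H q"
        by (intro killed_by_distribution_leafwise_constant[where F = F, OF N_mfd hN]) (use kill in blast)+
      then have "?H q' = ?H q" using q q' by (simp add: pullback_def)
      moreover have "brQ fs (?\<pi> q) = ?H q'" unfolding brQ_def q'_def using q ptsQ by simp
      ultimately show ?thesis using q by (simp add: pullback_def)
    qed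
    have "brQ fs \<in> smooth_funs Q"
      by (rule submersion_descent[OF N_mfd Q subm ptsQ[symmetric] hN val]) (simp_all add: brQ_def)
    then show ?thesis using val by (simp add: pullback_def)
  qed
  have key: "brQ fs (?\<pi> q) = br Fs q"
    if len: "length fs = n" "length Fs = n" and fs: "set fs \<subseteq> smooth_funs Q" and Fs: "set Fs \<subseteq> ?CE"
      and ext: "\<And>i. i < n \<Longrightarrow> pullback N id (Fs ! i) = pullback N ?\<pi> (fs ! i)" and q: "q \<in> pts N" for fs Fs q
  proof -
    have "br (map e fs) q = br Fs q"
    proof (rule eq_on[OF q _ len(2) _ Fs])
      show "length (map e fs) = n" using len(1) by simp
      show "set (map e fs) \<subseteq> ?CE" using eB[OF fs] BCE by blast
      fix i assume i: "i < n"
      then have "fs ! i \<in> smooth_funs Q" using fs len(1) by auto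
      from e(2)[OF this] show "pullback N id (map e fs ! i) = pullback N id (Fs ! i)" using ext[OF i] i len(1) by simp
    qed
    then show ?thesis using key0[OF len(1) fs] q by simp
  qed
  have closed: "brQ fs \<in> smooth_funs Q" if "length fs = n" "set fs \<subseteq> smooth_funs Q" for fs
    using key0[OF that] by blast
  have eqI: "g = h" if "\<And>q. q \<in> pts N \<Longrightarrow> g (?\<pi> q) = h (?\<pi> q)" "\<And>y. y \<notin> pts Q \<Longrightarrow> g y = h y" for g h :: "'a set \<Rightarrow> real"
    using that ptsQ by (metis ext imageE)
  have brQ_0: "brQ fs y = 0" if "y \<notin> pts Q" for fs y using that by (simp add: brQ_def)
  \<comment> \<open>In the axioms below the chosen extension of a combination of functions is replaced by the combination of the chosen extensions.\<close>
  have key_upd: "brQ (fs[i := g]) (?\<pi> q) = br ((map e fs)[i := G]) q"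
    if len: "length fs = n" and fs: "set fs \<subseteq> smooth_funs Q" and i: "i < n" and g: "g \<in> smooth_funs Q"
      and G: "G \<in> B" "pullback N id G = pullback N ?\<pi> g" and q: "q \<in> pts N" for fs i g G q
  proof (rule key[OF _ _ _ _ _ q])
    show "set (fs[i := g]) \<subseteq> smooth_funs Q" using set_update_subset_insert[of fs i g] fs g by blast
    show "set ((map e fs)[i := G]) \<subseteq> ?CE"
      using set_update_subset_insert[of "map e fs" i G] eB[OF fs] G(1) BCE by blast
    fix j assume j: "j < n"
    then have "fs ! j \<in> smooth_funs Q" using fs len by auto
    from e(2)[OF this] show "pullback N id ((map e fs)[i := G] ! j) = pullback N ?\<pi> (fs[i := g] ! j)"
      using G(2) j len by (cases "i = j") auto
  qed (use len in auto)
  have fsB: "set (map e fs) \<subseteq> smooth_funs M" if "set fs \<subseteq> smooth_funs Q" for fs using eB[OF that] BM by blast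
  have "nambu_poisson_bracket n Q brQ"
    unfolding nambu_poisson_bracket_def
  proof (intro conjI allI impI)
    show "brQ fs \<in> smooth_funs Q" if "length fs = n \<and> set fs \<subseteq> smooth_funs Q" for fs
      using closed that by blast
  next
    fix fs i g h a b
    assume *: "length fs = n \<and> set fs \<subseteq> smooth_funs Q \<and> i < n \<and> g \<in> smooth_funs Q \<and> h \<in> smooth_funs Q"
    then have len: "length fs = n" and fs: "set fs \<subseteq> smooth_funs Q" and i: "i < n"
      and gh: "g \<in> smooth_funs Q" "h \<in> smooth_funs Q" by auto
    show "brQ (fs[i := \<lambda>x. a * g x + b * h x]) = (\<lambda>x. a * brQ (fs[i := g]) x + b * brQ (fs[i := h]) x)"
    proof (rule eqI)
      fix q assume q: "q \<in> pts N"
      have comb: "pullback N id (\<lambda>x. a * e g x + b * e h x) = pullback N ?\<pi> (\<lambda>x. a * g x + b * h x)"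
        using e(2)[OF gh(1)] e(2)[OF gh(2)] by (auto simp: pullback_def fun_eq_iff split: if_splits)
      have "brQ (fs[i := \<lambda>x. a * g x + b * h x]) (?\<pi> q) = br ((map e fs)[i := \<lambda>x. a * e g x + b * e h x]) q"
        by (rule key_upd[OF len fs i smooth_funs_lincomb[OF gh] B_lin[OF e(1)[OF gh(1)] e(1)[OF gh(2)]] comb q])
      also have "\<dots> = a * br ((map e fs)[i := e g]) q + b * br ((map e fs)[i := e h]) q"
        using nambu_lincomb[OF br _ fsB[OF fs] i eM[OF gh(1)] eM[OF gh(2)], of a b] len by simp
      also have "\<dots> = a * brQ (fs[i := g]) (?\<pi> q) + b * brQ (fs[i := h]) (?\<pi> q)"
        using key_upd[OF len fs i gh(1) e(1)[OF gh(1)] e(2)[OF gh(1)] q]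
          key_upd[OF len fs i gh(2) e(1)[OF gh(2)] e(2)[OF gh(2)] q] by simp
      finally show "brQ (fs[i := \<lambda>x. a * g x + b * h x]) (?\<pi> q) =
          a * brQ (fs[i := g]) (?\<pi> q) + b * brQ (fs[i := h]) (?\<pi> q)" .
    qed (simp add: brQ_0)
  next
    fix fs i j
    assume *: "length fs = n \<and> set fs \<subseteq> smooth_funs Q \<and> i < j \<and> j < n"
    then have len: "length fs = n" and fs: "set fs \<subseteq> smooth_funs Q" and ij: "i < j" "j < n" by auto
    show "brQ (fs[i := fs ! j, j := fs ! i]) = (\<lambda>x. - brQ fs x)"
    proof (rule eqI)
      fix q assume q: "q \<in> pts N"
      have s: "set (fs[i := fs ! j, j := fs ! i]) = set fs"
        using ij len by (simp add: set_swap)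
      have m: "map e (fs[i := fs ! j, j := fs ! i]) = (map e fs)[i := map e fs ! j, j := map e fs ! i]"
        using ij len by (simp add: map_update)
      have "brQ (fs[i := fs ! j, j := fs ! i]) (?\<pi> q) = br (map e (fs[i := fs ! j, j := fs ! i])) q"
        using key0[of "fs[i := fs ! j, j := fs ! i]"] len fs s q by simp
      also have "\<dots> = - br (map e fs) q" unfolding m
        using nambu_skew[OF br _ fsB[OF fs] ij] len by simp
      also have "\<dots> = - brQ fs (?\<pi> q)" using key0[OF len fs] q by simp
      finally show "brQ (fs[i := fs ! j, j := fs ! i]) (?\<pi> q) = - brQ fs (?\<pi> q)" .
    qed (simp add: brQ_0)
  next
    fix fs g h
    assume *: "Suc (length fs) = n \<and> set fs \<subseteq> smooth_funs Q \<and> g \<in> smooth_funs Q \<and> h \<in> smooth_funs Q"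
    then have len: "Suc (length fs) = n" and fs: "set fs \<subseteq> smooth_funs Q"
      and gh: "g \<in> smooth_funs Q" "h \<in> smooth_funs Q" by auto
    have last: "brQ (fs @ [k]) (?\<pi> q) = br (map e fs @ [K]) q"
      if "k \<in> smooth_funs Q" "K \<in> B" "pullback N id K = pullback N ?\<pi> k" "q \<in> pts N" for k K q
      using key_upd[of "fs @ [k]" "length fs" k K q] that len fs by (simp add: list_update_append)
    show "brQ (fs @ [\<lambda>x. g x * h x]) = (\<lambda>x. g x * brQ (fs @ [h]) x + brQ (fs @ [g]) x * h x)"
    proof (rule eqI)
      fix q assume q: "q \<in> pts N"
      have at_q: "e g q = g (?\<pi> q)" "e h q = h (?\<pi> q)"
        using fun_cong[OF e(2)[OF gh(1)], of q] fun_cong[OF e(2)[OF gh(2)], of q] q by (simp_all add: pullback_def)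
      have prod: "pullback N id (\<lambda>x. e g x * e h x) = pullback N ?\<pi> (\<lambda>x. g x * h x)"
        using e(2)[OF gh(1)] e(2)[OF gh(2)] by (auto simp: pullback_def fun_eq_iff split: if_splits)
      have "brQ (fs @ [\<lambda>x. g x * h x]) (?\<pi> q) = br (map e fs @ [\<lambda>x. e g x * e h x]) q"
        by (rule last[OF smooth_funs_mult[OF gh] B_mult[OF e(1)[OF gh(1)] e(1)[OF gh(2)]] prod q])
      also have "\<dots> = e g q * br (map e fs @ [e h]) q + br (map e fs @ [e g]) q * e h q"
        using nambu_Leibniz[OF br _ fsB[OF fs] eM[OF gh(1)] eM[OF gh(2)]] len by simp
      also have "\<dots> = g (?\<pi> q) * brQ (fs @ [h]) (?\<pi> q) + brQ (fs @ [g]) (?\<pi> q) * h (?\<pi> q)"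
        using last[OF gh(1) e(1)[OF gh(1)] e(2)[OF gh(1)] q] last[OF gh(2) e(1)[OF gh(2)] e(2)[OF gh(2)] q] at_q by simp
      finally show "brQ (fs @ [\<lambda>x. g x * h x]) (?\<pi> q) =
          g (?\<pi> q) * brQ (fs @ [h]) (?\<pi> q) + brQ (fs @ [g]) (?\<pi> q) * h (?\<pi> q)" .
    qed (simp add: brQ_0)
  next
    fix gs fs
    assume *: "Suc (length gs) = n \<and> set gs \<subseteq> smooth_funs Q \<and> length fs = n \<and> set fs \<subseteq> smooth_funs Q"
    then have leng: "Suc (length gs) = n" and gs: "set gs \<subseteq> smooth_funs Q"
      and len: "length fs = n" and fs: "set fs \<subseteq> smooth_funs Q" by auto
    \<comment> \<open>A bracket of functions in \<open>B\<close> only annihilates \<open>D\<close>, yet may replace an extension in \<open>B\<close> in one slot.\<close>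
    have swap: "brQ (hs[i := brQ ks]) (?\<pi> q) = br ((map e hs)[i := br (map e ks)]) q"
      if "length hs = n" "set hs \<subseteq> smooth_funs Q" "length ks = n" "set ks \<subseteq> smooth_funs Q" "i < n" "q \<in> pts N"
      for hs ks i q
    proof -
      have k: "brQ ks \<in> smooth_funs Q" by (rule closed[OF that(3,4)])
      have "br ((map e hs)[i := e (brQ ks)]) q = br ((map e hs)[i := br (map e ks)]) q"
      proof (rule eq_slot[OF that(6) _ _ that(5)])
        show "set (map e hs) \<subseteq> ?CE" using eB[OF that(2)] BCE by blast
        show "e (brQ ks) \<in> ?CD" using e(1)[OF k] BCE CED by blast
        show "br (map e ks) \<in> ?CD" by (rule brCD) (use that eB[OF that(4)] in auto)
        show "pullback N id (e (brQ ks)) = pullback N id (br (map e ks))"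
          unfolding e(2)[OF k] using key0[OF that(3,4)] by (auto simp: pullback_def fun_eq_iff)
      qed (use that in simp)
      then show ?thesis using key_upd[OF that(1,2,5) k e(1)[OF k] e(2)[OF k] that(6)] by simp
    qed
    show "brQ (gs @ [brQ fs]) = (\<lambda>x. \<Sum>k<n. brQ (fs[k := brQ (gs @ [fs ! k])]) x)"
    proof (rule eqI)
      fix q assume q: "q \<in> pts N"
      have z: "(\<lambda>_. 0) \<in> smooth_funs Q" by (rule smooth_funs_zero)
      have "brQ (gs @ [brQ fs]) (?\<pi> q) = br (map e gs @ [br (map e fs)]) q"
        using swap[of "gs @ [\<lambda>_. 0]" fs "length gs" q] leng gs len fs z q by (simp add: list_update_append)
      also have "\<dots> = (\<Sum>k<n. br ((map e fs)[k := br (map e gs @ [map e fs ! k])]) q)"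
        using nambu_fundamental[OF br _ fsB[OF gs] _ fsB[OF fs]] leng len by simp
      also have "\<dots> = (\<Sum>k<n. brQ (fs[k := brQ (gs @ [fs ! k])]) (?\<pi> q))"
      proof (rule sum.cong[OF refl])
        fix k assume "k \<in> {..<n}"
        then have k: "k < n" by simp
        then have "fs ! k \<in> smooth_funs Q" using fs len by auto
        then show "br ((map e fs)[k := br (map e gs @ [map e fs ! k])]) q = brQ (fs[k := brQ (gs @ [fs ! k])]) (?\<pi> q)"
          using swap[OF len fs _ _ k q, of "gs @ [fs ! k]"] leng gs len k by simp
      qed
      finally show "brQ (gs @ [brQ fs]) (?\<pi> q) = (\<Sum>k<n. brQ (fs[k := brQ (gs @ [fs ! k])]) (?\<pi> q))" .
    qed (simp add: brQ_0)
  qed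
  moreover have "pullback N ?\<pi> (brQ fs) = pullback N id (br Fs)"
    if "length fs = n \<and> length Fs = n \<and> set fs \<subseteq> smooth_funs Q \<and> set Fs \<subseteq> ?CE \<and>
      (\<forall>i<n. pullback N id (Fs ! i) = pullback N ?\<pi> (fs ! i))" for fs Fs
    using key[of fs Fs] that by (auto simp: pullback_def)
  ultimately show ?thesis unfolding nambu_reducible_def F[symmetric] by blast
qed

end
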